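(* Every finite connected non-bipartite Cayley graph of even order and of degree at least $5$ is $2$-extendable.
   Context: Graphs are finite and simple: a Cayley graph is $\mathrm{Cay}(\Gamma,C)$ for a finite group $\Gamma$ and an inverse-closed subset $C\subseteq\Gamma$ not containing the identity, with vertex set $\Gamma$ and with $x,y$ adjacent iff $x^{-1}y\in C$; its degree is $|C|$. A connected graph of even order $n$ is $q$-extendable, where $q$ is an integer with $0\le q<n/2$, if it has a perfect matching and every matching of size $q$ is contained in one of its perfect matchings. *)

theory Defs
  imports
    "HOL-Algebra.Group"
    "Graph_Theory.Digraph_Component"
    "Graph_Theory.Pair_Digraph"
begin

text \<open>
  Finite simple graphs are the instances of the locale \<^locale>\<open>pair_graph\<close>: finite, loop-free,
  symmetric relations. An undirected edge is the two-element set of its end vertices, so the two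
  arcs \<open>(u, v)\<close> and \<open>(v, u)\<close> give one edge.
\<close>

definition graph_edges :: "'a pair_pre_digraph \<Rightarrow> 'a set set" where
  "graph_edges X = (\<lambda>(u, v). {u, v}) ` parcs X"

definition bipartite_graph :: "'a pair_pre_digraph \<Rightarrow> bool" where
  "bipartite_graph X \<longleftrightarrow>
    (\<exists>A B. A \<union> B = pverts X \<and> A \<inter> B = {} \<and> parcs X \<subseteq> A \<times> B \<union> B \<times> A)"

definition graph_matching :: "'a pair_pre_digraph \<Rightarrow> 'a set set \<Rightarrow> bool" where
  "graph_matching X M \<longleftrightarrow> M \<subseteq> graph_edges X \<and> pairwise disjnt M"

definition perfect_matching :: "'a pair_pre_digraph \<Rightarrow> 'a set set \<Rightarrow> bool" where
  "perfect_matching X M \<longleftrightarrow> graph_matching X M \<and> \<Union>M = pverts X"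

text \<open>
  Extendability is only defined for finite simple connected graphs of even order \<open>n\<close> and
  \<open>q < n/2\<close>; these requirements are part of the predicate. The name
  \<open>connected\<close> is qualified because topological connectedness is also in scope.
\<close>

definition extendable :: "nat \<Rightarrow> 'a pair_pre_digraph \<Rightarrow> bool" where
  "extendable q X \<longleftrightarrow>
    pair_graph X \<and> Digraph_Component.connected (with_proj X) \<and>
    even (card (pverts X)) \<and> 2 * q < card (pverts X) \<and>
    (\<exists>P. perfect_matching X P) \<and>
    (\<forall>M. graph_matching X M \<and> card M = q \<longrightarrow> (\<exists>P. perfect_matching X P \<and> M \<subseteq> P))"

definition cayley_graph :: "('a, 'b) monoid_scheme \<Rightarrow> 'a set \<Rightarrow> 'a pair_pre_digraph" where
  "cayley_graph \<Gamma> C =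
    \<lparr> pverts = carrier \<Gamma>,
      parcs = {(x, y). x \<in> carrier \<Gamma> \<and> y \<in> carrier \<Gamma> \<and> inv\<^bsub>\<Gamma>\<^esub> x \<otimes>\<^bsub>\<Gamma>\<^esub> y \<in> C} \<rparr>"

definition connection_set :: "('a, 'b) monoid_scheme \<Rightarrow> 'a set \<Rightarrow> bool" where
  "connection_set \<Gamma> C \<longleftrightarrow>
    C \<subseteq> carrier \<Gamma> \<and> (\<forall>c\<in>C. inv\<^bsub>\<Gamma>\<^esub> c \<in> C) \<and> \<one>\<^bsub>\<Gamma>\<^esub> \<notin> C"

lemma pair_graph_cayley_graph:
  fixes \<Gamma> :: "('a, 'b) monoid_scheme"
  assumes "group \<Gamma>" and "finite (carrier \<Gamma>)" and "connection_set \<Gamma> C"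
  shows "pair_graph (cayley_graph \<Gamma> C)"
proof -
  interpret group \<Gamma> by fact
  let ?X = "cayley_graph \<Gamma> C"
  have sym: "(y, x) \<in> parcs ?X" if "(x, y) \<in> parcs ?X" for x y
  proof -
    from that have xy: "x \<in> carrier \<Gamma>" "y \<in> carrier \<Gamma>" "inv\<^bsub>\<Gamma>\<^esub> x \<otimes>\<^bsub>\<Gamma>\<^esub> y \<in> C"
      by (auto simp: cayley_graph_def)
    then have "inv\<^bsub>\<Gamma>\<^esub> (inv\<^bsub>\<Gamma>\<^esub> x \<otimes>\<^bsub>\<Gamma>\<^esub> y) = inv\<^bsub>\<Gamma>\<^esub> y \<otimes>\<^bsub>\<Gamma>\<^esub> x"
      by (simp add: inv_mult_group)
    with xy assms(3) show ?thesis
      by (force simp: cayley_graph_def connection_set_def)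
  qed
  have sub: "parcs ?X \<subseteq> carrier \<Gamma> \<times> carrier \<Gamma>"
    by (auto simp: cayley_graph_def)
  show ?thesis
  proof
    show "finite (pverts ?X)"
      using assms(2) by (simp add: cayley_graph_def)
    show "finite (parcs ?X)"
      using finite_subset[OF sub] assms(2) by simp
    show "symmetric (with_proj ?X)"
      using sym by (auto simp: symmetric_def intro: symI)
    show "fst e \<noteq> snd e" if "e \<in> parcs ?X" for e
      using that assms(3) by (auto simp: cayley_graph_def connection_set_def)
  qed (auto simp: cayley_graph_def)
qed

text \<open>Hence the degree of a Cayley graph can be written as \<^term>\<open>card C\<close>.\<close>

lemma out_degree_cayley_graph:
  fixes \<Gamma> :: "('a, 'b) monoid_scheme"
  assumes "group \<Gamma>" and "connection_set \<Gamma> C" and "x \<in> carrier \<Gamma>"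
  shows "out_degree (with_proj (cayley_graph \<Gamma> C)) x = card C"
proof -
  interpret group \<Gamma> by fact
  have C: "C \<subseteq> carrier \<Gamma>"
    using assms(2) by (simp add: connection_set_def)
  have "bij_betw (\<lambda>c. (x, x \<otimes>\<^bsub>\<Gamma>\<^esub> c)) C (out_arcs (with_proj (cayley_graph \<Gamma> C)) x)"
  proof (rule bij_betw_byWitness[where f' = "\<lambda>(u, v). inv\<^bsub>\<Gamma>\<^esub> u \<otimes>\<^bsub>\<Gamma>\<^esub> v"])
  qed (use C assms(3) in
      \<open>auto simp: out_arcs_def cayley_graph_def m_assoc[symmetric] subset_iff\<close>)
  then show ?thesis
    by (simp add: out_degree_def bij_betw_same_card)
qed

end

(* If two independent edges lie in no perfect matching, Tutte's theorem yields a set S containing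
   them and a partition of V - S into |S| - 2 odd parts without edges between distinct parts. Since
   right multiplication by a generator is a permutation, each generator c satisfies
     #{x in S. x c in S} + (sum over the p non-singleton parts A of #{x in A. x c not in A}) = p + 2.
   - p = 0: every odd closed walk, moved by any group element, has a step inside S, so the odd girth
     is at least |V|/2, which is impossible for degree at least 5.
   - p >= 2: some part has a small edge boundary, so by submodularity the smallest minimisers of the
     boundary are cosets of a subgroup K with very few outgoing generators. Comparing a part with
     the union of the cosets in which it has a majority gives a contradiction.
   - p = 1: counting translates of a triangle bounds |V - A| by 9 and excludes triangles. If the
     part A has at least five vertices, the argument with cosets applies again. If |A| = 3, then
     (S, V - S) is a bipartition up to four edges; the symmetric difference of S with a translate of
     S has boundary at most 8, which forces every translate of S to be S or V - S. *)

theory Submission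
  imports Defs
begin

section \<open>The theorems of Hall and Tutte\<close>

text \<open>Summed over all generators, the equation says that \<open>inn C S\<close> and the
  boundaries of the non-singleton parts add up to |C|(p + 2), and the two given edges put four arcs
  into \<open>inn C S\<close>. This 4 yields the bound 2|C| - 2 for the boundary of some part when p
  \<ge> 2, and 3|C| - 4 for the part when p = 1. The obstacle is that these bounds are close to the
  boundaries of very small sets: in a triangle-free graph a path on three vertices has boundary
  exactly 3|C| - 4. Atoms are therefore taken among sets with at least 3, respectively 4, vertices
  on both sides, and uncrossing them requires that all competing sets have at least 5, respectively
  7, vertices. For degree 5 the first of these needs an additional parity argument. The equation for
  a single generator matters when only one generator leaves the subgroup K. It is then an
  involution, which cannot pair up all vertices of an odd part, so every non-singleton part has
  between one and three exits along it.\<close>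

lemma hall_marriage:
  fixes A :: "'i \<Rightarrow> 'b set"
  assumes "finite I" and "\<And>i. i \<in> I \<Longrightarrow> finite (A i)"
    and "\<And>J. J \<subseteq> I \<Longrightarrow> card J \<le> card (\<Union>i\<in>J. A i)"
  shows "\<exists>f. inj_on f I \<and> (\<forall>i\<in>I. f i \<in> A i)"
  using assms
proof (induction "card I" arbitrary: I A rule: less_induct)
  case less
  note fin = less.prems(1) and finA = less.prems(2) and hall = less.prems(3)
  have finU: "finite (\<Union>i\<in>J. A i)" if "J \<subseteq> I" for J
    using that fin finA finite_subset by blast
  show ?case
  proof (cases "I = {}")
    case False
    then obtain i where i: "i \<in> I" by blast
    show ?thesis
    \<comment> \<open>Halmos and Vaughan: a tight proper subfamily is matched inside its own union
      and the rest outside that union; without one, every proper subfamily has a spare element, so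
      \<open>i\<close> may take any \<open>x\<close>.\<close>
    proof (cases "\<exists>J. J \<subset> I \<and> J \<noteq> {} \<and> card (\<Union>i\<in>J. A i) \<le> card J")
      case True
      then obtain J where J: "J \<subset> I" "J \<noteq> {}" "card (\<Union>i\<in>J. A i) \<le> card J" by blast
      let ?U = "\<Union>i\<in>J. A i"
      have finJ: "finite J" using J(1) fin finite_subset by blast
      have "\<exists>f. inj_on f J \<and> (\<forall>i\<in>J. f i \<in> A i)"
        by (rule less.hyps) (use J fin finA hall finJ in \<open>auto simp: psubset_card_mono\<close>)
      then obtain f where f: "inj_on f J" "\<forall>i\<in>J. f i \<in> A i" by blast
      have "\<exists>g. inj_on g (I - J) \<and> (\<forall>i\<in>I - J. g i \<in> A i - ?U)"
      proof (rule less.hyps)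
        show "card (I - J) < card I"
          using J fin by (intro psubset_card_mono) auto
        fix L assume L: "L \<subseteq> I - J"
        have "card L + card J = card (L \<union> J)"
          using L fin finJ by (subst card_Un_disjoint) (auto intro: finite_subset)
        also have "\<dots> \<le> card (\<Union>i\<in>L \<union> J. A i)"
          using L J by (intro hall) auto
        also have "(\<Union>i\<in>L \<union> J. A i) = (\<Union>i\<in>L. A i - ?U) \<union> ?U" by auto
        also have "card \<dots> \<le> card (\<Union>i\<in>L. A i - ?U) + card ?U" by (rule card_Un_le)
        finally show "card L \<le> card (\<Union>i\<in>L. A i - ?U)" using J(3) by linarith
      qed (use fin finA in auto)
      then obtain g where g: "inj_on g (I - J)" "\<forall>i\<in>I - J. g i \<in> A i - ?U" by blast
      have fU: "f a \<in> ?U" if "a \<in> J" for a using f(2) that by blast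
      have gU: "g a \<notin> ?U" if "a \<in> I - J" for a using g(2) that by blast
      have "inj_on (\<lambda>i. if i \<in> J then f i else g i) I"
      proof (rule inj_onI)
        fix a b assume "a \<in> I" "b \<in> I" "(if a \<in> J then f a else g a) = (if b \<in> J then f b else g b)"
        then show "a = b"
          using f(1) g(1) fU[of a] fU[of b] gU[of a] gU[of b]
          by (cases "a \<in> J"; cases "b \<in> J") (simp_all add: inj_on_def)
      qed
      then show ?thesis using f g by (intro exI[of _ "\<lambda>i. if i \<in> J then f i else g i"]) auto
    next
      case noJ: False
      have "card {i} \<le> card (\<Union>i\<in>{i}. A i)" using i by (intro hall) auto
      then obtain x where x: "x \<in> A i" by fastforce
      have "\<exists>f. inj_on f (I - {i}) \<and> (\<forall>j\<in>I - {i}. f j \<in> A j - {x})"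
      proof (rule less.hyps)
        show "card (I - {i}) < card I" using i fin by (intro psubset_card_mono) auto
        fix J assume J: "J \<subseteq> I - {i}"
        show "card J \<le> card (\<Union>j\<in>J. A j - {x})"
        proof (cases "J = {}")
          case False
          have "J \<subset> I" using J i by blast
          then have "card J < card (\<Union>j\<in>J. A j)" using noJ False not_less by blast
          moreover have "(\<Union>j\<in>J. A j - {x}) = (\<Union>j\<in>J. A j) - {x}" by auto
          moreover have "card (\<Union>j\<in>J. A j) - 1 \<le> card ((\<Union>j\<in>J. A j) - {x})"
            by (simp add: card_Diff_singleton_if)
          ultimately show ?thesis by simp
        qed simp
      qed (use fin finA in auto)
      then obtain f where f: "inj_on f (I - {i})" "\<forall>j\<in>I - {i}. f j \<in> A j - {x}" by blast
      have "inj_on (f(i := x)) I" using f by (auto simp: inj_on_def)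
      then show ?thesis using f x by (intro exI[of _ "f(i := x)"]) auto
    qed
  qed auto
qed

text \<open>Connected components are avoided: the members of an odd family are arbitrary odd unions of
  components of \<open>W - T\<close>.\<close>

definition odd_family :: "('a \<Rightarrow> 'a \<Rightarrow> bool) \<Rightarrow> 'a set \<Rightarrow> 'a set \<Rightarrow> 'a set set \<Rightarrow> bool" where
  "odd_family adj W T F \<longleftrightarrow> T \<subseteq> W \<and> pairwise disjnt F \<and>
    (\<forall>A\<in>F. A \<subseteq> W - T \<and> odd (card A) \<and> (\<forall>x\<in>A. \<forall>y\<in>W - T - A. \<not> adj x y))"

definition perfectly_matched :: "('a \<Rightarrow> 'a \<Rightarrow> bool) \<Rightarrow> 'a set \<Rightarrow> 'a set set \<Rightarrow> bool" where
  "perfectly_matched adj W M \<longleftrightarrow>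
    (\<forall>e\<in>M. \<exists>x y. e = {x, y} \<and> x \<noteq> y \<and> adj x y) \<and> pairwise disjnt M \<and> \<Union>M = W"

text \<open>By symmetry of \<open>adj\<close>, the vertices outside the barrier and outside all
  members are again separated from the rest, so an odd remainder is one further member.\<close>

lemma odd_family_add_rest:
  assumes "odd_family adj W T F" and "symp adj" and "odd (card (W - T - \<Union>F))"
  shows "odd_family adj W T (insert (W - T - \<Union>F) F)" and "W - T - \<Union>F \<notin> F"
proof -
  show "odd_family adj W T (insert (W - T - \<Union>F) F)"
    using assms unfolding odd_family_def pairwise_insert disjnt_def
    by (auto dest: sympD)
  have "W - T - \<Union>F \<noteq> {}" using assms(3) by force
  then show "W - T - \<Union>F \<notin> F" by blast
qed

lemma odd_family_finite:
  assumes "odd_family adj W T F" and "finite W"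
  shows "finite F" and "finite (\<Union>F)"
proof -
  have "F \<subseteq> Pow W" using assms by (auto simp: odd_family_def)
  then show "finite F" using assms(2) finite_subset by blast
  show "finite (\<Union>F)" using \<open>F \<subseteq> Pow W\<close> assms(2) by (meson Sup_le_iff finite_subset PowD subsetD)
qed

lemma card_Union_odd_parity:
  assumes "finite F" and "pairwise disjnt F" and "\<And>A. A \<in> F \<Longrightarrow> odd (card A)"
  shows "even (card (\<Union>F)) \<longleftrightarrow> even (card F)"
  using assms
proof (induction F rule: finite_induct)
  case (insert A F)
  \<comment> \<open>An infinite set has \<open>card\<close> 0, which is even, so odd sets are
    finite.\<close>
  have "finite A" using insert.prems(2)[of A] card.infinite by fastforce
  moreover have "finite (\<Union>F)"
    using insert.prems(2) insert.hyps(1) card.infinite by (metis finite_Union even_zero insertCI)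
  moreover have "A \<inter> \<Union>F = {}"
    using insert.prems(1) insert.hyps(2) by (auto simp: pairwise_insert disjnt_def)
  ultimately have "card (\<Union>(insert A F)) = card A + card (\<Union>F)"
    by (simp add: card_Un_disjoint)
  moreover have "even (card (\<Union>F)) \<longleftrightarrow> even (card F)"
    using insert by (auto simp: pairwise_insert)
  moreover have "odd (card A)" using insert.prems by auto
  ultimately show ?case using insert.hyps by simp
qed simp

text \<open>Anderson's proof: a maximal tight barrier leaves only odd pieces, each of which satisfies
  Tutte's condition after the removal of any vertex, and Hall's theorem matches the barrier
  with the pieces.\<close>

theorem tutte:
  assumes "finite W" and "symp adj"
    and "\<And>T F. odd_family adj W T F \<Longrightarrow> card F \<le> card T"
  shows "\<exists>M. perfectly_matched adj W M"
  using assms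
proof (induction "card W" arbitrary: W rule: less_induct)
  case less
  note fin = less.prems(1) and sym = less.prems(2) and tut = less.prems(3)
  let ?tight = "\<lambda>T. \<exists>F. odd_family adj W T F \<and> card F = card T"
  have "?tight {}" by (intro exI[of _ "{}"]) (auto simp: odd_family_def)
  moreover have "card T \<le> card W" if "?tight T" for T
    using that fin by (auto simp: odd_family_def intro: card_mono)
  ultimately have "\<exists>T. ?tight T \<and> (\<forall>T'. ?tight T' \<longrightarrow> card T' \<le> card T)"
    by (intro ex_has_greatest_nat[of ?tight "{}" card "Suc (card W)"]) (auto simp: less_Suc_eq_le)
  then obtain T where TT: "?tight T \<and> (\<forall>T'. ?tight T' \<longrightarrow> card T' \<le> card T)"
    by (elim exE) (rule that)
  have T: "?tight T" using TT by (rule conjunct1)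
  have maxT: "card T' \<le> card T" if "?tight T'" for T'
    by (rule TT[THEN conjunct2, rule_format, OF that])
  from T obtain F where F: "odd_family adj W T F" and cF: "card F = card T" by blast
  have TW: "T \<subseteq> W" and disF: "pairwise disjnt F"
    and FA: "\<And>A. A \<in> F \<Longrightarrow> A \<subseteq> W - T \<and> odd (card A) \<and> (\<forall>x\<in>A. \<forall>y\<in>W - T - A. \<not> adj x y)"
    using F by (auto simp: odd_family_def)
  have finT: "finite T" using TW fin finite_subset by blast
  have finF: "finite F" using odd_family_finite[OF F fin] by blast
  \<comment> \<open>Tutte's condition supplies the reverse inequality, so such a family would make a
    barrier larger than \<open>T\<close> tight.\<close>
  have no_larger: False if "odd_family adj W T' F'" "card T' \<le> card F'" "card T < card T'" for T' F'
    using tut[OF that(1)] that maxT[of T'] by force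
  have rest: "W - T - \<Union>F = {}"
  proof (rule ccontr)
    let ?R = "W - T - \<Union>F"
    assume "?R \<noteq> {}"
    then obtain v where v: "v \<in> ?R" by blast
    have "even (card ?R)"
    proof (rule ccontr)
      assume "odd (card ?R)"
      from tut[OF odd_family_add_rest(1)[OF F sym this]] odd_family_add_rest(2)[OF F sym this]
      show False using finF cF by simp
    qed
    \<comment> \<open>Moving \<open>v\<close> into the barrier makes the even remainder odd, so
      barrier and family both gain one element.\<close>
    then have "odd (card (?R - {v}))"
      using v fin by (metis card_Suc_Diff1 even_Suc finite_Diff)
    have eq: "?R - {v} = W - insert v T - \<Union>F" by auto
    have "odd_family adj W (insert v T) F"
      using F v by (auto simp: odd_family_def)
    from odd_family_add_rest[OF this sym] \<open>odd (card (?R - {v}))\<close> eq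
    have "odd_family adj W (insert v T) (insert (?R - {v}) F)" "?R - {v} \<notin> F" by auto
    then show False
      using no_larger[of "insert v T" "insert (?R - {v}) F"] v finT finF cF by simp
  qed
  show ?case
  proof (cases "W = {}")
    case True
    then show ?thesis by (intro exI[of _ "{}"]) (auto simp: perfectly_matched_def)
  next
    case Wne: False
    have piece: "\<exists>M. perfectly_matched adj (A - {v}) M" if A: "A \<in> F" and v: "v \<in> A" for A v
    proof (rule less.hyps)
      have AW: "A \<subseteq> W" using FA[OF A] by blast
      then show "card (A - {v}) < card W" using v fin by (intro psubset_card_mono) auto
      show "finite (A - {v})" using AW fin finite_subset by blast
      have evA: "even (card (A - {v}))" using FA[OF A] v
        by (metis card_Suc_Diff1 card.infinite even_Suc even_zero)
      fix R D assume RD: "odd_family adj (A - {v}) R D"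
      show "card D \<le> card R"
      proof (rule ccontr)
        assume "\<not> card D \<le> card R"
        \<comment> \<open>\<open>A - {v}\<close> is even, so a surplus of one leaves an odd
          remainder, which is one more piece. The surplus of two pays for losing \<open>A\<close>
          from the family and for adding \<open>v\<close> to the barrier.\<close>
        have "\<exists>D'. odd_family adj (A - {v}) R D' \<and> card R + 2 \<le> card D'"
        proof (cases "card D = card R + 1")
          case True
          let ?Q = "A - {v} - R - \<Union>D"
          have finA: "finite (A - {v})" by fact
          have RA: "R \<subseteq> A - {v}" "\<Union>D \<subseteq> A - {v} - R" using RD by (auto simp: odd_family_def)
          have "card (A - {v}) = card R + card (A - {v} - R)"
            using RA finA by (metis card_Diff_subset card_mono finite_subset le_add_diff_inverse)
          moreover have "card (A - {v} - R) = card (\<Union>D) + card ?Q"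
            using RA finA by (metis card_Diff_subset card_mono finite_subset le_add_diff_inverse finite_Diff)
          moreover have "even (card (\<Union>D)) \<longleftrightarrow> even (card D)"
            using RD odd_family_finite[OF RD finA] by (intro card_Union_odd_parity) (auto simp: odd_family_def)
          ultimately have "odd (card ?Q)" using evA True by presburger
          from odd_family_add_rest[OF RD sym this] show ?thesis
            using True odd_family_finite[OF RD finA]
            by (intro exI[of _ "insert ?Q D"]) simp
        qed (use RD \<open>\<not> card D \<le> card R\<close> in auto)
        then obtain D' where D': "odd_family adj (A - {v}) R D'" "card R + 2 \<le> card D'" by blast
        have D'A: "\<And>B. B \<in> D' \<Longrightarrow> B \<subseteq> A - {v} - R \<and> B \<noteq> {}" "R \<subseteq> A - {v}"
          using D'(1) by (auto simp: odd_family_def)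
        have finD: "finite D'" using odd_family_finite[OF D'(1)] \<open>finite (A - {v})\<close> by blast
        have disj: "(F - {A}) \<inter> D' = {}"
          using D'A disF A unfolding pairwise_def disjnt_def by blast
        let ?T = "T \<union> insert v R"
        have cardR: "card ?T = card T + Suc (card R)"
        proof -
          have "T \<inter> insert v R = {}" "v \<notin> R" "finite R"
            using D'A(2) FA[OF A] v \<open>finite (A - {v})\<close> finite_subset by blast+
          then show ?thesis using finT by (simp add: card_Un_disjoint)
        qed
        have "odd_family adj W ?T ((F - {A}) \<union> D')"
          unfolding odd_family_def
        proof (intro conjI ballI)
          show "?T \<subseteq> W" using TW AW v D'A by blast
          have pD: "pairwise disjnt D'" using D'(1) by (simp add: odd_family_def)
          have cross: "disjnt B B'" if "B \<in> F - {A}" "B' \<in> D'" for B B'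
          proof -
            have "disjnt B A" using pairwiseD[OF disF, of B A] that A by blast
            then show ?thesis using D'A(1)[OF that(2)] by (auto simp: disjnt_def)
          qed
          show "pairwise disjnt (F - {A} \<union> D')"
          proof (rule pairwiseI)
            fix B B' assume "B \<in> F - {A} \<union> D'" "B' \<in> F - {A} \<union> D'" "B \<noteq> B'"
            then consider "B \<in> F" "B' \<in> F" | "B \<in> D'" "B' \<in> D'"
              | "B \<in> F - {A}" "B' \<in> D'" | "B \<in> D'" "B' \<in> F - {A}" by blast
            then show "disjnt B B'"
              using pairwiseD[OF disF, of B B'] pairwiseD[OF pD, of B B'] \<open>B \<noteq> B'\<close>
                cross[of B B'] cross[of B' B] by cases (simp_all add: disjnt_sym)
          qed
        next
          fix B assume B: "B \<in> F - {A} \<union> D'"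
          show "B \<subseteq> W - ?T"
          proof (cases "B \<in> D'")
            case True
            then show ?thesis using D'A(1)[OF True] FA[OF A] by blast
          next
            case False
            then have "B \<in> F" "disjnt B A" using B A pairwiseD[OF disF, of B A] by blast+
            then show ?thesis using FA[of B] D'A(2) v by (auto simp: disjnt_def)
          qed
          show "odd (card B)" using B FA D'(1) by (auto simp: odd_family_def)
          fix x y assume xy: "x \<in> B" "y \<in> W - ?T - B"
          show "\<not> adj x y"
          proof (cases "B \<in> F")
            case True
            then show ?thesis using FA xy by blast
          next
            case False
            then have BD: "B \<in> D'" using B by blast
            then have xA: "x \<in> A" using xy D'A(1) by blast
            show ?thesis
            proof (cases "y \<in> A")
              case True
              then show ?thesis using D'(1) BD xy unfolding odd_family_def by blast
            next
              case False
              then show ?thesis using FA[OF A] xA xy by blast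
            qed
          qed
        qed
        moreover have "card ?T \<le> card ((F - {A}) \<union> D')"
        proof -
          have "card ((F - {A}) \<union> D') = card (F - {A}) + card D'"
            using disj finF finD by (simp add: card_Un_disjoint)
          moreover have "card (F - {A}) + 1 = card F" using card_Suc_Diff1[OF finF A] by simp
          ultimately show ?thesis using cardR cF D'(2) by linarith
        qed
        ultimately show False using no_larger[of ?T] cardR by simp
      qed
    qed (fact sym)
    let ?N = "\<lambda>A. {t \<in> T. \<exists>x\<in>A. adj x t}"
    have "\<exists>f. inj_on f F \<and> (\<forall>A\<in>F. f A \<in> ?N A)"
    proof (rule hall_marriage[OF finF])
      fix J assume J: "J \<subseteq> F"
      \<comment> \<open>A member of \<open>J\<close> has neighbours only in itself and in its own
        \<open>?N A\<close>, so Tutte's condition for this barrier is Hall's condition.\<close>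
      have "odd_family adj W (\<Union>A\<in>J. ?N A) J"
        unfolding odd_family_def
      proof (intro conjI ballI)
        show "pairwise disjnt J" using J disF pairwise_subset by blast
        fix A assume A: "A \<in> J"
        show "A \<subseteq> W - (\<Union>A\<in>J. ?N A)" "odd (card A)" using A J FA by blast+
        fix x y assume "x \<in> A" "y \<in> W - (\<Union>A\<in>J. ?N A) - A"
        then show "\<not> adj x y" using A J FA[of A] by blast
      qed (use TW in auto)
      then show "card J \<le> card (\<Union>A\<in>J. ?N A)" by (rule tut)
    qed (use finT in auto)
    then obtain f where f: "inj_on f F" "\<And>A. A \<in> F \<Longrightarrow> f A \<in> ?N A" by blast
    have fF: "f ` F = T"
      using f finT cF by (intro card_subset_eq) (auto simp: card_image)
    have "\<forall>A\<in>F. \<exists>x. x \<in> A \<and> adj x (f A)" using f by blast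
    then obtain h where h: "\<And>A. A \<in> F \<Longrightarrow> h A \<in> A \<and> adj (h A) (f A)" by metis
    have "\<forall>A\<in>F. \<exists>M. perfectly_matched adj (A - {h A}) M" using piece h by blast
    then obtain N where N: "\<And>A. A \<in> F \<Longrightarrow> perfectly_matched adj (A - {h A}) (N A)" by metis
    let ?E = "\<lambda>A. insert {h A, f A} (N A)"
    have UE: "\<Union>(?E A) = insert (f A) A" if "A \<in> F" for A
      using N[OF that] h[OF that] by (auto simp: perfectly_matched_def)
    have fT: "f A \<in> T" if "A \<in> F" for A using f(2)[OF that] by blast
    have "perfectly_matched adj W (\<Union>A\<in>F. ?E A)"
      unfolding perfectly_matched_def
    proof (intro conjI)
      show "\<forall>e\<in>\<Union>A\<in>F. ?E A. \<exists>x y. e = {x, y} \<and> x \<noteq> y \<and> adj x y"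
      proof
        fix e assume "e \<in> (\<Union>A\<in>F. ?E A)"
        then obtain A where A: "A \<in> F" "e \<in> ?E A" by blast
        have "h A \<noteq> f A" using h[OF A(1)] fT[OF A(1)] FA[OF A(1)] by (metis DiffD2 subsetD)
        then show "\<exists>x y. e = {x, y} \<and> x \<noteq> y \<and> adj x y"
          using A N[OF A(1)] h[OF A(1)] unfolding perfectly_matched_def by blast
      qed
      show "pairwise disjnt (\<Union>A\<in>F. ?E A)"
      proof (rule pairwiseI)
        fix e e' assume "e \<in> (\<Union>A\<in>F. ?E A)" "e' \<in> (\<Union>A\<in>F. ?E A)" and ne: "e \<noteq> e'"
        then obtain A B where A: "A \<in> F" "e \<in> ?E A" and B: "B \<in> F" "e' \<in> ?E B" by blast
        show "disjnt e e'"
        proof (cases "A = B")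
          case True
          have "pairwise disjnt (?E A)"
            using N[OF A(1)] fT[OF A(1)] FA[OF A(1)]
            unfolding perfectly_matched_def pairwise_insert disjnt_def by blast
          then show ?thesis using A B True ne by (auto simp: pairwise_def)
        next
          case False
          have "e \<subseteq> insert (f A) A" "e' \<subseteq> insert (f B) B" using A B UE by blast+
          moreover have "A \<inter> B = {}" using disF A B False by (auto simp: pairwise_def disjnt_def)
          moreover have "f A \<noteq> f B" using f(1) A B False by (auto simp: inj_on_def)
          ultimately show ?thesis using fT[OF A(1)] fT[OF B(1)] FA[OF A(1)] FA[OF B(1)]
            unfolding disjnt_def by blast
        qed
      qed
      have "\<Union>(\<Union>A\<in>F. ?E A) = (\<Union>A\<in>F. insert (f A) A)" using UE by blast
      also have "\<dots> = f ` F \<union> \<Union>F" by blast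
      also have "\<dots> = W" using fF rest TW FA by blast
      finally show "\<Union>(\<Union>A\<in>F. ?E A) = W" .
    qed
    then show ?thesis by blast
  qed
qed

section \<open>Edge cuts in Cayley graphs\<close>

lemma even_card_sym_irrefl:
  assumes "finite R" and "sym R" and "irrefl R"
  shows "even (card R)"
  using assms
proof (induction "card R" arbitrary: R rule: less_induct)
  case less
  show ?case
  proof (cases "R = {}")
    case False
    then obtain x y where xy: "(x, y) \<in> R" by auto
    with less.prems have yx: "(y, x) \<in> R" "x \<noteq> y" by (auto simp: sym_def irrefl_def)
    let ?R = "R - {(x, y), (y, x)}"
    have card: "card R = card ?R + 2"
      using xy yx less.prems(1) by (subst card_Diff_subset) (auto simp: numeral_2_eq_2 intro!: Suc_leI card_gt_0_iff[THEN iffD2] dest: card_mono[of R "{(x, y), (y, x)}"])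
    have "even (card ?R)"
      by (rule less.hyps) (use less.prems card in \<open>auto simp: sym_def irrefl_def\<close>)
    then show ?thesis using card by simp
  qed simp
qed

text \<open>Steps along edges are right multiplications by \<open>C\<close>, so left multiplications
  are automorphisms; by this symmetry connectedness is expressed at the identity only, in
  \<open>gen\<close>.\<close>

locale cayley = group G for G (structure) +
  fixes C :: "'a set"
  assumes fin: "finite (carrier G)"
    and C_sub: "C \<subseteq> carrier G"
    and C_inv: "\<And>c. c \<in> C \<Longrightarrow> inv c \<in> C"
    and C_one: "\<one> \<notin> C"
    and gen: "\<And>U. \<lbrakk>U \<subseteq> carrier G; \<one> \<in> U; \<And>x c. \<lbrakk>x \<in> U; c \<in> C\<rbrakk> \<Longrightarrow> x \<otimes> c \<in> U\<rbrakk> \<Longrightarrow> U = carrier G"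
begin

abbreviation V :: "'a set" where "V \<equiv> carrier G"

lemma finC: "finite C" using C_sub fin finite_subset by blast

lemma finX: "X \<subseteq> V \<Longrightarrow> finite X" using fin finite_subset by blast

lemma C_carrier: "c \<in> C \<Longrightarrow> c \<in> V" using C_sub by blast

text \<open>Both functions count arcs, so \<open>inn C X\<close> is twice the number of edges inside \<open>X\<close>, while
  \<open>cut C X\<close> counts every boundary edge once.\<close>

definition cut :: "'a set \<Rightarrow> 'a set \<Rightarrow> nat" where
  "cut E X = (\<Sum>c\<in>E. card {x \<in> X. x \<otimes> c \<notin> X})"

definition inn :: "'a set \<Rightarrow> 'a set \<Rightarrow> nat" where
  "inn E X = (\<Sum>c\<in>E. card {x \<in> X. x \<otimes> c \<in> X})"

lemma card_swap:
  assumes "finite E" "finite X"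
  shows "(\<Sum>c\<in>E. card {x \<in> X. P x c}) = (\<Sum>x\<in>X. card {c \<in> E. P x c})"
proof -
  have "(\<Sum>c\<in>E. card {x \<in> X. P x c}) = (\<Sum>c\<in>E. \<Sum>x\<in>X. if P x c then 1 else 0)"
    using assms by (simp add: sum.If_cases Int_def)
  also have "\<dots> = (\<Sum>x\<in>X. \<Sum>c\<in>E. if P x c then 1 else 0)" by (rule sum.swap)
  also have "\<dots> = (\<Sum>x\<in>X. card {c \<in> E. P x c})"
    using assms by (simp add: sum.If_cases Int_def)
  finally show ?thesis .
qed

lemma cut_swap: "finite E \<Longrightarrow> finite X \<Longrightarrow> cut E X = (\<Sum>x\<in>X. card {c \<in> E. x \<otimes> c \<notin> X})"
  unfolding cut_def by (rule card_swap)

lemma inn_swap: "finite E \<Longrightarrow> finite X \<Longrightarrow> inn E X = (\<Sum>x\<in>X. card {c \<in> E. x \<otimes> c \<in> X})"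
  unfolding inn_def by (rule card_swap)

lemma card_split: "finite X \<Longrightarrow> card {x \<in> X. \<not> P x} + card {x \<in> X. P x} = card X"
  by (subst card_Un_disjoint[symmetric]) (auto intro: arg_cong[where f = card])

lemma cut_plus_inn: "finite X \<Longrightarrow> cut E X + inn E X = card E * card X"
  unfolding cut_def inn_def by (simp add: sum.distrib[symmetric] card_split)

lemma cut_Int_Diff: "finite E \<Longrightarrow> cut E X = cut (E \<inter> K) X + cut (E - K) X"
  unfolding cut_def by (rule sum.Int_Diff)

lemma inn_mono: "E \<subseteq> E' \<Longrightarrow> finite E' \<Longrightarrow> inn E X \<le> inn E' X"
  unfolding inn_def by (rule sum_mono2) auto

lemma mult_r_inj: "c \<in> V \<Longrightarrow> inj_on (\<lambda>x. x \<otimes> c) V"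
  by (auto simp: inj_on_def)

lemma card_preimage:
  assumes "X \<subseteq> V" "c \<in> V"
  shows "card {x \<in> V. x \<otimes> c \<in> X} = card X"
proof -
  have "bij_betw (\<lambda>x. x \<otimes> c) {x \<in> V. x \<otimes> c \<in> X} X"
    by (rule bij_betw_byWitness[where f' = "\<lambda>x. x \<otimes> inv c"])
      (use assms in \<open>auto simp: m_assoc subset_iff\<close>)
  then show ?thesis by (rule bij_betw_same_card)
qed

text \<open>Right multiplication by \<open>c\<close> permutes \<open>V\<close>, so as many vertices
  leave \<open>X\<close> along \<open>c\<close> as enter it. Complements thus have equal cuts for
  each generator separately.\<close>

lemma card_exits_compl:
  assumes "X \<subseteq> V" "c \<in> V"
  shows "card {x \<in> V - X. x \<otimes> c \<notin> V - X} = card {x \<in> X. x \<otimes> c \<notin> X}"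
proof -
  have "card {x \<in> V. x \<otimes> c \<in> X} = card {x \<in> X. x \<otimes> c \<in> X} + card {x \<in> V - X. x \<otimes> c \<in> X}"
    using assms finX[OF assms(1)] fin
    by (subst card_Un_disjoint[symmetric]) (auto intro!: arg_cong[where f = card])
  moreover have "{x \<in> V - X. x \<otimes> c \<notin> V - X} = {x \<in> V - X. x \<otimes> c \<in> X}"
    using assms by auto
  ultimately show ?thesis
    using card_preimage[OF assms] card_split[OF finX[OF assms(1)], of "\<lambda>x. x \<otimes> c \<in> X"] by simp
qed

lemma cut_compl: "X \<subseteq> V \<Longrightarrow> E \<subseteq> V \<Longrightarrow> cut E (V - X) = cut E X"
  unfolding cut_def by (intro sum.cong refl card_exits_compl) auto

text \<open>The inequality holds for each generator: a vertex that exits the intersection or the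
  union exits \<open>X\<close> or \<open>Y\<close>, and one that exits both the intersection and the
  union exits both \<open>X\<close> and \<open>Y\<close>.\<close>

lemma cut_submod:
  assumes "finite X" "finite Y"
  shows "cut E (X \<inter> Y) + cut E (X \<union> Y) \<le> cut E X + cut E Y"
  unfolding cut_def sum.distrib[symmetric]
proof (rule sum_mono)
  fix c
  let ?P = "\<lambda>X. {x \<in> X. x \<otimes> c \<notin> X}"
  have f: "finite (?P X)" "finite (?P Y)" "finite (?P (X \<inter> Y))" "finite (?P (X \<union> Y))"
    using assms by auto
  have "card (?P (X \<inter> Y)) + card (?P (X \<union> Y))
      = card (?P (X \<inter> Y) \<union> ?P (X \<union> Y)) + card (?P (X \<inter> Y) \<inter> ?P (X \<union> Y))"
    using f by (intro card_Un_Int)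
  also have "\<dots> \<le> card (?P X \<union> ?P Y) + card (?P X \<inter> ?P Y)"
    using f by (intro add_mono card_mono) auto
  also have "\<dots> = card (?P X) + card (?P Y)" using f by (intro card_Un_Int[symmetric])
  finally show "card (?P (X \<inter> Y)) + card (?P (X \<union> Y)) \<le> card (?P X) + card (?P Y)" .
qed

text \<open>Submodularity for \<open>X\<close> and the complement of \<open>Y\<close>. It uncrosses
  two sets whose intersection is too small to be compared with a minimiser.\<close>

lemma cut_posimod:
  assumes "X \<subseteq> V" "Y \<subseteq> V" "E \<subseteq> V"
  shows "cut E (X - Y) + cut E (Y - X) \<le> cut E X + cut E Y"
proof -
  have "cut E (X \<inter> (V - Y)) + cut E (X \<union> (V - Y)) \<le> cut E X + cut E (V - Y)"
    using assms fin by (intro cut_submod) (auto intro: finX)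
  moreover have "X \<inter> (V - Y) = X - Y" "X \<union> (V - Y) = V - (Y - X)" using assms by auto
  moreover have "cut E (V - (Y - X)) = cut E (Y - X)" using assms by (intro cut_compl) auto
  ultimately show ?thesis using cut_compl[OF assms(2,3)] by simp
qed

lemma translate_inj: "g \<in> V \<Longrightarrow> X \<subseteq> V \<Longrightarrow> inj_on ((\<otimes>) g) X"
  by (auto simp: inj_on_def subset_iff)

lemma card_translate: "g \<in> V \<Longrightarrow> X \<subseteq> V \<Longrightarrow> card ((\<otimes>) g ` X) = card X"
  by (intro card_image translate_inj)

lemma translate_sub: "g \<in> V \<Longrightarrow> X \<subseteq> V \<Longrightarrow> (\<otimes>) g ` X \<subseteq> V"
  by auto

lemma translate_mem_iff: "g \<in> V \<Longrightarrow> X \<subseteq> V \<Longrightarrow> x \<in> V \<Longrightarrow> g \<otimes> x \<in> (\<otimes>) g ` X \<longleftrightarrow> x \<in> X"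
  by (auto simp: image_iff subset_iff)

lemma cut_translate:
  assumes "g \<in> V" "X \<subseteq> V" "E \<subseteq> V"
  shows "cut E ((\<otimes>) g ` X) = cut E X"
  unfolding cut_def
proof (rule sum.cong[OF refl])
  fix c assume "c \<in> E"
  then have c: "c \<in> V" using assms by auto
  have "{x \<in> (\<otimes>) g ` X. x \<otimes> c \<notin> (\<otimes>) g ` X} = (\<otimes>) g ` {x \<in> X. x \<otimes> c \<notin> X}"
    using assms c translate_mem_iff[OF assms(1,2)]
    by (auto simp: m_assoc subset_iff)
  then show "card {x \<in> (\<otimes>) g ` X. x \<otimes> c \<notin> (\<otimes>) g ` X} = card {x \<in> X. x \<otimes> c \<notin> X}"
    using card_translate[OF assms(1), of "{x \<in> X. x \<otimes> c \<notin> X}"] assms by auto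
qed

lemma inn_translate:
  assumes "g \<in> V" "X \<subseteq> V" "E \<subseteq> V"
  shows "inn E ((\<otimes>) g ` X) = inn E X"
  using cut_plus_inn[of X E] cut_plus_inn[of "(\<otimes>) g ` X" E] cut_translate[OF assms]
    card_translate[OF assms(1,2)] finX[OF assms(2)] by simp

text \<open>Arcs inside \<open>X\<close> pair off with their reverses. An arbitrary inverse-closed
  \<open>E\<close> is allowed so that the result applies to a single involution.\<close>

lemma inn_even:
  assumes "X \<subseteq> V" "E \<subseteq> V" "\<one> \<notin> E" "\<And>c. c \<in> E \<Longrightarrow> inv c \<in> E"
  shows "even (inn E X)"
proof -
  let ?R = "{(x, y) \<in> X \<times> X. inv x \<otimes> y \<in> E}"
  have "inn E X = card (SIGMA x:X. {c \<in> E. x \<otimes> c \<in> X})"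
    using assms finX by (simp add: inn_swap)
  also have "bij_betw (\<lambda>(x, c). (x, x \<otimes> c)) (SIGMA x:X. {c \<in> E. x \<otimes> c \<in> X}) ?R"
    by (rule bij_betw_byWitness[where f' = "\<lambda>(x, y). (x, inv x \<otimes> y)"])
      (use assms in \<open>auto simp: m_assoc[symmetric] subset_iff\<close>)
  then have "card (SIGMA x:X. {c \<in> E. x \<otimes> c \<in> X}) = card ?R" by (rule bij_betw_same_card)
  finally have "inn E X = card ?R" .
  moreover have "even (card ?R)"
  proof (rule even_card_sym_irrefl)
    show "finite ?R" using finX[OF assms(1)] by (auto intro: finite_subset[of _ "X \<times> X"])
    show "sym ?R"
    proof (rule symI)
      fix x y assume xy: "(x, y) \<in> ?R"
      then have "x \<in> V" "y \<in> V" using assms by auto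
      then have "inv (inv x \<otimes> y) = inv y \<otimes> x" by (simp add: inv_mult_group)
      then show "(y, x) \<in> ?R" using xy assms(4)[of "inv x \<otimes> y"] by auto
    qed
    show "irrefl ?R" using assms by (auto simp: irrefl_def)
  qed
  ultimately show ?thesis by simp
qed

text \<open>A vertex has at most |X| - 1 neighbours within \<open>X\<close>. The subtraction is
  truncated, so the bound is void once |X| exceeds |E|.\<close>

lemma cut_ge_degree:
  assumes "X \<subseteq> V" "E \<subseteq> V" "\<one> \<notin> E"
  shows "card X * (card E + 1 - card X) \<le> cut E X"
proof -
  have fE: "finite E" using assms finX by auto
  have "card E + 1 - card X \<le> card {c \<in> E. x \<otimes> c \<notin> X}" if x: "x \<in> X" for x
  proof -
    have "inj_on ((\<otimes>) x) {c \<in> E. x \<otimes> c \<in> X}"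
      using assms x by (intro translate_inj) auto
    moreover have "(\<otimes>) x ` {c \<in> E. x \<otimes> c \<in> X} \<subseteq> X - {x}"
      using assms x by auto (metis l_cancel_one subsetD)
    ultimately have "card {c \<in> E. x \<otimes> c \<in> X} \<le> card (X - {x})"
      using finX[OF assms(1)] by (intro card_inj_on_le[of "(\<otimes>) x"]) auto
    also have "\<dots> = card X - 1" using x by simp
    finally have "card {c \<in> E. x \<otimes> c \<in> X} \<le> card X - 1" .
    moreover have "card X > 0" using x finX[OF assms(1)] card_gt_0_iff by blast
    ultimately show ?thesis using card_split[OF fE, of "\<lambda>c. x \<otimes> c \<in> X"] by linarith
  qed
  then have "(\<Sum>x\<in>X. card E + 1 - card X) \<le> cut E X"
    unfolding cut_swap[OF fE finX[OF assms(1)]] by (rule sum_mono)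
  then show ?thesis by simp
qed

text \<open>Requiring \<open>m\<close> vertices on both sides excludes the cheap cuts around very
  small sets and is invariant under complements.\<close>

definition eligible :: "nat \<Rightarrow> 'a set \<Rightarrow> bool" where
  "eligible m X \<longleftrightarrow> X \<subseteq> V \<and> m \<le> card X \<and> m \<le> card (V - X)"

lemma eligible_compl: "eligible m X \<Longrightarrow> eligible m (V - X)"
  by (auto simp: eligible_def double_diff)

lemma card_compl: "X \<subseteq> V \<Longrightarrow> card (V - X) + card X = card V"
  using card_Diff_subset[OF finX] card_mono[OF fin] by (metis le_add_diff_inverse2)

text \<open>Mader's atoms: smallest minimisers of the cut function among the sets of size and co-size
  at least \<open>m\<close>. If these have size at least \<open>2 m - 1\<close>, submodularity makes their translates
  disjoint, so the atom through the identity is a subgroup.\<close>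

lemma atom_subgroup:
  assumes X: "eligible m X" and m: "1 \<le> m"
    and large: "\<And>Y. eligible m Y \<Longrightarrow> cut C Y \<le> cut C X \<Longrightarrow> 2 * m - 1 \<le> card Y"
  obtains K where "subgroup K G" "eligible m K" "cut C K \<le> cut C X"
    "\<And>Y. eligible m Y \<Longrightarrow> cut C K \<le> cut C Y"
    "\<And>Y. eligible m Y \<Longrightarrow> cut C Y = cut C K \<Longrightarrow> card K \<le> card Y"
proof -
  obtain Z where Z: "eligible m Z" and Zmin: "\<And>Y. eligible m Y \<Longrightarrow> cut C Z \<le> cut C Y"
    using ex_has_least_nat[of "eligible m" X "cut C"] X by blast
  let ?Q = "\<lambda>Y. eligible m Y \<and> cut C Y = cut C Z"
  obtain A where A: "eligible m A" "cut C A = cut C Z"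
    and Amin: "\<And>Y. ?Q Y \<Longrightarrow> card A \<le> card Y"
    using ex_has_least_nat[of ?Q Z card] Z by blast
  have lam: "cut C A \<le> cut C Y" if "eligible m Y" for Y using Zmin[OF that] A(2) by simp
  have AV: "A \<subseteq> V" using A by (simp add: eligible_def)
  have finA: "finite A" using AV finX by blast
  have big: "2 * m - 1 \<le> card A" using large[OF A(1)] lam[OF X] .
  \<comment> \<open>The complement of a minimiser is a minimiser, so a smallest one fills at most
    half of \<open>V\<close>; this leaves room outside the union of two translates.\<close>
  have half: "card A \<le> card (V - A)"
    using Amin[of "V - A"] eligible_compl[OF A(1)] cut_compl[OF AV C_sub] A(2) by simp
  have block: "(\<otimes>) g ` A = A" if g: "g \<in> V" and meet: "(\<otimes>) g ` A \<inter> A \<noteq> {}" for g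
  proof (rule ccontr)
    let ?Y = "(\<otimes>) g ` A"
    assume ne: "?Y \<noteq> A"
    have YV: "?Y \<subseteq> V" using translate_sub[OF g AV] .
    have finY: "finite ?Y" using YV finX by blast
    have cY: "card ?Y = card A" using card_translate[OF g AV] .
    have dY: "cut C ?Y = cut C A" using cut_translate[OF g AV C_sub] .
    let ?j = "card (A \<inter> ?Y)"
    have j0: "0 < ?j" using meet finA by (simp add: card_gt_0_iff Int_commute)
    have jA: "?j < card A"
    proof (rule ccontr)
      assume "\<not> ?j < card A"
      then have "A \<inter> ?Y = A" using finA card_mono[of A "A \<inter> ?Y"] by (intro card_subset_eq) auto
      then have "A = ?Y" using cY finY by (intro card_subset_eq) auto
      then show False using ne by simp
    qed
    have cAY: "card (A - ?Y) + ?j = card A" "card (?Y - A) + ?j = card A"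
      using finA finY cY by (metis Int_Diff_Un Int_Diff_disjoint add.commute card_Un_disjoint finite_Diff finite_Int,
        metis Int_Diff_Un Int_Diff_disjoint Int_commute add.commute card_Un_disjoint finite_Diff finite_Int)
    show False
    proof (cases "m \<le> ?j")
      case True
      have "card (A \<union> ?Y) + ?j = 2 * card A"
        using card_Un_Int[OF finA finY] cY by simp
      moreover have "card (V - (A \<union> ?Y)) + card (A \<union> ?Y) = card V"
        using AV YV by (intro card_compl) auto
      moreover have "card (V - A) + card A = card V" using AV by (rule card_compl)
      ultimately have "?j \<le> card (V - (A \<union> ?Y))" using half by linarith
      then have el1: "eligible m (A \<union> ?Y)"
        using True AV YV finA finY A(1) card_mono[of "A \<union> ?Y" A] by (auto simp: eligible_def)
      have "card (V - A) \<le> card (V - (A \<inter> ?Y))" using fin by (intro card_mono) auto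
      then have el2: "eligible m (A \<inter> ?Y)"
        using True AV A(1) by (auto simp: eligible_def)
      have "cut C (A \<inter> ?Y) + cut C (A \<union> ?Y) \<le> 2 * cut C A"
        using cut_submod[OF finA finY, of C] dY by simp
      then have "cut C (A \<inter> ?Y) = cut C Z" using lam[OF el1] lam[OF el2] A(2) by linarith
      then show False using Amin[of "A \<inter> ?Y"] el2 jA by simp
    next
      case False
      \<comment> \<open>The overlap has at most m - 1 vertices here, so 2 m - 1 vertices leave at
        least \<open>m\<close> in each difference.\<close>
      have sz: "m \<le> card (A - ?Y)" "m \<le> card (?Y - A)" using cAY False big by linarith+
      have "card (V - A) \<le> card (V - (A - ?Y))" "card (V - ?Y) \<le> card (V - (?Y - A))"
        using fin by (auto intro!: card_mono)
      moreover have "card (V - ?Y) = card (V - A)"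
        using card_compl[OF AV] card_compl[OF YV] cY by linarith
      ultimately have el: "eligible m (A - ?Y)" "eligible m (?Y - A)"
        using sz AV YV A(1) by (auto simp: eligible_def)
      have "cut C (A - ?Y) + cut C (?Y - A) \<le> 2 * cut C A"
        using cut_posimod[OF AV YV C_sub] dY by simp
      then have "cut C (A - ?Y) = cut C Z" using lam[OF el(1)] lam[OF el(2)] A(2) by linarith
      then show False using Amin[of "A - ?Y"] el(1) cAY j0 by simp
    qed
  qed
  have "card A > 0" using A m by (simp add: eligible_def)
  then obtain a where a: "a \<in> A" by (metis card.empty ex_in_conv less_numeral_extra(3))
  then have aV: "a \<in> V" using AV by blast
  define K where "K = (\<otimes>) (inv a) ` A"
  have KV: "K \<subseteq> V" unfolding K_def using AV aV by auto
  have tr: "(\<otimes>) g ` K = (\<otimes>) (g \<otimes> inv a) ` A" if "g \<in> V" for g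
    unfolding K_def image_image using that aV AV by (intro image_cong refl) (auto simp: m_assoc)
  have one: "\<one> \<in> K" unfolding K_def using a aV by force
  have Ktr: "(\<otimes>) (inv x) ` K = K" if x: "x \<in> K" for x
  proof -
    obtain b where b: "b \<in> A" "x = inv a \<otimes> b" using x by (auto simp: K_def)
    have bV: "b \<in> V" using b AV by blast
    have "inv x \<otimes> inv a = inv b" using b(2) bV aV by (simp add: inv_mult_group m_assoc)
    then have e1: "(\<otimes>) (inv x) ` K = (\<otimes>) (inv b) ` A" using tr[of "inv x"] x KV by auto
    have "(\<otimes>) (a \<otimes> inv b) ` A = A"
    proof (rule block)
      have "(a \<otimes> inv b) \<otimes> b = a" using aV bV by (simp add: m_assoc)
      then show "(\<otimes>) (a \<otimes> inv b) ` A \<inter> A \<noteq> {}" using a b(1) by force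
    qed (use aV bV in simp)
    then have "K = (\<otimes>) (inv a) ` ((\<otimes>) (a \<otimes> inv b) ` A)" by (simp add: K_def)
    also have "\<dots> = (\<otimes>) (inv b) ` A"
      unfolding image_image using aV bV AV
      by (intro image_cong refl) (auto simp: m_assoc[symmetric])
    finally show ?thesis using e1 by simp
  qed
  have "subgroup K G"
  proof
    show "inv x \<in> K" if "x \<in> K" for x
    proof -
      have "inv x \<otimes> \<one> \<in> (\<otimes>) (inv x) ` K" using one by blast
      then show ?thesis using Ktr[OF that] that KV by auto
    qed
    then show "x \<otimes> y \<in> K" if "x \<in> K" "y \<in> K" for x y
      using that Ktr[of "inv x"] KV by (metis image_eqI inv_inv subsetD)
  qed (use KV one in auto)
  moreover have cK: "card K = card A" unfolding K_def using card_translate[of "inv a" A] aV AV by simp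
  moreover have "card (V - K) = card (V - A)" using card_compl[OF KV] card_compl[OF AV] cK by linarith
  moreover have "cut C K = cut C A" unfolding K_def using cut_translate[of "inv a" A C] aV AV C_sub by simp
  ultimately show ?thesis
    using that[of K] A lam lam[OF X] Amin KV by (auto simp: eligible_def)
qed

text \<open>A generator in \<open>K\<close> never leads out of \<open>K\<close>, and one outside
  \<open>K\<close> leads out from every vertex.\<close>

lemma cut_subgroup:
  assumes "subgroup K G" "E \<subseteq> V"
  shows "cut E K = card K * card (E - K)"
proof -
  interpret K: subgroup K G by fact
  have "finite E" using assms finX by auto
  have "card {x \<in> K. x \<otimes> c \<notin> K} = (if c \<in> K then 0 else card K)" if "c \<in> E" for c
  proof (cases "c \<in> K")
    case False
    have "x \<otimes> c \<notin> K" if "x \<in> K" for x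
    proof
      assume "x \<otimes> c \<in> K"
      then have "inv x \<otimes> (x \<otimes> c) \<in> K" using that by auto
      then show False using that False \<open>c \<in> E\<close> assms by (simp add: m_assoc[symmetric] subset_iff)
    qed
    then have "{x \<in> K. x \<otimes> c \<notin> K} = K" by blast
    then show ?thesis using False by simp
  next
    case True
    then have e: "{x \<in> K. x \<otimes> c \<notin> K} = {}" by auto
    show ?thesis unfolding e using True by simp
  qed
  then have "cut E K = (\<Sum>c\<in>E. if c \<in> K then 0 else card K)" unfolding cut_def by simp
  also have "\<dots> = (\<Sum>c\<in>E - K. card K)" using \<open>finite E\<close> by (simp add: sum.If_cases Diff_eq)
  finally show ?thesis by simp
qed

lemma subgroup_generators:
  assumes "subgroup K G" "K \<noteq> V"
  shows "\<not> C \<subseteq> K"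
proof
  interpret K: subgroup K G by fact
  assume "C \<subseteq> K"
  then have "K = V" by (intro gen) (auto intro: K.m_closed K.subset[THEN subsetD])
  then show False using assms by simp
qed

lemma card_generators_subgroup:
  assumes "subgroup K G"
  shows "card (C \<inter> K) + 1 \<le> card K" and "card (C \<inter> K) + card (C - K) = card C"
proof -
  interpret K: subgroup K G by fact
  have "finite K" using K.subset finX by blast
  moreover have "insert \<one> (C \<inter> K) \<subseteq> K" by auto
  ultimately have "card (insert \<one> (C \<inter> K)) \<le> card K" by (rule card_mono)
  then show "card (C \<inter> K) + 1 \<le> card K" using C_one finC by simp
  show "card (C \<inter> K) + card (C - K) = card C"
    using finC by (metis Int_Diff_Un Int_Diff_disjoint card_Un_disjoint finite_Diff finite_Int)
qed

end

context cayley
begin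

subsection \<open>Cosets of a subgroup\<close>

text \<open>For a subgroup \<open>K\<close> this is the left coset \<open>x K\<close>; the
  generators in \<open>K\<close> are exactly those that stay within the left cosets.\<close>

definition blk :: "'a set \<Rightarrow> 'a \<Rightarrow> 'a set" where
  "blk K x = {y \<in> V. inv x \<otimes> y \<in> K}"

text \<open>For a subgroup \<open>K\<close> these are the unions of left cosets of
  \<open>K\<close>.\<close>

definition rinv :: "'a set \<Rightarrow> 'a set \<Rightarrow> bool" where
  "rinv K U \<longleftrightarrow> U \<subseteq> V \<and> (\<forall>x\<in>U. \<forall>b\<in>K. x \<otimes> b \<in> U)"

lemma blk_sub: "blk K x \<subseteq> V" by (auto simp: blk_def)

lemma subgroup_sub: "subgroup K G \<Longrightarrow> x \<in> K \<Longrightarrow> x \<in> V"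
  using subgroup.subset by blast

lemma blk_self: "subgroup K G \<Longrightarrow> x \<in> V \<Longrightarrow> x \<in> blk K x"
  by (simp add: blk_def subgroup.one_closed)

lemma subgroup_cancel:
  assumes "subgroup K G" "u \<in> K" "b \<in> V"
  shows "u \<otimes> b \<in> K \<longleftrightarrow> b \<in> K"
proof
  interpret K: subgroup K G by fact
  have u: "u \<in> V" using assms(2) by auto
  assume "u \<otimes> b \<in> K"
  then have "inv u \<otimes> (u \<otimes> b) \<in> K" by (rule K.m_closed[OF K.m_inv_closed[OF assms(2)]])
  moreover have "inv u \<otimes> (u \<otimes> b) = b" using u assms(3) by (simp add: m_assoc[symmetric])
  ultimately show "b \<in> K" by (simp only:)
qed (use assms in \<open>auto intro: subgroup.m_closed\<close>)

lemma blk_mult: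
  assumes "subgroup K G" "x \<in> V" "y \<in> blk K x" "b \<in> V"
  shows "y \<otimes> b \<in> blk K x \<longleftrightarrow> b \<in> K"
proof -
  interpret K: subgroup K G by fact
  let ?u = "inv x \<otimes> y"
  have y: "y \<in> V" "?u \<in> K" using assms(3) by (auto simp: blk_def)
  have uV: "?u \<in> V" using y assms by simp
  have eq: "inv x \<otimes> (y \<otimes> b) = ?u \<otimes> b" using assms y by (simp add: m_assoc)
  have "?u \<otimes> b \<in> K \<longleftrightarrow> b \<in> K" by (rule subgroup_cancel[OF assms(1) y(2) assms(4)])
  then show ?thesis using y assms(4) unfolding blk_def mem_Collect_eq eq by blast
qed

lemma blk_eq_translate:
  assumes "subgroup K G" "x \<in> V"
  shows "blk K x = (\<otimes>) x ` K"
proof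
  interpret K: subgroup K G by fact
  show "(\<otimes>) x ` K \<subseteq> blk K x"
    using blk_mult[OF assms blk_self[OF assms]] by (auto intro: K.subset[THEN subsetD])
  show "blk K x \<subseteq> (\<otimes>) x ` K"
  proof
    fix y assume "y \<in> blk K x"
    then have y: "y \<in> V" "inv x \<otimes> y \<in> K" by (auto simp: blk_def)
    then have "y = x \<otimes> (inv x \<otimes> y)" using assms by (simp add: m_assoc[symmetric])
    then show "y \<in> (\<otimes>) x ` K" using y by blast
  qed
qed

lemma card_blk: "subgroup K G \<Longrightarrow> x \<in> V \<Longrightarrow> card (blk K x) = card K"
  by (simp add: blk_eq_translate card_translate subgroup.subset)

lemma rinv_blk: "subgroup K G \<Longrightarrow> x \<in> V \<Longrightarrow> rinv K (blk K x)"
  using blk_mult blk_sub subgroup_sub unfolding rinv_def by blast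

lemma blk_rinv_sub:
  assumes "subgroup K G" "rinv K U" "x \<in> U"
  shows "blk K x \<subseteq> U"
proof -
  have U: "x \<in> V" "\<And>b. b \<in> K \<Longrightarrow> x \<otimes> b \<in> U" using assms by (auto simp: rinv_def)
  show ?thesis unfolding blk_eq_translate[OF assms(1) U(1)] using U(2) by blast
qed

lemma blk_eq:
  assumes "subgroup K G" "x \<in> V" "y \<in> blk K x"
  shows "blk K y = blk K x"
proof (rule card_subset_eq)
  have "y \<in> V" using assms(3) blk_sub by blast
  then show "card (blk K y) = card (blk K x)" using assms by (simp add: card_blk)
  show "blk K y \<subseteq> blk K x" using assms by (intro blk_rinv_sub rinv_blk)
qed (use finX blk_sub in blast)

lemma rinv_compl:
  assumes "subgroup K G" "rinv K U"
  shows "rinv K (V - U)"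
  unfolding rinv_def
proof (intro conjI ballI)
  interpret K: subgroup K G by fact
  fix x b assume x: "x \<in> V - U" and b: "b \<in> K"
  have bV: "b \<in> V" using b by auto
  have "x \<otimes> b \<notin> U"
  proof
    assume "x \<otimes> b \<in> U"
    then have "(x \<otimes> b) \<otimes> inv b \<in> U" using assms(2) b by (auto simp: rinv_def)
    then show False using x bV by (simp add: m_assoc)
  qed
  then show "x \<otimes> b \<in> V - U" using x bV by simp
qed simp

lemma rinv_card:
  assumes "subgroup K G" "rinv K U" "U \<noteq> {}"
  shows "card K \<le> card U"
proof -
  obtain x where x: "x \<in> U" using assms by blast
  then have xV: "x \<in> V" using assms by (auto simp: rinv_def)
  have "card (blk K x) \<le> card U"
    using assms x by (intro card_mono blk_rinv_sub finX) (auto simp: rinv_def)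
  then show ?thesis using card_blk[OF assms(1) xV] by simp
qed

lemma cut_rinv: "rinv K U \<Longrightarrow> E \<subseteq> K \<Longrightarrow> cut E U = 0"
proof -
  assume U: "rinv K U" "E \<subseteq> K"
  have "{x \<in> U. x \<otimes> c \<notin> U} = {}" if "c \<in> E" for c using U that by (auto simp: rinv_def)
  then show ?thesis unfolding cut_def by (intro sum.neutral ballI) (metis card.empty)
qed

text \<open>Arcs along generators in \<open>K\<close> stay within cosets, so none runs between
  \<open>U\<close> and its complement.\<close>

lemma cut_rinv_split:
  assumes "subgroup K G" "rinv K U" "E \<subseteq> K" "X \<subseteq> V"
  shows "cut E X = cut E (X \<inter> U) + cut E (X - U)"
  unfolding cut_def sum.distrib[symmetric]
proof (rule sum.cong[OF refl])
  fix c assume "c \<in> E"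
  then have c: "c \<in> K" using assms by blast
  have U: "x \<otimes> c \<in> U \<longleftrightarrow> x \<in> U" if "x \<in> V" for x
    using that assms(2) rinv_compl[OF assms(1,2)] c by (auto simp: rinv_def)
  have "{x \<in> X. x \<otimes> c \<notin> X} = {x \<in> X \<inter> U. x \<otimes> c \<notin> X \<inter> U} \<union> {x \<in> X - U. x \<otimes> c \<notin> X - U}"
    using U assms(4) by auto
  also have "card \<dots> = card {x \<in> X \<inter> U. x \<otimes> c \<notin> X \<inter> U} + card {x \<in> X - U. x \<otimes> c \<notin> X - U}"
    using finX[OF assms(4)] by (intro card_Un_disjoint) auto
  finally show "card {x \<in> X. x \<otimes> c \<notin> X}
    = card {x \<in> X \<inter> U. x \<otimes> c \<notin> X \<inter> U} + card {x \<in> X - U. x \<otimes> c \<notin> X - U}" .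
qed

lemma cut_rinv_diff:
  assumes "subgroup K G" "rinv K U" "E \<subseteq> K" "X \<subseteq> V"
  shows "cut E (U - X) = cut E (X \<inter> U)"
proof -
  have EV: "E \<subseteq> V" using assms subgroup.subset by blast
  have UV: "U \<subseteq> V" using assms by (simp add: rinv_def)
  have "cut E (X \<inter> U) = cut E (V - (X \<inter> U))" using EV assms(4) by (intro cut_compl[symmetric]) auto
  also have "\<dots> = cut E ((V - (X \<inter> U)) \<inter> U) + cut E ((V - (X \<inter> U)) - U)"
    by (rule cut_rinv_split[OF assms(1-3)]) auto
  also have "(V - (X \<inter> U)) \<inter> U = U - X" using UV by auto
  also have "(V - (X \<inter> U)) - U = V - U" by auto
  also have "cut E (V - U) = 0" by (rule cut_rinv[OF rinv_compl[OF assms(1,2)] assms(3)])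
  finally show ?thesis by simp
qed

text \<open>An exit from \<open>U\<close> that is no exit from \<open>X\<close> starts in
  \<open>U - X\<close> or ends in \<open>X - U\<close>, and right multiplication by one generator is
  injective.\<close>

lemma cut_change:
  assumes "X \<subseteq> V" "U \<subseteq> V" "E \<subseteq> V"
  shows "cut E U \<le> cut E X + card E * card ((U - X) \<union> (X - U))"
proof -
  have fX: "finite X" "finite U" using assms finX by auto
  have "card {x \<in> U. x \<otimes> c \<notin> U} \<le> card {x \<in> X. x \<otimes> c \<notin> X} + card ((U - X) \<union> (X - U))"
    if "c \<in> E" for c
  proof -
    have c: "c \<in> V" using that assms by blast
    let ?B = "{x \<in> V. x \<otimes> c \<in> X - U}"
    have cB: "card ?B = card (X - U)" using assms c by (intro card_preimage) auto
    have "{x \<in> U. x \<otimes> c \<notin> U} \<subseteq> {x \<in> X. x \<otimes> c \<notin> X} \<union> ((U - X) \<union> ?B)"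
      using assms c by auto
    then have "card {x \<in> U. x \<otimes> c \<notin> U} \<le> card ({x \<in> X. x \<otimes> c \<notin> X} \<union> ((U - X) \<union> ?B))"
      using fX fin by (intro card_mono) auto
    also have "\<dots> \<le> card {x \<in> X. x \<otimes> c \<notin> X} + (card (U - X) + card ?B)"
      by (meson add_left_mono card_Un_le order_trans)
    also have "card (U - X) + card ?B = card ((U - X) \<union> (X - U))"
      using fX cB by (subst card_Un_disjoint) auto
    finally show ?thesis .
  qed
  then have "cut E U \<le> (\<Sum>c\<in>E. card {x \<in> X. x \<otimes> c \<notin> X} + card ((U - X) \<union> (X - U)))"
    unfolding cut_def by (rule sum_mono)
  also have "\<dots> = cut E X + card E * card ((U - X) \<union> (X - U))"
    unfolding cut_def by (simp add: sum.distrib)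
  finally show ?thesis .
qed

text \<open>Rounding a set to the union \<open>U\<close> of the cosets in which it has a majority. The error \<open>N\<close> is
  sparse in every coset and has the same cut as \<open>X\<close> with respect to generators inside \<open>K\<close>.\<close>

lemma majority:
  assumes K: "subgroup K G" and X: "X \<subseteq> V"
  obtains U N where "rinv K U" "N = (U - X) \<union> (X - U)" "N \<subseteq> V"
    "\<And>x. x \<in> V \<Longrightarrow> 2 * card (N \<inter> blk K x) \<le> card K"
    "\<And>E. E \<subseteq> K \<Longrightarrow> cut E N = cut E X"
proof -
  define U where "U = {x \<in> V. card K < 2 * card (X \<inter> blk K x)}"
  define N where "N = (U - X) \<union> (X - U)"
  have U: "rinv K U"
    unfolding rinv_def
  proof (intro conjI ballI)
    fix x b assume x: "x \<in> U" and b: "b \<in> K"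
    have xV: "x \<in> V" and bV: "b \<in> V" using x b subgroup_sub[OF K] by (auto simp: U_def)
    have "x \<otimes> b \<in> blk K x" using blk_mult[OF K xV blk_self[OF K xV] bV] b by simp
    then have "blk K (x \<otimes> b) = blk K x" by (rule blk_eq[OF K xV])
    then show "x \<otimes> b \<in> U" using x xV bV by (simp add: U_def)
  qed (auto simp: U_def)
  have UV: "U \<subseteq> V" by (auto simp: U_def)
  have NV: "N \<subseteq> V" using UV X by (auto simp: N_def)
  have sparse: "2 * card (N \<inter> blk K x) \<le> card K" if x: "x \<in> V" for x
  proof (cases "x \<in> U")
    case True
    then have "blk K x \<subseteq> U" by (rule blk_rinv_sub[OF K U])
    then have "N \<inter> blk K x = blk K x - X \<inter> blk K x" by (auto simp: N_def)
    moreover have "card (blk K x - X \<inter> blk K x) = card (blk K x) - card (X \<inter> blk K x)"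
      using finX[OF blk_sub] by (intro card_Diff_subset) auto
    ultimately have "card (N \<inter> blk K x) = card K - card (X \<inter> blk K x)"
      using card_blk[OF K x] by simp
    moreover have "card K < 2 * card (X \<inter> blk K x)" using True by (simp add: U_def)
    ultimately show ?thesis by linarith
  next
    case False
    then have "x \<in> V - U" using x by simp
    then have "blk K x \<subseteq> V - U" by (rule blk_rinv_sub[OF K rinv_compl[OF K U]])
    then have "N \<inter> blk K x = X \<inter> blk K x" by (auto simp: N_def)
    then show ?thesis using False x by (simp add: U_def)
  qed
  have "cut E N = cut E X" if E: "E \<subseteq> K" for E
  proof -
    have "cut E N = cut E (N \<inter> U) + cut E (N - U)" by (rule cut_rinv_split[OF K U E NV])
    also have "N \<inter> U = U - X" by (auto simp: N_def)
    also have "N - U = X - U" by (auto simp: N_def)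
    also have "cut E (U - X) = cut E (X \<inter> U)" by (rule cut_rinv_diff[OF K U E X])
    finally show ?thesis using cut_rinv_split[OF K U E X] by simp
  qed
  then show ?thesis using that[of U N] U N_def NV sparse by blast
qed

section \<open>Subgroups with a single outgoing generator\<close>

lemma cut_in_blk:
  assumes "subgroup K G" "x \<in> V" "N \<subseteq> blk K x" "c \<in> V" "c \<notin> K"
  shows "cut {c} N = card N"
proof -
  have "{y \<in> N. y \<otimes> c \<notin> N} = N" using blk_mult[OF assms(1,2)] assms by blast
  then show ?thesis by (simp add: cut_def)
qed

text \<open>The product is concave in \<open>j\<close>, so on an interval it is least at an end; on
  1..r and on 2..r - 1 both ends give the stated value.\<close>

lemma mult_ge_sum:
  fixes j r :: nat
  shows "1 \<le> j \<Longrightarrow> j \<le> r \<Longrightarrow> r \<le> j * (r + 1 - j)"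
    and "2 \<le> j \<Longrightarrow> j + 1 \<le> r \<Longrightarrow> 2 * r - 2 \<le> j * (r + 1 - j)"
proof -
  assume j: "1 \<le> j" "j \<le> r"
  then obtain a t where "j = Suc a" "r = j + t" by (metis Suc_le_D One_nat_def le_Suc_ex)
  then show "r \<le> j * (r + 1 - j)" by (simp add: algebra_simps)
next
  assume j: "2 \<le> j" "j + 1 \<le> r"
  then obtain a t where "j = a + 2" "r = j + 1 + t" by (metis le_Suc_ex add.commute)
  then show "2 * r - 2 \<le> j * (r + 1 - j)" by (simp add: algebra_simps)
qed

lemma cut_one_exit:
  assumes "C - K = {c}"
  shows "cut C X = cut (C \<inter> K) X + cut {c} X"
  using cut_Int_Diff[OF finC, of X K] assms by simp

text \<open>Let N be the rounding error and r = |C \<inter> K|. Each coset that N meets costs at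
  least r exits along \<open>C \<inter> K\<close>, and at least one of the 2 r allowed exits is
  along \<open>c\<close>, so N lies in one coset. If \<open>U\<close> is trivial, N is
  \<open>X\<close> or its complement, and \<open>c\<close> leads out from all of it; otherwise
  \<open>U\<close> has at least |K| exits along \<open>c\<close>, and since \<open>X\<close> has at
  most three, N must be large. Both contradict the cost 2 r - 2 of two or more vertices.\<close>

lemma one_exit_dense:
  assumes K: "subgroup K G" and c: "C - K = {c}"
    and sz: "card K \<le> 2 * card (C \<inter> K)" "4 \<le> card (C \<inter> K)" "5 \<le> card K"
    and exits: "\<And>U. \<lbrakk>rinv K U; U \<noteq> {}; U \<noteq> V\<rbrakk> \<Longrightarrow> card K \<le> cut {c} U"
    and X: "eligible 3 X" "1 \<le> cut {c} X" "cut {c} X \<le> 3" "cut C X \<le> 2 * card (C \<inter> K)"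
  shows False
proof -
  let ?E = "C \<inter> K" and ?r = "card (C \<inter> K)" and ?d = "cut {c} X"
  have XV: "X \<subseteq> V" and X3: "3 \<le> card X" "3 \<le> card (V - X)" using X(1) by (auto simp: eligible_def)
  have cV: "c \<in> V" and cK: "c \<notin> K" using c C_sub by auto
  have E: "?E \<subseteq> K" "?E \<subseteq> V" "\<one> \<notin> ?E" using C_sub C_one by auto
  obtain U N where U: "rinv K U" and N: "N = (U - X) \<union> (X - U)" "N \<subseteq> V"
    and sparse: "\<And>x. x \<in> V \<Longrightarrow> 2 * card (N \<inter> blk K x) \<le> card K"
    and cN: "\<And>E. E \<subseteq> K \<Longrightarrow> cut E N = cut E X"
    using majority[OF K XV] by blast
  have UV: "U \<subseteq> V" using U by (simp add: rinv_def)
  have cost: "cut ?E N + ?d \<le> 2 * ?r" using X(4) cut_one_exit[OF c] cN[OF E(1)] by simp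
  have piece: "?r \<le> cut ?E Y" if "Y \<subseteq> V" "Y \<noteq> {}" "2 * card Y \<le> card K" for Y
  proof -
    have "1 \<le> card Y" using that finX by (simp add: Suc_le_eq card_gt_0_iff)
    then have "?r \<le> card Y * (?r + 1 - card Y)" using that sz by (intro mult_ge_sum) auto
    then show ?thesis using cut_ge_degree[OF that(1) E(2,3)] by linarith
  qed
  have "N \<noteq> {}"
  proof
    assume "N = {}"
    then have UX: "U = X" using N by auto
    have "X \<noteq> {}" "X \<noteq> V" using X3 by auto
    then have "card K \<le> ?d" using exits[of X] U UX by blast
    then show False using X(3) sz by simp
  qed
  then obtain x where x: "x \<in> N" by blast
  have xV: "x \<in> V" using x N by blast
  have split: "cut ?E N = cut ?E (N \<inter> blk K x) + cut ?E (N - blk K x)"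
    by (rule cut_rinv_split[OF K rinv_blk[OF K xV] E(1) N(2)])
  have p1: "?r \<le> cut ?E (N \<inter> blk K x)"
    using x blk_self[OF K xV] N(2) sparse[OF xV] by (intro piece) auto
  have "N - blk K x = {}"
  proof (rule ccontr)
    assume "N - blk K x \<noteq> {}"
    then obtain z where z: "z \<in> N - blk K x" by blast
    let ?Z = "(N - blk K x) \<inter> blk K z"
    have zV: "z \<in> V" using z N by blast
    have "card ?Z \<le> card (N \<inter> blk K z)" using finX[OF N(2)] by (intro card_mono) auto
    then have "2 * card ?Z \<le> card K" using sparse[OF zV] by linarith
    then have "?r \<le> cut ?E ?Z"
      using z blk_self[OF K zV] N(2) by (intro piece) auto
    moreover have "cut ?E (N - blk K x) = cut ?E ?Z + cut ?E (N - blk K x - blk K z)"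
      by (rule cut_rinv_split[OF K rinv_blk[OF K zV] E(1)]) (use N(2) in blast)
    ultimately show False using split p1 cost X(2) by linarith
  qed
  then have Nx: "N \<subseteq> blk K x" by blast
  then have Nj: "N \<inter> blk K x = N" by blast
  have half: "2 * card N \<le> card K" using sparse[OF xV] Nj by simp
  have cutN: "cut {c} N = card N" by (rule cut_in_blk[OF K xV Nx cV cK])
  have deg: "card N * (?r + 1 - card N) \<le> cut ?E N" by (rule cut_ge_degree[OF N(2) E(2,3)])
  have deg2: "2 * ?r - 2 \<le> cut ?E N" if "2 \<le> card N" "card N + 1 \<le> ?r"
    using mult_ge_sum(2)[OF that] deg by linarith
  show False
  proof (cases "U = {} \<or> U = V")
    case True
    then have "N = X \<or> N = V - X" using N XV by auto
    then have "3 \<le> card N" "cut {c} N = ?d" using X3 cut_compl[OF XV, of "{c}"] cV by auto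
    then have j: "card N = 3" "?d = 3" using cutN X(3) by auto
    \<comment> \<open>Three vertices cost 2 r - 2 and have three exits along \<open>c\<close>, one
      more than the budget of 2 r.\<close>
    then have "2 * ?r - 2 \<le> cut ?E N" using sz by (intro deg2) auto
    then show False using cost j by linarith
  next
    case False
    then have "card K \<le> cut {c} U" using exits U by blast
    also have "\<dots> \<le> ?d + card N" using cut_change[OF XV UV, of "{c}"] cV N(1) by simp
    finally have j: "card K \<le> ?d + card N" .
    have "2 * ?r - 2 \<le> cut ?E N" by (rule deg2) (use j half X(3) sz in linarith)+
    then show False using cost j half sz by linarith
  qed
qed

text \<open>The budget is now 3 r - 1 and Mantel's bound replaces the degree bound, so the error N
  may meet two cosets. If N has at least five vertices, one trace costs 2 r - 2 and the other r;
  this leaves one exit along \<open>c\<close> and forbids two traces with two vertices each. For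
  trivial \<open>U\<close> the sizes 1 and at least 4 are impossible, since \<open>c\<close> maps
  all but at most one vertex of either trace into the other. For proper \<open>U\<close>, N would
  need at least |K| - 1 vertices.\<close>

lemma one_exit_triangle_free:
  assumes K: "subgroup K G" and c: "C - K = {c}"
    and sz: "2 * card (C \<inter> K) \<le> card K" "card K + 1 \<le> 3 * card (C \<inter> K)" "4 \<le> card (C \<inter> K)"
    and exits: "\<And>U. \<lbrakk>rinv K U; U \<noteq> {}; U \<noteq> V\<rbrakk> \<Longrightarrow> card K \<le> cut {c} U"
    and mantel: "\<And>Y. Y \<subseteq> V \<Longrightarrow>
      2 * card Y * card (C \<inter> K) \<le> 2 * cut (C \<inter> K) Y + card Y * card Y"
    and X: "eligible 5 X" "1 \<le> cut {c} X" "cut {c} X \<le> 3" "cut C X + 1 \<le> 3 * card (C \<inter> K)"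
  shows False
proof -
  let ?E = "C \<inter> K" and ?r = "card (C \<inter> K)" and ?d = "cut {c} X"
  have XV: "X \<subseteq> V" and X5: "5 \<le> card X" "5 \<le> card (V - X)" using X(1) by (auto simp: eligible_def)
  have cV: "c \<in> V" and cK: "c \<notin> K" using c C_sub by auto
  have E: "?E \<subseteq> K" "?E \<subseteq> V" "\<one> \<notin> ?E" using C_sub C_one by auto
  obtain U N where U: "rinv K U" and N: "N = (U - X) \<union> (X - U)" "N \<subseteq> V"
    and sparse: "\<And>x. x \<in> V \<Longrightarrow> 2 * card (N \<inter> blk K x) \<le> card K"
    and cN: "\<And>E. E \<subseteq> K \<Longrightarrow> cut E N = cut E X"
    using majority[OF K XV] by blast
  have UV: "U \<subseteq> V" using U by (simp add: rinv_def)
  have fN: "finite N" using finX[OF N(2)] .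
  have cost: "cut ?E N + ?d + 1 \<le> 3 * ?r" using X(4) cut_one_exit[OF c] cN[OF E(1)] by simp
  have piece2: "2 * ?r - 2 \<le> cut ?E Y"
    if Y: "Y \<subseteq> V" "2 \<le> card Y" "2 * card Y \<le> card K" for Y
  proof -
    have "card Y + 2 \<le> 2 * ?r" using Y sz by linarith
    \<comment> \<open>Mantel's bound |Y|(2 r - |Y|)/2 equals 2 r - 2 at |Y| = 2 and at |Y| = 2 r -
      2; \<open>t\<close> is the distance to the upper end.\<close>
    then obtain t where t: "2 * ?r = card Y + 2 + t" by (metis le_Suc_ex)
    obtain a where a: "card Y = a + 2" using Y(2) by (metis le_Suc_ex add.commute)
    have "card Y * (2 * ?r) \<le> 2 * cut ?E Y + card Y * card Y"
      using mantel[OF Y(1)] by (simp add: algebra_simps)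
    then have "card Y * (2 + t) \<le> 2 * cut ?E Y" unfolding t by (simp add: algebra_simps)
    then have "2 * (2 * ?r - 2) \<le> 2 * cut ?E Y" unfolding t a by (simp add: algebra_simps)
    then show ?thesis by simp
  qed
  have piece: "?r \<le> cut ?E Y" if "Y \<subseteq> V" "Y \<noteq> {}" "2 * card Y \<le> card K" for Y
  proof (cases "card Y = 1")
    case True
    then show ?thesis using mantel[OF that(1)] by simp
  next
    case False
    moreover have "0 < card Y" using that finX by (simp add: card_gt_0_iff)
    ultimately show ?thesis using piece2[OF that(1) _ that(3)] sz by linarith
  qed
  have "N \<noteq> {}"
  proof
    assume "N = {}"
    then have UX: "U = X" using N by auto
    have "X \<noteq> {}" "X \<noteq> V" using X5 by auto
    then have "card K \<le> ?d" using exits[of X] U UX by blast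
    then show False using X(3) sz by simp
  qed
  then obtain x where x: "x \<in> N" by blast
  have xV: "x \<in> V" using x N by blast
  define A where "A = N \<inter> blk K x"
  define B where "B = N - blk K x"
  have AB: "A \<subseteq> V" "B \<subseteq> V" "A \<inter> B = {}" "A \<union> B = N" using N(2) by (auto simp: A_def B_def)
  have split: "cut ?E N = cut ?E A + cut ?E B"
    unfolding A_def B_def by (rule cut_rinv_split[OF K rinv_blk[OF K xV] E(1) N(2)])
  have A: "A \<noteq> {}" "2 * card A \<le> card K"
    using x blk_self[OF K xV] sparse[OF xV] by (auto simp: A_def)
  have edge: "N = X \<or> N = V - X" if "U = {} \<or> U = V" using that N XV by auto
  have dN: "5 \<le> card N" "cut {c} N = ?d" if "U = {} \<or> U = V"
    using edge[OF that] X5 cut_compl[OF XV, of "{c}"] cV by auto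
  have proper: "card K \<le> ?d + card N" if "\<not> (U = {} \<or> U = V)"
  proof -
    have "card K \<le> cut {c} U" using exits U that by blast
    also have "\<dots> \<le> ?d + card N" using cut_change[OF XV UV, of "{c}"] cV N(1) by simp
    finally show ?thesis .
  qed
  show False
  proof (cases "B = {}")
    case True
    then have "N = A" using AB by blast
    then have "N \<subseteq> blk K x" by (auto simp: A_def)
    then have "cut {c} N = card N" by (rule cut_in_blk[OF K xV _ cV cK])
    then show False using dN proper A \<open>N = A\<close> X(3) sz by force
  next
    case False
    then obtain z where z: "z \<in> B" by blast
    have zV: "z \<in> V" using z AB by blast
    have splitB: "cut ?E B = cut ?E (B \<inter> blk K z) + cut ?E (B - blk K z)"
      by (rule cut_rinv_split[OF K rinv_blk[OF K zV] E(1) AB(2)])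
    have half: "2 * card (Y \<inter> blk K w) \<le> card K" if "Y \<subseteq> N" "w \<in> V" for Y w
    proof -
      have "card (Y \<inter> blk K w) \<le> card (N \<inter> blk K w)" using fN that by (intro card_mono) auto
      then show ?thesis using sparse[OF that(2)] by linarith
    qed
    have pB: "?r \<le> cut ?E (B \<inter> blk K z)"
      using z blk_self[OF K zV] AB half[of B z] zV by (intro piece) auto
    have pA: "?r \<le> cut ?E A" using A AB by (intro piece) auto
    have "B - blk K z = {}"
    proof (rule ccontr)
      assume "B - blk K z \<noteq> {}"
      then obtain w where w: "w \<in> B - blk K z" by blast
      have wV: "w \<in> V" using w AB by blast
      have "?r \<le> cut ?E ((B - blk K z) \<inter> blk K w)"
        using w blk_self[OF K wV] AB half[of "B - blk K z" w] wV by (intro piece) auto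
      moreover have "cut ?E (B - blk K z)
          = cut ?E ((B - blk K z) \<inter> blk K w) + cut ?E (B - blk K z - blk K w)"
        by (rule cut_rinv_split[OF K rinv_blk[OF K wV] E(1)]) (use AB(2) in blast)
      ultimately show False using split splitB pA pB cost by linarith
    qed
    then have Bz: "B \<subseteq> blk K z" by blast
    have "B \<subseteq> N" using AB by blast
    then have B: "2 * card B \<le> card K" using half[of B z] Bz zV by (simp add: Int_absorb2)
    have cN: "card N = card A + card B"
      using AB fN by (metis card_Un_disjoint finite_Un)
    have pB': "?r \<le> cut ?E B" using pB splitB by linarith
    have pA2: "2 * ?r - 2 \<le> cut ?E A" if "2 \<le> card A" using that A AB by (intro piece2) auto
    have pB2: "2 * ?r - 2 \<le> cut ?E B" if "2 \<le> card B" using that B AB by (intro piece2) auto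
    have d1: "?d = 1" if "5 \<le> card N"
    proof -
      have "2 \<le> card A \<or> 2 \<le> card B" using that cN by linarith
      then have "3 * ?r - 2 \<le> cut ?E N" using pA2 pB2 pA pB' split sz by linarith
      then show ?thesis using cost X(2) sz by linarith
    qed
    have both: "\<not> (2 \<le> card A \<and> 2 \<le> card B)" if "5 \<le> card N"
      using pA2 pB2 split cost sz d1[OF that] by linarith
    show False
    proof (cases "U = {} \<or> U = V")
      case True
      note N5 = dN[OF True]
      have exit: "card Y \<le> ?d + card (N - Y)" if Y: "Y = A \<or> Y = B" for Y
      proof -
        have "A \<subseteq> blk K x" by (auto simp: A_def)
        then obtain w where w: "w \<in> V" "Y \<subseteq> blk K w" using Y Bz xV zV by blast
        have YN: "Y \<subseteq> N" using Y AB by blast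
        have "Y \<subseteq> {y \<in> N. y \<otimes> c \<notin> N} \<union> {y \<in> V. y \<otimes> c \<in> N - Y}"
          using YN N(2) blk_mult[OF K w(1) _ cV] w(2) cK by auto
        then have "card Y \<le> card ({y \<in> N. y \<otimes> c \<notin> N} \<union> {y \<in> V. y \<otimes> c \<in> N - Y})"
          using fN fin by (intro card_mono) auto
        also have "\<dots> \<le> card {y \<in> N. y \<otimes> c \<notin> N} + card {y \<in> V. y \<otimes> c \<in> N - Y}" by (rule card_Un_le)
        also have "card {y \<in> V. y \<otimes> c \<in> N - Y} = card (N - Y)" using N(2) cV by (intro card_preimage) auto
        finally show ?thesis using N5(2) by (simp add: cut_def)
      qed
      have "N - A = B" "N - B = A" using AB by auto
      then have "card A \<le> 1 + card B" "card B \<le> 1 + card A"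
        using exit[of A] exit[of B] d1[OF N5(1)] by auto
      then show False using both[OF N5(1)] N5(1) cN by linarith
    next
      case False
      note p = proper[OF False]
      have N5: "5 \<le> card N" using p X(3) sz by linarith
      then show False using both d1 p cN A B sz by linarith
    qed
  qed
qed

end

subsection \<open>Walks\<close>

context cayley
begin

text \<open>The n-fold product set of \<open>C\<close>: \<open>\<one> \<in> walk n\<close> says that
  there are closed walks of length \<open>n\<close> at the identity and, by translation,
  everywhere.\<close>

primrec walk :: "nat \<Rightarrow> 'a set" where
  "walk 0 = {\<one>}"
| "walk (Suc n) = {x \<otimes> c | x c. x \<in> walk n \<and> c \<in> C}"

lemma walk_sub: "walk n \<subseteq> V"
  by (induction n) (auto simp: C_carrier)

lemma walk_1: "c \<in> C \<Longrightarrow> c \<in> walk 1"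
  using C_carrier by force

lemma walk_add: "x \<in> walk m \<Longrightarrow> y \<in> walk n \<Longrightarrow> x \<otimes> y \<in> walk (m + n)"
proof (induction n arbitrary: y)
  case 0
  then have "x \<in> V" using walk_sub by blast
  then show ?case using 0 by simp
next
  case (Suc n)
  then obtain w c where w: "w \<in> walk n" "c \<in> C" "y = w \<otimes> c" by auto
  have "x \<otimes> y = (x \<otimes> w) \<otimes> c"
    using w Suc.prems walk_sub C_carrier by (simp add: m_assoc subset_iff)
  then show ?case using Suc.IH[OF Suc.prems(1) w(1)] w(2) by auto
qed

lemma walk_inv: "x \<in> walk n \<Longrightarrow> inv x \<in> walk n"
proof (induction n arbitrary: x)
  case (Suc n)
  then obtain w c where w: "w \<in> walk n" "c \<in> C" "x = w \<otimes> c" by auto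
  have "inv x = inv c \<otimes> inv w"
    using w walk_sub C_carrier by (simp add: inv_mult_group subset_iff)
  then show ?case using walk_add[OF walk_1[OF C_inv[OF w(2)]] Suc.IH[OF w(1)]] by simp
qed simp

lemma walk_path:
  assumes "x \<in> walk n"
  obtains z where "z 0 = \<one>" "z n = x" "\<And>i. i \<le> n \<Longrightarrow> z i \<in> V"
    "\<And>i. i < n \<Longrightarrow> \<exists>c\<in>C. z (Suc i) = z i \<otimes> c"
proof -
  have "\<exists>z. z 0 = \<one> \<and> z n = x \<and> (\<forall>i\<le>n. z i \<in> V) \<and> (\<forall>i<n. \<exists>c\<in>C. z (Suc i) = z i \<otimes> c)"
    using assms
  proof (induction n arbitrary: x)
    case 0
    then show ?case by (intro exI[of _ "\<lambda>_. \<one>"]) auto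
  next
    case (Suc n)
    then obtain w c where w: "w \<in> walk n" "c \<in> C" "x = w \<otimes> c" by auto
    from Suc.IH[OF w(1)] obtain z where z: "z 0 = \<one>" "z n = w" "\<forall>i\<le>n. z i \<in> V"
      "\<forall>i<n. \<exists>c\<in>C. z (Suc i) = z i \<otimes> c" by blast
    have "x \<in> V" using Suc.prems walk_sub by blast
    then show ?case using z w(2,3)
      by (intro exI[of _ "z(Suc n := x)"]) (auto simp: less_Suc_eq le_Suc_eq)
  qed
  then show ?thesis using that by blast
qed

lemma path_walk:
  assumes z: "\<And>i. i \<le> n \<Longrightarrow> z i \<in> V" "\<And>i. i < n \<Longrightarrow> \<exists>c\<in>C. z (Suc i) = z i \<otimes> c"
    and "i \<le> j" "j \<le> n"
  shows "inv (z i) \<otimes> z j \<in> walk (j - i)"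
  using assms(3,4)
proof (induction "j - i" arbitrary: j)
  case 0
  then show ?case using z(1) by simp
next
  case (Suc d)
  then obtain j' where j': "j = Suc j'" "d = j' - i" "i \<le> j'" by (cases j) auto
  obtain c where c: "c \<in> C" "z j = z j' \<otimes> c" using z(2)[of j'] j' Suc.prems by auto
  have "inv (z i) \<otimes> z j = (inv (z i) \<otimes> z j') \<otimes> c"
    using c z(1)[of i] z(1)[of j'] j' Suc.prems C_carrier by (simp add: m_assoc)
  moreover have "inv (z i) \<otimes> z j' \<in> walk (j' - i)" using Suc.hyps(1)[of j'] j' Suc.prems by simp
  moreover have "j - i = Suc (j' - i)" using j' by simp
  ultimately show ?case using c(1) by auto
qed

text \<open>By minimality, two vertices of the walk with a common neighbour are at distance \<open>2\<close> on it, so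
  it meets every neighbourhood at most twice.\<close>

lemma odd_girth_bound:
  assumes g: "\<one> \<in> walk g" "odd g" "5 \<le> g"
    and least: "\<And>m. \<one> \<in> walk m \<Longrightarrow> odd m \<Longrightarrow> g \<le> m"
  shows "g * card C \<le> 2 * card V"
proof -
  obtain z where z: "z 0 = \<one>" "z g = \<one>" "\<And>i. i \<le> g \<Longrightarrow> z i \<in> V"
    "\<And>i. i < g \<Longrightarrow> \<exists>c\<in>C. z (Suc i) = z i \<otimes> c"
    using walk_path[OF g(1)] by blast
  let ?N = "\<lambda>v. {i \<in> {..<g}. inv (z i) \<otimes> v \<in> C}"
  \<comment> \<open>The two arcs of the closed walk between \<open>z i\<close> and
    \<open>z j\<close>, each closed up through \<open>v\<close>, have lengths j - i + 2 and g - (j -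
    i) + 2. Exactly one is odd, and minimality of \<open>g\<close> bounds it from below.\<close>
  have diff: "j = i + 2 \<or> j + 2 = i + g" if v: "v \<in> V" and i: "i \<in> ?N v" and j: "j \<in> ?N v" and ij: "i < j" for v i j
  proof -
    have ig: "i < g" "j < g" "z i \<in> V" "z j \<in> V" using i j z(3) by auto
    define e f where "e = inv (z i) \<otimes> v" and "f = inv (z j) \<otimes> v"
    have ef: "e \<in> C" "f \<in> C" "v = z i \<otimes> e" "v = z j \<otimes> f"
      using i j ig v by (auto simp: e_def f_def m_assoc[symmetric])
    have efV: "e \<in> V" "f \<in> V" using ef C_carrier by auto
    have zz: "inv (z i) \<otimes> z j = e \<otimes> inv f"
    proof -
      have "z j = v \<otimes> inv f" using ef(4) ig efV by (simp add: m_assoc)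
      then show ?thesis using ef(3) ig efV by (simp add: m_assoc[symmetric])
    qed
    have w2: "e \<otimes> inv f \<in> walk 2" "f \<otimes> inv e \<in> walk 2"
      using walk_add[OF walk_1 walk_1] ef C_inv by (auto simp: numeral_2_eq_2)
    have w: "inv (z i) \<otimes> z j \<in> walk (j - i)" by (rule path_walk[of g z]) (use z ij ig in auto)
    have "inv (inv (z i) \<otimes> z j) \<otimes> (e \<otimes> inv f) \<in> walk ((j - i) + 2)"
      by (rule walk_add[OF walk_inv[OF w] w2(1)])
    then have "\<one> \<in> walk (j - i + 2)" using zz efV by simp
    then have o: "odd (j - i) \<Longrightarrow> g \<le> j - i + 2" using least by simp
    have "inv (z 0) \<otimes> z i \<in> walk (i - 0)" by (rule path_walk[of g z]) (use z ij ig in auto)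
    moreover have "inv (z j) \<otimes> z g \<in> walk (g - j)" by (rule path_walk[of g z]) (use z ij ig in auto)
    ultimately have "(inv (z j) \<otimes> z i) \<in> walk (g - j + i)"
      using walk_add[of "inv (z j)" "g - j" "z i" i] z(1,2) ig by simp
    from walk_add[OF this w2(1)] have "inv (z j) \<otimes> z i \<otimes> (inv (z i) \<otimes> z j) \<in> walk (g - j + i + 2)"
      using zz by simp
    moreover have "inv (z j) \<otimes> z i \<otimes> (inv (z i) \<otimes> z j) = \<one>"
      using ig by (metis inv_closed inv_inv inv_mult_group l_inv m_closed)
    ultimately have "\<one> \<in> walk (g - j + i + 2)" by simp
    then have e: "odd (g - j + i + 2) \<Longrightarrow> g \<le> g - j + i + 2" using least by blast
    show ?thesis
    proof (cases "odd (j - i)")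
      case True
      then have "g \<le> j - i + 2" by (rule o)
      moreover have "j - i < g" "j - i + 1 \<noteq> g" using ij ig True g(2) by presburger+
      ultimately show ?thesis using ij g(3) by linarith
    next
      case False
      have "g - j + i + 2 + (j - i) = g + 2" using ij ig by simp
      then have "odd (g - j + i + 2)" using False g(2) by presburger
      then have "g \<le> g - j + i + 2" by (rule e)
      then have "j - i \<le> 2" "j - i \<noteq> 1" using ij ig False by presburger+
      then show ?thesis using ij by linarith
    qed
  qed
  have two: "card (?N v) \<le> 2" if v: "v \<in> V" for v
  proof (rule ccontr)
    assume "\<not> card (?N v) \<le> 2"
    then have "3 \<le> card (?N v)" by linarith
    then obtain T where T: "T \<subseteq> ?N v" "card T = 3" by (rule obtain_subset_with_card_n)
    then obtain a b c where abc: "T = {a, b, c}" "a \<noteq> b" "a \<noteq> c" "b \<noteq> c" by (auto simp: card_3_iff)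
    have mem: "a \<in> ?N v" "b \<in> ?N v" "c \<in> ?N v" using T abc by auto
    \<comment> \<open>Three indices would be pairwise two apart on a cycle of length
      \<open>g\<close>, which an odd \<open>g\<close> of at least 5 does not allow.\<close>
    have tri: False if "i \<in> ?N v" "j \<in> ?N v" "l \<in> ?N v" "i < j" "j < l" for i j l
    proof -
      obtain h where h: "g = 2 * h + 1" using g(2) by (elim oddE)
      have d: "j = i + 2 \<or> j + 2 = i + g" "l = j + 2 \<or> l + 2 = j + g" "l = i + 2 \<or> l + 2 = i + g"
        using diff[OF v that(1,2,4)] diff[OF v that(2,3,5)] diff[OF v that(1,3)] that(4,5) by auto
      show False
        by (rule disjE[OF d(1)]; rule disjE[OF d(2)]; rule disjE[OF d(3)])
          (use that(4,5) h g(3) in presburger)+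
    qed
    have "a < b \<or> b < a" "a < c \<or> c < a" "b < c \<or> c < b" using abc(2-4) by linarith+
    then show False
      using tri[OF mem] tri[OF mem(1,3,2)] tri[OF mem(2,1,3)] tri[OF mem(2,3,1)]
        tri[OF mem(3,1,2)] tri[OF mem(3,2,1)] by blast
  qed
  have "(\<Sum>i\<in>{..<g}. card {v \<in> V. inv (z i) \<otimes> v \<in> C}) = (\<Sum>v\<in>V. card (?N v))"
    using fin by (intro card_swap) auto
  also have "\<dots> \<le> (\<Sum>v\<in>V. 2)" using two by (intro sum_mono) auto
  also have "(\<Sum>i\<in>{..<g}. card {v \<in> V. inv (z i) \<otimes> v \<in> C}) = (\<Sum>i\<in>{..<g}. card C)"
  proof (rule sum.cong[OF refl])
    fix i assume "i \<in> {..<g}"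
    then have zi: "z i \<in> V" using z(3) by simp
    have "{v \<in> V. inv (z i) \<otimes> v \<in> C} = (\<otimes>) (z i) ` C"
    proof
      show "{v \<in> V. inv (z i) \<otimes> v \<in> C} \<subseteq> (\<otimes>) (z i) ` C"
      proof
        fix v assume "v \<in> {v \<in> V. inv (z i) \<otimes> v \<in> C}"
        moreover then have "v = z i \<otimes> (inv (z i) \<otimes> v)" using zi by (simp add: m_assoc[symmetric])
        ultimately show "v \<in> (\<otimes>) (z i) ` C" by blast
      qed
    qed (use zi C_carrier in \<open>auto simp: m_assoc[symmetric]\<close>)
    then show "card {v \<in> V. inv (z i) \<otimes> v \<in> C} = card C"
      using card_translate[OF zi C_sub] by simp
  qed
  finally show ?thesis by simp
qed

end

section \<open>Barriers\<close>

text \<open>The configuration that Tutte's theorem yields for two independent edges \<open>u1 u2\<close> and \<open>v1 v2\<close>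
  that lie in no perfect matching. The parts \<open>P\<close> need not be connected.\<close>

locale cayley_barrier = cayley +
  fixes S :: "'a set" and P :: "'a set set" and u1 u2 v1 v2 :: 'a
  assumes S_sub: "S \<subseteq> V"
    and P_disj: "pairwise disjnt P"
    and P_cover: "\<Union>P = V - S"
    and P_odd: "\<And>A. A \<in> P \<Longrightarrow> odd (card A)"
    and P_sep: "\<And>A x c. \<lbrakk>A \<in> P; x \<in> A; c \<in> C\<rbrakk> \<Longrightarrow> x \<otimes> c \<in> A \<union> S"
    and P_card: "card P + 2 = card S"
    and degree: "5 \<le> card C"
    and uv_sub: "{u1, u2, v1, v2} \<subseteq> S"
    and uv_card: "card {u1, u2, v1, v2} = 4"
    and u_adj: "inv u1 \<otimes> u2 \<in> C"
    and v_adj: "inv v1 \<otimes> v2 \<in> C"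
    and odd_walk: "\<exists>n. odd n \<and> \<one> \<in> walk n"
begin

text \<open>By parity these parts have at least three vertices; their number is the p of the
  overview.\<close>

definition big :: "'a set set" where "big = {A \<in> P. card A \<noteq> 1}"

lemma finP: "finite P"
proof -
  have "P \<subseteq> Pow V" using P_cover by blast
  then show ?thesis using fin finite_subset by blast
qed

lemma finS: "finite S" using S_sub by (rule finX)

lemma P_sub: "A \<in> P \<Longrightarrow> A \<subseteq> V" "A \<in> P \<Longrightarrow> A \<inter> S = {}"
  using P_cover by blast+

lemma big_P: "A \<in> big \<Longrightarrow> A \<in> P" by (simp add: big_def)

lemma finbig: "finite big" using finP by (simp add: big_def)

lemma big_card: "A \<in> big \<Longrightarrow> 3 \<le> card A"
proof -
  assume "A \<in> big"
  then have "odd (card A)" "card A \<noteq> 1" using P_odd by (auto simp: big_def)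
  then show ?thesis by presburger
qed

lemma cut_part:
  assumes "A \<in> P" "c \<in> C"
  shows "cut {c} A = card {x \<in> A. x \<otimes> c \<in> S}"
proof -
  have "{x \<in> A. x \<otimes> c \<notin> A} = {x \<in> A. x \<otimes> c \<in> S}"
    using P_sep[OF assms(1) _ assms(2)] P_sub(2)[OF assms(1)] by blast
  then show ?thesis by (simp add: cut_def)
qed

lemma singleton_part: "A \<in> P - big \<Longrightarrow> \<exists>y. A = {y}"
  by (auto simp: big_def card_1_singleton_iff)

text \<open>Sort the |S| vertices that \<open>c\<close> sends into \<open>S\<close> by origin:
  \<open>S\<close> itself, a non-singleton part, which contributes its exits, or a singleton part,
  which contributes one because \<open>c\<close> moves its only vertex. Then insert |S| = |P| +
  2.\<close>

lemma generator_equation: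
  assumes c: "c \<in> C"
  shows "inn {c} S + (\<Sum>A\<in>big. cut {c} A) = card big + 2"
proof -
  have cV: "c \<in> V" using c C_carrier by blast
  have "card {x \<in> V - S. x \<otimes> c \<in> S} = card (\<Union>A\<in>P. {x \<in> A. x \<otimes> c \<in> S})"
    using P_cover by (intro arg_cong[where f = card]) blast
  also have "\<dots> = (\<Sum>A\<in>P. card {x \<in> A. x \<otimes> c \<in> S})"
  proof (rule card_UN_disjoint[OF finP])
    show "\<forall>A\<in>P. finite {x \<in> A. x \<otimes> c \<in> S}" using P_sub(1) finX by auto
    show "\<forall>A\<in>P. \<forall>B\<in>P. A \<noteq> B \<longrightarrow> {x \<in> A. x \<otimes> c \<in> S} \<inter> {x \<in> B. x \<otimes> c \<in> S} = {}"
      using P_disj unfolding pairwise_def disjnt_def by blast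
  qed
  also have "\<dots> = (\<Sum>A\<in>P. cut {c} A)" using cut_part[OF _ c] by (intro sum.cong) auto
  also have "\<dots> = (\<Sum>A\<in>P - big. cut {c} A) + (\<Sum>A\<in>big. cut {c} A)"
    using big_P by (intro sum.subset_diff finP) auto
  also have "(\<Sum>A\<in>P - big. cut {c} A) = (\<Sum>A\<in>P - big. 1)"
  proof (rule sum.cong[OF refl])
    fix A assume A: "A \<in> P - big"
    then obtain y where y: "A = {y}" using singleton_part by blast
    then have "y \<in> V" using A P_sub(1) by blast
    then have "y \<otimes> c \<noteq> y" using c cV C_one by (metis l_cancel_one)
    then show "cut {c} A = 1" by (simp add: y cut_def Collect_conv_if)
  qed
  also have "\<dots> = card P - card big" using big_P finP by (simp add: card_Diff_subset[OF finbig] subsetI)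
  finally have 1: "card {x \<in> V - S. x \<otimes> c \<in> S} = card P - card big + (\<Sum>A\<in>big. cut {c} A)" .
  have "card S = card {x \<in> V. x \<otimes> c \<in> S}" using S_sub cV by (simp add: card_preimage)
  also have "\<dots> = card {x \<in> S. x \<otimes> c \<in> S} + card {x \<in> V - S. x \<otimes> c \<in> S}"
    using S_sub finS fin by (subst card_Un_disjoint[symmetric]) (auto intro!: arg_cong[where f = card])
  finally have "card S = inn {c} S + (card P - card big + (\<Sum>A\<in>big. cut {c} A))"
    using 1 by (simp add: inn_def)
  moreover have "card big \<le> card P" using big_P by (intro card_mono finP) blast
  ultimately show ?thesis using P_card by linarith
qed

lemma cut_sum_gen: "cut C X = (\<Sum>c\<in>C. cut {c} X)" and inn_sum_gen: "inn C X = (\<Sum>c\<in>C. inn {c} X)"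
  by (simp_all add: cut_def inn_def)

lemma degree_equation: "inn C S + (\<Sum>A\<in>big. cut C A) = card C * (card big + 2)"
proof -
  have "inn C S + (\<Sum>A\<in>big. cut C A) = (\<Sum>c\<in>C. inn {c} S) + (\<Sum>A\<in>big. \<Sum>c\<in>C. cut {c} A)"
    unfolding inn_sum_gen[of S] by (subst cut_sum_gen) simp
  also have "\<dots> = (\<Sum>c\<in>C. inn {c} S + (\<Sum>A\<in>big. cut {c} A))"
    by (subst sum.swap) (simp add: sum.distrib)
  also have "\<dots> = (\<Sum>c\<in>C. card big + 2)" using generator_equation by (intro sum.cong) auto
  finally show ?thesis by simp
qed

lemma uv_degree: "x \<in> {u1, u2, v1, v2} \<Longrightarrow> 1 \<le> card {c \<in> C. x \<otimes> c \<in> S}"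
proof -
  have arc: "1 \<le> card {c \<in> C. x \<otimes> c \<in> S} \<and> 1 \<le> card {c \<in> C. y \<otimes> c \<in> S}"
    if "x \<in> S" "y \<in> S" "inv x \<otimes> y \<in> C" for x y
  proof -
    have xy: "x \<in> V" "y \<in> V" using that S_sub by auto
    have "x \<otimes> (inv x \<otimes> y) = y" using xy by (simp add: m_assoc[symmetric])
    then have "inv x \<otimes> y \<in> {c \<in> C. x \<otimes> c \<in> S}" using that by simp
    moreover have "y \<otimes> inv (inv x \<otimes> y) = x" using xy by (simp add: inv_mult_group m_assoc[symmetric])
    then have "inv (inv x \<otimes> y) \<in> {c \<in> C. y \<otimes> c \<in> S}" using that C_inv by simp
    ultimately have "{c \<in> C. x \<otimes> c \<in> S} \<noteq> {}" "{c \<in> C. y \<otimes> c \<in> S} \<noteq> {}" by blast+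
    then show ?thesis using finC by (simp add: Suc_le_eq card_gt_0_iff)
  qed
  assume "x \<in> {u1, u2, v1, v2}"
  then show ?thesis using arc[of u1 u2] arc[of v1 v2] uv_sub u_adj v_adj by auto
qed

text \<open>Each end of the two given edges has a neighbour in \<open>S\<close>, which accounts for
  four arcs. A vertex of \<open>S\<close> with two neighbours in \<open>S\<close> would raise the
  count to at least five.\<close>

lemma inn_S_ge: "4 \<le> inn C S"
  and inn_S_eq: "inn C S = 4 \<Longrightarrow> x \<in> S \<Longrightarrow> card {c \<in> C. x \<otimes> c \<in> S} \<le> 1"
proof -
  let ?Q = "{u1, u2, v1, v2}" and ?f = "\<lambda>x. card {c \<in> C. x \<otimes> c \<in> S}"
  have Q: "card B \<le> sum ?f B" if "B \<subseteq> ?Q" for B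
  proof -
    have "(\<Sum>x\<in>B. 1) \<le> sum ?f B" using that uv_degree by (intro sum_mono) blast
    then show ?thesis by simp
  qed
  have sw: "inn C S = sum ?f S" by (rule inn_swap[OF finC finS])
  have "sum ?f ?Q \<le> sum ?f S" using uv_sub finS by (intro sum_mono2) auto
  then show "4 \<le> inn C S" using Q[OF subset_refl] unfolding uv_card sw by (rule order_trans[rotated])
  assume eq: "inn C S = 4" and x: "x \<in> S"
  show "?f x \<le> 1"
  proof (rule ccontr)
    assume "\<not> ?f x \<le> 1"
    have "sum ?f (insert x (?Q - {x})) \<le> sum ?f S" using uv_sub finS x by (intro sum_mono2) auto
    moreover have "sum ?f (insert x (?Q - {x})) = ?f x + sum ?f (?Q - {x})"
      by (subst sum.insert) auto
    moreover have "3 \<le> card (?Q - {x})" using uv_card card_Diff1_le[of ?Q x] by (simp add: card_Diff_singleton_if)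
    ultimately show False using Q[of "?Q - {x}"] eq sw \<open>\<not> ?f x \<le> 1\<close> by fastforce
  qed
qed

text \<open>The vertices that an involution keeps inside a part are paired up, so an odd part has an
  exit. The exits of all p parts add up to at most p + 2, so no part has more than three.\<close>

lemma involution_cut:
  assumes c: "c \<in> C" "inv c = c" and A: "A \<in> big"
  shows "1 \<le> cut {c} A" and "cut {c} A \<le> 3"
proof -
  have pos: "1 \<le> cut {c} B" if B: "B \<in> big" for B
  proof -
    have BV: "B \<subseteq> V" using B big_P P_sub by blast
    have "even (inn {c} B)" using c C_one C_carrier BV by (intro inn_even) auto
    moreover have "cut {c} B + inn {c} B = card B" using cut_plus_inn[OF finX[OF BV], of "{c}"] by simp
    moreover have "odd (card B)" using B big_P P_odd by blast
    ultimately show ?thesis by presburger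
  qed
  show "1 \<le> cut {c} A" using pos[OF A] .
  have "card (big - {A}) \<le> (\<Sum>B\<in>big - {A}. cut {c} B)"
    using pos sum_mono[of "big - {A}" "\<lambda>_. 1" "\<lambda>B. cut {c} B"] by simp
  moreover have "card (big - {A}) + 1 = card big" using card_Suc_Diff1[OF finbig A] by simp
  moreover have "(\<Sum>B\<in>big. cut {c} B) = cut {c} A + (\<Sum>B\<in>big - {A}. cut {c} B)"
    using finbig A by (rule sum.remove)
  ultimately show "cut {c} A \<le> 3" using generator_equation[OF c(1)] by linarith
qed

text \<open>The inverse of the only outgoing generator is outgoing too, so it is an involution. A
  proper union of cosets is eligible because it and its complement contain a coset; only
  \<open>c\<close> leaves it, so minimality of \<open>K\<close> gives the last bound.\<close>

lemma subgroup_one_exit: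
  assumes K: "subgroup K G" and C: "card (C - K) = 1"
    and el: "eligible m K" and low: "\<And>Y. eligible m Y \<Longrightarrow> cut C K \<le> cut C Y"
  obtains c where "C - K = {c}" "c \<in> C" "inv c = c"
    "\<And>U. \<lbrakk>rinv K U; U \<noteq> {}; U \<noteq> V\<rbrakk> \<Longrightarrow> card K \<le> cut {c} U"
proof -
  obtain c where c: "C - K = {c}" using C by (metis card_1_singletonE)
  then have cC: "c \<in> C" "c \<notin> K" by auto
  have "inv c \<notin> K"
  proof
    assume "inv c \<in> K"
    then have "inv (inv c) \<in> K" using K by (rule subgroup.m_inv_closed[rotated])
    then show False using cC C_carrier by simp
  qed
  then have "inv c = c" using c C_inv[OF cC(1)] by blast
  moreover have "card K \<le> cut {c} U" if U: "rinv K U" "U \<noteq> {}" "U \<noteq> V" for U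
  proof -
    have UV: "U \<subseteq> V" using U by (simp add: rinv_def)
    have "card K \<le> card U" by (rule rinv_card[OF K U(1,2)])
    moreover have "card K \<le> card (V - U)"
      using UV U(3) by (intro rinv_card[OF K rinv_compl[OF K U(1)]]) auto
    ultimately have "eligible m U" using el UV by (auto simp: eligible_def)
    then have "cut C K \<le> cut C U" by (rule low)
    moreover have "cut C K = card K" using cut_subgroup[OF K C_sub] C by simp
    ultimately show ?thesis using cut_one_exit[OF c, of U] cut_rinv[OF U(1), of "C \<inter> K"] by simp
  qed
  ultimately show ?thesis using that c cC by blast
qed

text \<open>Here \<open>C \<inter> K\<close> is \<open>K\<close> without the identity, so cosets are
  cliques, and a vertex of the sparse error N has at least |K|/2 neighbours in its coset outside N.
  The resulting cost |N| |K| / 2 is incompatible with |N| \<ge> |K| when \<open>U\<close> is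
  trivial, and with a gain of at most 2 |N| exits when it is not, since |K| \<ge> 5.\<close>

lemma clique_atom_rinv:
  assumes K: "subgroup K G" and sz: "card K + 1 = card C" "card (C - K) = 2" "5 \<le> card K"
    and low: "\<And>Y. eligible 3 Y \<Longrightarrow> 2 * card K \<le> cut C Y"
    and small: "\<And>Y. eligible 3 Y \<Longrightarrow> cut C Y = 2 * card K \<Longrightarrow> card K \<le> card Y"
    and X: "eligible 3 X" "cut C X = 2 * card K"
  shows "rinv K X"
proof -
  interpret K: subgroup K G by fact
  let ?E = "C \<inter> K" and ?F = "C - K"
  have XV: "X \<subseteq> V" using X(1) by (simp add: eligible_def)
  obtain U N where U: "rinv K U" and N: "N = (U - X) \<union> (X - U)" "N \<subseteq> V"
    and sparse: "\<And>x. x \<in> V \<Longrightarrow> 2 * card (N \<inter> blk K x) \<le> card K"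
    and cN: "\<And>E. E \<subseteq> K \<Longrightarrow> cut E N = cut E X"
    using majority[OF K XV] by blast
  have UV: "U \<subseteq> V" using U by (simp add: rinv_def)
  have cE: "card ?E + 1 = card K" using card_generators_subgroup[OF K] sz by linarith
  have "card K \<le> 2 * card {b \<in> ?E. x \<otimes> b \<notin> N}" if x: "x \<in> N" for x
  proof -
    have xV: "x \<in> V" using x N(2) by blast
    have "inj_on ((\<otimes>) x) {b \<in> ?E. x \<otimes> b \<in> N}" using xV C_sub by (intro translate_inj) auto
    moreover have "(\<otimes>) x ` {b \<in> ?E. x \<otimes> b \<in> N} \<subseteq> N \<inter> blk K x - {x}"
    proof
      fix y assume "y \<in> (\<otimes>) x ` {b \<in> ?E. x \<otimes> b \<in> N}"
      then obtain b where b: "b \<in> C" "b \<in> K" "y = x \<otimes> b" "y \<in> N" by blast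
      have "y \<noteq> x" using b xV C_one C_carrier by (metis l_cancel_one)
      moreover have "y \<in> blk K x"
        using b blk_mult[OF K xV blk_self[OF K xV] C_carrier[OF b(1)]] by simp
      ultimately show "y \<in> N \<inter> blk K x - {x}" using b by blast
    qed
    ultimately have "card {b \<in> ?E. x \<otimes> b \<in> N} \<le> card (N \<inter> blk K x - {x})"
      using finX[OF N(2)] by (intro card_inj_on_le[of "(\<otimes>) x"]) auto
    moreover have "card (N \<inter> blk K x - {x}) + 1 = card (N \<inter> blk K x)"
      using card_Suc_Diff1[of "N \<inter> blk K x" x] finX[OF N(2)] x blk_self[OF K xV] by simp
    moreover have "card {b \<in> ?E. x \<otimes> b \<notin> N} + card {b \<in> ?E. x \<otimes> b \<in> N} = card ?E"
      using finC by (intro card_split) auto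
    ultimately show ?thesis using cE sparse[OF xV] by linarith
  qed
  then have "(\<Sum>x\<in>N. card K) \<le> (\<Sum>x\<in>N. 2 * card {b \<in> ?E. x \<otimes> b \<notin> N})" by (rule sum_mono)
  also have "\<dots> = 2 * cut ?E N"
    using finC finX[OF N(2)] by (subst cut_swap) (auto simp: sum_distrib_left)
  finally have cost: "card N * card K \<le> 2 * cut ?E N" by simp
  have tot: "cut ?E N + cut ?F X = 2 * card K"
    using cut_Int_Diff[OF finC, of X K] X(2) cN[of ?E] by simp
  have "N = {}"
  proof (rule ccontr)
    assume "N \<noteq> {}"
    then have N0: "0 < card N" using finX[OF N(2)] by (simp add: card_gt_0_iff)
    show False
    proof (cases "U = {} \<or> U = V")
      case True
      then have "N = X \<or> N = V - X" using N XV by auto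
      moreover have "card K \<le> card X" using small X by blast
      moreover have "card K \<le> card (V - X)"
        using small[OF eligible_compl[OF X(1)]] X(2) cut_compl[OF XV C_sub] by simp
      ultimately have "card K \<le> card N" by auto
      then have "card K * card K \<le> card N * card K" by simp
      also have "\<dots> \<le> 4 * card K" using cost tot by linarith
      finally show False using sz(3) by simp
    next
      case False
      have "card K \<le> card U" using False by (intro rinv_card[OF K U]) auto
      moreover have "card K \<le> card (V - U)"
        using UV False by (intro rinv_card[OF K rinv_compl[OF K U]]) auto
      ultimately have "eligible 3 U" using sz(3) UV by (auto simp: eligible_def)
      then have "2 * card K \<le> cut C U" by (rule low)
      also have "cut C U = cut ?F U" using cut_Int_Diff[OF finC, of U K] cut_rinv[OF U, of ?E] by simp
      also have "\<dots> \<le> cut ?F X + 2 * card N"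
        using cut_change[OF XV UV, of ?F] C_sub sz(2) N(1) by auto
      finally have "card N * card K \<le> 4 * card N" using tot cost by linarith
      then show False using N0 sz(3) by simp
    qed
  qed
  then have "U = X" using N by auto
  then show ?thesis using U by simp
qed

lemma at_most_one_big: "card big \<le> 1"
proof (rule ccontr)
  assume "\<not> card big \<le> 1"
  then have p: "2 \<le> card big" by simp
  have el: "eligible 3 A" if A: "A \<in> big" for A
  proof -
    obtain B where B: "B \<in> big" "B \<noteq> A"
      using p A by (metis card_1_singleton_iff card.empty is_singletonI' is_singleton_altdef
        not_less_eq_eq numeral_2_eq_2 One_nat_def le_refl empty_iff)
    have "disjnt A B" using pairwiseD[OF P_disj, of A B] A B big_P by blast
    then have "B \<subseteq> V - A" using P_sub(1)[OF big_P[OF B(1)]] by (auto simp: disjnt_def)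
    then have "card B \<le> card (V - A)" using fin by (intro card_mono) auto
    then show ?thesis using big_card A B(1) P_sub(1)[OF big_P[OF A]] by (force simp: eligible_def)
  qed
  obtain k where k: "card C = k + 5" using degree by (metis le_Suc_ex add.commute)
  obtain q where q: "card big = q + 2" using p by (metis le_Suc_ex add.commute)
  have bound: "card big * m + inn C S \<le> card C * (card big + 2)" if "\<And>A. A \<in> big \<Longrightarrow> m \<le> cut C A" for m
  proof -
    have "(\<Sum>A\<in>big. m) \<le> (\<Sum>A\<in>big. cut C A)" using that by (rule sum_mono)
    then show ?thesis using degree_equation by simp
  qed
  \<comment> \<open>Boundaries of at least 2 |C| - 1, together with the four arcs in
    \<open>S\<close>, would exceed |C|(p + 2) for p \<ge> 2.\<close>
  have "\<exists>A\<in>big. cut C A \<le> 2 * card C - 2"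
  proof (rule ccontr)
    assume "\<not> ?thesis"
    then have "card big * (2 * card C - 1) + inn C S \<le> card C * (card big + 2)" by (intro bound) force
    then show False using inn_S_ge unfolding k q by (simp add: algebra_simps)
  qed
  then obtain X where X: "X \<in> big" "cut C X \<le> 2 * card C - 2" by blast
  have XV: "X \<subseteq> V" using X P_sub big_P by blast
  \<comment> \<open>For degree 5 a 4-clique would meet the bound 2 |C| - 2 = 8; the boundary of an
    odd part is odd, which lowers the bound to 7.\<close>
  have X7: "cut C X \<le> 7" if "card C = 5"
  proof -
    have "even (inn C X)" using XV C_sub C_one C_inv by (intro inn_even)
    moreover have "cut C X + inn C X = 5 * card X" using cut_plus_inn[OF finX[OF XV], of C] that by simp
    moreover have "odd (card X)" using X big_P P_odd by blast
    ultimately have "odd (cut C X)" by presburger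
    then show ?thesis using X(2) that by presburger
  qed
  have large: "5 \<le> card Y" if Y: "eligible 3 Y" "cut C Y \<le> cut C X" for Y
  proof (rule ccontr)
    assume "\<not> 5 \<le> card Y"
    then have Y34: "card Y = 3 \<or> card Y = 4" using Y(1) by (auto simp: eligible_def)
    have deg: "card Y * (card C + 1 - card Y) \<le> cut C X"
      using cut_ge_degree[of Y C] Y C_sub C_one by (auto simp: eligible_def)
    show False
    proof (cases "k = 0")
      case True
      then have "cut C X \<le> 7" using X7 k by simp
      then show False using Y34 deg k True by auto
    next
      case False
      then show False using Y34 deg X(2) k by auto
    qed
  qed
  obtain K where K: "subgroup K G" "eligible 3 K" "cut C K \<le> cut C X"
    and low: "\<And>Y. eligible 3 Y \<Longrightarrow> cut C K \<le> cut C Y"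
    and small: "\<And>Y. eligible 3 Y \<Longrightarrow> cut C Y = cut C K \<Longrightarrow> card K \<le> card Y"
    by (rule atom_subgroup[OF el[OF X(1)]]) (use large in auto)
  have K5: "5 \<le> card K" using large K by blast
  define u where "u = card (C - K)"
  have cK: "cut C K = card K * u" using cut_subgroup[OF K(1) C_sub] by (simp add: u_def)
  have gens: "card (C \<inter> K) + 1 \<le> card K" "card (C \<inter> K) + u = card C"
    using card_generators_subgroup[OF K(1)] by (auto simp: u_def)
  have "K \<noteq> V" using K(2) by (auto simp: eligible_def)
  then have u1: "1 \<le> u"
    using subgroup_generators[OF K(1)] finC by (auto simp: u_def Suc_le_eq card_gt_0_iff)
  have ub: "card K * u + 2 \<le> 2 * card C" using cK K(3) X(2) degree by linarith
  \<comment> \<open>With |K| \<ge> 5 and |C| \<le> |K| - 1 + u, three outgoing generators already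
    make |K| u exceed 2 |C| - 2.\<close>
  have "u \<le> 2"
  proof (rule ccontr)
    assume "\<not> u \<le> 2"
    then obtain t where t: "u = t + 3" by (metis not_less_eq_eq numeral_2_eq_2 numeral_3_eq_3 le_Suc_ex add.commute)
    obtain r where r: "card K = r + 5" using K5 by (metis le_Suc_ex add.commute)
    have "2 * card C + 2 \<le> 2 * (card K + u)" using gens(1) unfolding gens(2)[symmetric] by simp
    then have "card K * u + 4 \<le> 2 * (card K + u)" using ub by linarith
    then show False unfolding t r by (simp add: algebra_simps)
  qed
  then consider "u = 1" | "u = 2" using u1 by linarith
  then show False
  proof cases
    case 1
    obtain c where c: "C - K = {c}" "c \<in> C" "inv c = c"
      and exits: "\<And>U. \<lbrakk>rinv K U; U \<noteq> {}; U \<noteq> V\<rbrakk> \<Longrightarrow> card K \<le> cut {c} U"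
      using subgroup_one_exit[OF K(1) _ K(2) low] 1 u_def by auto
    show False
      by (rule one_exit_dense[OF K(1) c(1) _ _ K5 exits el[OF X(1)] involution_cut[OF c(2,3) X(1)]])
        (use 1 ub gens degree X(2) in auto)
  next
    case 2
    have "card K * 2 + 2 \<le> 2 * card C" "card (C \<inter> K) + 2 = card C" using ub gens(2) 2 by simp_all
    then have kK: "card K + 1 = card C" using gens(1) by linarith
    have low2: "2 * card K \<le> cut C Y" if "eligible 3 Y" for Y using low[OF that] cK 2 by simp
    have "card big * (2 * card K) + inn C S \<le> card C * (card big + 2)" by (intro bound low2 el)
    \<comment> \<open>The degree equation becomes tight: there are exactly two non-singleton parts,
      each with boundary 2 |K|, and \<open>S\<close> contains only four arcs.\<close>
    then have "q * (card K - 1) + inn C S \<le> 4"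
      using K5 unfolding kK[symmetric] q by (simp add: algebra_simps diff_mult_distrib2)
    moreover have "q \<le> q * (card K - 1)" "q = 0 \<or> card K - 1 \<le> q * (card K - 1)" using K5 by auto
    ultimately have q0: "q = 0" and a4: "inn C S = 4" using inn_S_ge K5 by linarith+
    have sum4: "(\<Sum>A\<in>big. cut C A) = 2 * (2 * card K)"
      using degree_equation a4 q q0 kK by simp
    have eq: "cut C A = 2 * card K" if A: "A \<in> big" for A
    proof -
      have "card (big - {A}) = 1" using card_Suc_Diff1[OF finbig A] q q0 by simp
      moreover have "(\<Sum>B\<in>big - {A}. 2 * card K) \<le> (\<Sum>B\<in>big - {A}. cut C B)"
        by (intro sum_mono low2 el) simp
      moreover have "(\<Sum>B\<in>big. cut C B) = cut C A + (\<Sum>B\<in>big - {A}. cut C B)"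
        using finbig A by (rule sum.remove)
      ultimately have "cut C A \<le> 2 * card K" using sum4 by simp
      then show ?thesis using low2[OF el[OF A]] by simp
    qed
    have rin: "rinv K A" if A: "A \<in> big" for A
      by (rule clique_atom_rinv[OF K(1) kK _ K5 low2 _ el[OF A] eq[OF A]])
        (use small cK 2 u_def in auto)
    \<comment> \<open>Since these parts are unions of cosets, a generator in \<open>K\<close> has no
      exits from them, so each such generator alone needs four arcs inside \<open>S\<close>.\<close>
    have "inn {b} S = 4" if b: "b \<in> C \<inter> K" for b
    proof -
      have "(\<Sum>A\<in>big. cut {b} A) = 0" using cut_rinv[OF rin] b by (intro sum.neutral) auto
      then show ?thesis using generator_equation[of b] b q q0 by simp
    qed
    then have "inn (C \<inter> K) S = 4 * card (C \<inter> K)" by (simp add: inn_def)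
    moreover have "inn (C \<inter> K) S \<le> inn C S" using finC by (intro inn_mono) auto
    ultimately show False using a4 gens 2 kK K5 by linarith
  qed
qed

end

section \<open>Right stabilisers and Mantel's theorem\<close>

context cayley
begin

lemma rinv_dvd:
  assumes K: "subgroup K G" and U: "rinv K U"
  shows "card K dvd card U"
proof -
  have UV: "U \<subseteq> V" using U by (simp add: rinv_def)
  have eq: "\<Union>(blk K ` U) = U"
    using blk_rinv_sub[OF K U] blk_self[OF K] UV by blast
  have "card K dvd card (\<Union>(blk K ` U))"
  proof (rule dvd_partition)
    show "finite (\<Union>(blk K ` U))" using eq finX[OF UV] by simp
    show "\<forall>c\<in>blk K ` U. card K dvd card c" using card_blk[OF K] UV by auto
    show "\<forall>c1\<in>blk K ` U. \<forall>c2\<in>blk K ` U. c1 \<noteq> c2 \<longrightarrow> c1 \<inter> c2 = {}"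
    proof (intro ballI impI)
      fix c1 c2 assume c: "c1 \<in> blk K ` U" "c2 \<in> blk K ` U" "c1 \<noteq> c2"
      then obtain x y where xy: "x \<in> V" "y \<in> V" "c1 = blk K x" "c2 = blk K y" using UV by blast
      show "c1 \<inter> c2 = {}"
      proof (rule ccontr)
        assume "c1 \<inter> c2 \<noteq> {}"
        then obtain z where "z \<in> blk K x" "z \<in> blk K y" using xy by blast
        then have "blk K x = blk K y" using blk_eq[OF K] xy by metis
        then show False using c xy by simp
      qed
    qed
  qed
  then show ?thesis using eq by simp
qed

text \<open>The right stabiliser; one inclusion suffices for finite \<open>X\<close>. A subset of
  \<open>V\<close> is a union of left cosets of its stabiliser.\<close>

definition stab :: "'a set \<Rightarrow> 'a set" where
  "stab X = {g \<in> V. \<forall>x\<in>X. x \<otimes> g \<in> X}"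

lemma stab_rinv: "X \<subseteq> V \<Longrightarrow> rinv (stab X) X"
  by (auto simp: stab_def rinv_def)

lemma stab_subgroup:
  assumes X: "X \<subseteq> V"
  shows "subgroup (stab X) G"
proof
  show "stab X \<subseteq> V" by (auto simp: stab_def)
  show "\<one> \<in> stab X" using X by (auto simp: stab_def)
  show "g \<otimes> h \<in> stab X" if "g \<in> stab X" "h \<in> stab X" for g h
  proof -
    have gh: "g \<in> V" "h \<in> V" using that by (auto simp: stab_def)
    have "x \<otimes> (g \<otimes> h) \<in> X" if x: "x \<in> X" for x
    proof -
      have "x \<otimes> (g \<otimes> h) = (x \<otimes> g) \<otimes> h" using x X gh by (simp add: m_assoc subset_iff)
      then show ?thesis using x \<open>g \<in> stab X\<close> \<open>h \<in> stab X\<close> by (simp add: stab_def)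
    qed
    then show ?thesis using gh by (simp add: stab_def)
  qed
  show "inv g \<in> stab X" if g: "g \<in> stab X" for g
  proof -
    have gV: "g \<in> V" and gX: "\<And>x. x \<in> X \<Longrightarrow> x \<otimes> g \<in> X" using g by (auto simp: stab_def)
    have "(\<lambda>x. x \<otimes> g) ` X = X"
      using gX finX[OF X] inj_on_subset[OF mult_r_inj[OF gV] X] by (intro endo_inj_surj) auto
    then have "x \<otimes> inv g \<in> X" if x: "x \<in> X" for x
    proof -
      obtain y where "y \<in> X" "x = y \<otimes> g" using \<open>(\<lambda>x. x \<otimes> g) ` X = X\<close> x by blast
      then show ?thesis using gV X by (auto simp: m_assoc subset_iff)
    qed
    then show ?thesis using gV by (simp add: stab_def)
  qed
qed

lemma card_arcs_sym:
  assumes "X \<subseteq> V" "Y \<subseteq> V"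
  shows "(\<Sum>c\<in>C. card {x \<in> X. x \<otimes> c \<in> Y}) = (\<Sum>c\<in>C. card {y \<in> Y. y \<otimes> c \<in> X})"
proof (rule sum.reindex_bij_witness[of _ "\<lambda>c. inv c" "\<lambda>c. inv c"])
  fix c assume c: "c \<in> C"
  then have cV: "c \<in> V" by (rule C_carrier)
  have "bij_betw (\<lambda>x. x \<otimes> c) {x \<in> X. x \<otimes> c \<in> Y} {y \<in> Y. y \<otimes> inv c \<in> X}"
    by (rule bij_betw_byWitness[where f' = "\<lambda>y. y \<otimes> inv c"])
      (use assms cV in \<open>auto simp: m_assoc subset_iff\<close>)
  then show "card {y \<in> Y. y \<otimes> inv c \<in> X} = card {x \<in> X. x \<otimes> c \<in> Y}"
    by (rule bij_betw_same_card[symmetric])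
qed (use C_inv C_carrier in auto)

lemma inn_mono_set: "X \<subseteq> Y \<Longrightarrow> finite Y \<Longrightarrow> inn E X \<le> inn E Y"
  unfolding inn_def by (intro sum_mono card_mono) auto

text \<open>Each edge from \<open>q\<close> to a neighbour in \<open>W\<close> contributes one arc
  at \<open>q\<close> and one at the other end.\<close>

lemma inn_ge_twice_degree:
  assumes "W \<subseteq> V" "q \<in> W"
  shows "2 * card {c \<in> C. q \<otimes> c \<in> W} \<le> inn C W"
proof -
  let ?f = "\<lambda>x. card {c \<in> C. x \<otimes> c \<in> W}"
  let ?B = "(\<otimes>) q ` {c \<in> C. q \<otimes> c \<in> W}"
  have qV: "q \<in> V" using assms by blast
  have fW: "finite W" using finX[OF assms(1)] .
  have B: "card ?B = ?f q" using qV C_sub by (intro card_translate) auto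
  have BW: "?B \<subseteq> W" by blast
  have qB: "q \<notin> ?B"
  proof
    assume "q \<in> ?B"
    then obtain c where "c \<in> C" "q = q \<otimes> c" by blast
    then show False using qV C_carrier C_one by (metis l_cancel_one)
  qed
  have "1 \<le> ?f y" if y: "y \<in> ?B" for y
  proof -
    obtain c where c: "c \<in> C" "y = q \<otimes> c" using y by blast
    then have "y \<otimes> inv c = q" using qV C_carrier by (simp add: m_assoc)
    then have "inv c \<in> {c \<in> C. y \<otimes> c \<in> W}" using c C_inv assms by simp
    then have "{c \<in> C. y \<otimes> c \<in> W} \<noteq> {}" by blast
    then show ?thesis using finC by (simp add: Suc_le_eq card_gt_0_iff)
  qed
  then have "(\<Sum>y\<in>?B. 1) \<le> sum ?f ?B" by (rule sum_mono)
  then have "?f q + card ?B \<le> sum ?f (insert q ?B)"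
    using qB finite_subset[OF BW fW] by simp
  also have "\<dots> \<le> sum ?f W" using BW assms fW by (intro sum_mono2) auto
  also have "\<dots> = inn C W" by (rule inn_swap[OF finC fW, symmetric])
  finally show ?thesis using B by simp
qed

text \<open>Mantel's theorem, through the independent neighbourhood of a vertex of maximum degree.\<close>

lemma mantel:
  assumes X: "X \<subseteq> V" and tf: "\<And>a b. \<lbrakk>a \<in> C; b \<in> C\<rbrakk> \<Longrightarrow> a \<otimes> b \<notin> C"
  shows "2 * inn C X \<le> card X * card X"
proof (cases "X = {}")
  case False
  let ?f = "\<lambda>x. card {c \<in> C. x \<otimes> c \<in> X}"
  have fX: "finite X" using finX[OF X] .
  have "Max (?f ` X) \<in> ?f ` X" using fX False by (intro Max_in) auto
  then obtain v where v: "v \<in> X" "?f v = Max (?f ` X)" by auto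
  have vmax: "?f x \<le> ?f v" if "x \<in> X" for x
    unfolding v(2) using that fX by (intro Max_ge) auto
  have vV: "v \<in> V" using v X by blast
  define N where "N = (\<otimes>) v ` {c \<in> C. v \<otimes> c \<in> X}"
  have N: "N \<subseteq> X" "card N = ?f v"
    unfolding N_def using vV C_sub by (auto intro!: card_translate)
  have indep: "y \<otimes> c \<notin> N" if y: "y \<in> N" and c: "c \<in> C" for y c
  proof
    assume "y \<otimes> c \<in> N"
    then obtain b where b: "b \<in> C" "y \<otimes> c = v \<otimes> b" by (auto simp: N_def)
    obtain a where a: "a \<in> C" "y = v \<otimes> a" using y by (auto simp: N_def)
    have "v \<otimes> (a \<otimes> c) = v \<otimes> b" using a b(2) vV C_carrier c by (simp add: m_assoc)
    then have "a \<otimes> c = b" using vV C_carrier a(1) b(1) c by simp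
    then show False using tf[OF a(1) c] b(1) by simp
  qed
  have NV: "N \<subseteq> V" "X - N \<subseteq> V" using N X by auto
  have "sum ?f N = (\<Sum>x\<in>N. card {c \<in> C. x \<otimes> c \<in> X - N})"
    using indep by (intro sum.cong refl arg_cong[where f = card]) auto
  also have "\<dots> = (\<Sum>c\<in>C. card {x \<in> N. x \<otimes> c \<in> X - N})"
    using finC finX[OF NV(1)] by (rule card_swap[symmetric])
  also have "\<dots> = (\<Sum>c\<in>C. card {x \<in> X - N. x \<otimes> c \<in> N})" using NV by (rule card_arcs_sym)
  also have "\<dots> = (\<Sum>x\<in>X - N. card {c \<in> C. x \<otimes> c \<in> N})"
    using finC finX[OF NV(2)] by (rule card_swap)
  also have "\<dots> \<le> sum ?f (X - N)" using finC N by (intro sum_mono card_mono) auto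
  finally have half: "sum ?f N \<le> sum ?f (X - N)" .
  have "inn C X = sum ?f (X - N) + sum ?f N"
    using inn_swap[OF finC fX] sum.subset_diff[OF N(1) fX, of ?f] by simp
  then have "inn C X \<le> 2 * sum ?f (X - N)" using half by simp
  also have "sum ?f (X - N) \<le> (\<Sum>x\<in>X - N. card N)" using vmax N(2) by (intro sum_mono) auto
  also have "\<dots> = (card X - card N) * card N" using N(1) finX[OF NV(1)] by (simp add: card_Diff_subset)
  finally have 1: "2 * inn C X \<le> 4 * ((card X - card N) * card N)" by linarith
  obtain r where r: "card X = card N + r" using card_mono[OF fX N(1)] by (metis le_Suc_ex)
  have "4 * (r * n) \<le> (n + r) * (n + r)" for n r :: nat
  proof -
    have "4 * (int r * int n) \<le> (int n + int r) * (int n + int r)"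
      using zero_le_square[of "int n - int r"] by (simp add: algebra_simps)
    then show ?thesis by (metis of_nat_add of_nat_le_iff of_nat_mult of_nat_numeral)
  qed
  then show ?thesis using 1 r by (metis add_diff_cancel_left' order_trans)
qed (simp add: inn_def)

end

section \<open>Existence of a non-singleton part\<close>

context cayley_barrier
begin

lemma single_step: "{y} \<in> P \<Longrightarrow> c \<in> C \<Longrightarrow> y \<otimes> c \<in> S"
proof -
  assume a: "{y} \<in> P" "c \<in> C"
  then have "y \<in> V" using P_sub by blast
  then have "y \<otimes> c \<noteq> y" using a C_one C_carrier by (metis l_cancel_one)
  then show ?thesis using P_sep[OF a(1) _ a(2), of y] by simp
qed

lemma degree_le_S:
  assumes "{y} \<in> P"
  shows "card C \<le> card S"
proof -
  have "y \<in> V" using P_sub(1)[OF assms] by blast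
  then have "card ((\<otimes>) y ` C) = card C" using C_sub by (rule card_translate)
  moreover have "(\<otimes>) y ` C \<subseteq> S" using single_step[OF assms] by blast
  then have "card ((\<otimes>) y ` C) \<le> card S" using finS by (rule card_mono[rotated])
  ultimately show ?thesis by simp
qed

lemma card_S_ge: "4 \<le> card S"
  using uv_card card_mono[OF finS uv_sub] by simp

text \<open>For p = 0 each generator has exactly two arcs inside \<open>S\<close>, so a given step
  of the walk lies there for exactly two translates, and the |V| translates give |V| \<le> 2 g.
  Against this, g |C| \<le> 2 |V| for g \<ge> 5, and |V| = 2 |S| - 2 \<ge> 8 excludes g \<le>
  3.\<close>

lemma big_nonempty: "big \<noteq> {}"
proof
  assume nb: "big = {}"
  have sing: "\<exists>y. A = {y}" if "A \<in> P" for A using singleton_part[of A] that nb by simp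
  obtain A where A: "A \<in> P" using P_card card_S_ge by fastforce
  then obtain y where "{y} \<in> P" using sing by blast
  then have kS: "card C \<le> card S" by (rule degree_le_S)
  have out: "x \<otimes> c \<in> S" if "x \<in> V - S" "c \<in> C" for x c
  proof -
    obtain B where "B \<in> P" "x \<in> B" using \<open>x \<in> V - S\<close> P_cover by blast
    then have "{x} \<in> P" using sing by blast
    then show ?thesis using \<open>c \<in> C\<close> by (rule single_step)
  qed
  have "card (V - S) = card P"
  proof -
    have "card (\<Union>P) = sum card P"
      using P_disj P_sub(1) finX by (intro card_Union_disjoint) auto
    also have "\<dots> = (\<Sum>A\<in>P. 1)" using sing by (intro sum.cong refl) fastforce
    finally show ?thesis using P_cover by simp
  qed
  then have nV: "card V + 2 = 2 * card S" using card_compl[OF S_sub] P_card by linarith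
  obtain g where g: "odd g" "\<one> \<in> walk g" and least: "\<And>m. odd m \<Longrightarrow> \<one> \<in> walk m \<Longrightarrow> g \<le> m"
    using odd_walk ex_has_least_nat[of "\<lambda>m. odd m \<and> \<one> \<in> walk m" _ "\<lambda>m. m"] by blast
  obtain z where z: "z 0 = \<one>" "z g = \<one>" "\<And>i. i \<le> g \<Longrightarrow> z i \<in> V"
    "\<And>i. i < g \<Longrightarrow> \<exists>c\<in>C. z (Suc i) = z i \<otimes> c"
    using walk_path[OF g(2)] by blast
  obtain c where c: "\<And>i. i < g \<Longrightarrow> c i \<in> C \<and> z (Suc i) = z i \<otimes> c i" using z(4) by metis
  let ?T = "\<lambda>i. {x \<in> V. x \<otimes> z i \<in> {y \<in> S. y \<otimes> c i \<in> S}}"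
  have "V \<subseteq> (\<Union>i\<in>{..<g}. ?T i)"
  proof
    fix x assume x: "x \<in> V"
    show "x \<in> (\<Union>i\<in>{..<g}. ?T i)"
    proof (rule ccontr)
      assume no: "x \<notin> (\<Union>i\<in>{..<g}. ?T i)"
      \<comment> \<open>If no step lies inside \<open>S\<close>, membership in \<open>S\<close>
        alternates along the walk, because no edge joins two vertices outside
        \<open>S\<close>.\<close>
      have "x \<otimes> z i \<in> S \<longleftrightarrow> (x \<in> S \<longleftrightarrow> even i)" if "i \<le> g" for i
        using that
      proof (induction i)
        case 0
        then show ?case using x z(1) by simp
      next
        case (Suc i)
        have ci: "c i \<in> C" "z (Suc i) = z i \<otimes> c i" using c[of i] Suc.prems by auto
        have zi: "z i \<in> V" using z(3) Suc.prems by simp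
        have eq: "x \<otimes> z (Suc i) = (x \<otimes> z i) \<otimes> c i" using ci x zi C_carrier by (simp add: m_assoc)
        have "x \<otimes> z i \<in> S \<longleftrightarrow> x \<otimes> z (Suc i) \<notin> S"
        proof
          assume "x \<otimes> z i \<in> S"
          then show "x \<otimes> z (Suc i) \<notin> S" using no x eq Suc.prems by auto
        next
          assume "x \<otimes> z (Suc i) \<notin> S"
          then show "x \<otimes> z i \<in> S" using out[of "x \<otimes> z i" "c i"] eq ci x zi by auto
        qed
        then show ?case using Suc by auto
      qed
      from this[of g] show False using g(1) z(2) x by auto
    qed
  qed
  then have "card V \<le> card (\<Union>i\<in>{..<g}. ?T i)" using fin by (intro card_mono) auto
  also have "\<dots> \<le> (\<Sum>i\<in>{..<g}. card (?T i))" by (rule card_UN_le) simp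
  also have "\<dots> = (\<Sum>i\<in>{..<g}. 2)"
  proof (rule sum.cong[OF refl])
    fix i assume i: "i \<in> {..<g}"
    then have "c i \<in> C" "z i \<in> V" using c z(3) by auto
    moreover have "card (?T i) = card {y \<in> S. y \<otimes> c i \<in> S}"
      using S_sub \<open>z i \<in> V\<close> by (intro card_preimage) auto
    ultimately show "card (?T i) = 2" using generator_equation[of "c i"] nb by (simp add: inn_def)
  qed
  finally have Vg: "card V \<le> 2 * g" by simp
  have g1: "g \<noteq> 1"
  proof
    assume "g = 1"
    then obtain d where "d \<in> C" "\<one> = \<one> \<otimes> d" using g(2) by auto
    then show False using C_one C_carrier by auto
  qed
  show False
  proof (cases "5 \<le> g")
    case True
    have "g * card C \<le> 2 * card V" using odd_girth_bound[OF g(2,1) True] least by blast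
    also have "\<dots> \<le> g * 4" using Vg by simp
    finally have "card C \<le> 4" using True by simp
    then show False using degree by simp
  next
    case False
    then have "g \<le> 3" using g(1) by presburger
    then show False using Vg nV kS degree by linarith
  qed
qed

lemma big_singleton: obtains A where "big = {A}"
proof -
  have "0 < card big" using big_nonempty finbig by (simp add: card_gt_0_iff)
  then have "card big = 1" using at_most_one_big by linarith
  then show ?thesis using that by (metis card_1_singletonE)
qed

end

section \<open>Exactly one non-singleton part\<close>

locale cayley_one_big = cayley_barrier +
  fixes A :: "'a set"
  assumes big_A: "big = {A}"
begin

lemma A_P: "A \<in> P" and A_card: "3 \<le> card A" and A_odd: "odd (card A)"
  using big_A big_P big_card P_odd by auto

lemma A_sub: "A \<subseteq> V" and A_S: "A \<inter> S = {}"
  using P_sub A_P by auto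

lemma gen_eq3: "c \<in> C \<Longrightarrow> inn {c} S + cut {c} A = 3"
  using generator_equation[of c] big_A by simp

lemma deg_eq3: "inn C S + cut C A = 3 * card C"
  using degree_equation big_A by simp

lemma outside: "x \<in> V - A - S \<Longrightarrow> {x} \<in> P"
proof -
  assume x: "x \<in> V - A - S"
  then obtain B where B: "B \<in> P" "x \<in> B" using P_cover by blast
  then have "B \<in> P - big" using x big_A by auto
  then show ?thesis using singleton_part B by blast
qed

lemma card_singles: "card (V - A - S) + 3 = card S"
proof -
  have disj: "B \<inter> A = {}" if "B \<in> P - {A}" for B
    using pairwiseD[OF P_disj, of B A] that A_P by (auto simp: disjnt_def)
  have "V - A - S = \<Union>P - A" using P_cover by blast
  also have "\<dots> = \<Union>(P - {A})" using disj by blast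
  also have "card \<dots> = sum card (P - {A})"
    using P_disj P_sub(1) finX by (intro card_Union_disjoint) (auto intro: pairwise_subset)
  also have "\<dots> = (\<Sum>B\<in>P - {A}. 1)"
  proof (rule sum.cong[OF refl])
    fix B assume "B \<in> P - {A}"
    then have "B \<in> P - big" using big_A by auto
    then show "card B = 1" using singleton_part by fastforce
  qed
  finally have "card (V - A - S) = card (P - {A})" by simp
  then show ?thesis using card_Suc_Diff1[OF finP A_P] P_card by linarith
qed

lemma card_D: "card (V - A) + 3 = 2 * card S"
proof -
  have "V - A = S \<union> (V - A - S)" using S_sub A_S by blast
  also have "card \<dots> = card S + card (V - A - S)"
    using finS fin by (intro card_Un_disjoint) auto
  finally have "card (V - A) = card S + card (V - A - S)" .
  then show ?thesis using card_singles by linarith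
qed

lemma S_ge_degree: "card C \<le> card S"
proof -
  have "card (V - A - S) \<noteq> 0" using card_singles card_S_ge by linarith
  then obtain y where "y \<in> V - A - S" by (metis card.empty ex_in_conv)
  then show ?thesis using outside degree_le_S by blast
qed

end

section \<open>Exclusion of triangles\<close>

context cayley_one_big
begin

lemma arcs_to_S: "c \<in> C \<Longrightarrow> card {y \<in> V. (y \<in> S \<or> y \<in> A) \<and> y \<otimes> c \<in> S} = 3"
proof -
  assume c: "c \<in> C"
  have "{y \<in> V. (y \<in> S \<or> y \<in> A) \<and> y \<otimes> c \<in> S} = {y \<in> S. y \<otimes> c \<in> S} \<union> {y \<in> A. y \<otimes> c \<in> S}"
    using S_sub A_sub by blast
  also have "card \<dots> = card {y \<in> S. y \<otimes> c \<in> S} + card {y \<in> A. y \<otimes> c \<in> S}"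
    using finS finX[OF A_sub] A_S by (intro card_Un_disjoint) auto
  finally show ?thesis using gen_eq3[OF c] cut_part[OF A_P c] by (simp add: inn_def)
qed

text \<open>Going around a triangle that is not contained in \<open>A\<close>, one of the three steps leads from
  \<open>S \<union> A\<close> to \<open>S\<close>, and each generator provides three such steps.\<close>

lemma triangle_bound:
  assumes a: "a \<in> C" and b: "b \<in> C" and ab: "a \<otimes> b \<in> C"
  shows "card {x \<in> V. \<not> (x \<in> A \<and> x \<otimes> a \<in> A \<and> x \<otimes> (a \<otimes> b) \<in> A)} \<le> 9"
proof -
  let ?T = "{x \<in> V. \<not> (x \<in> A \<and> x \<otimes> a \<in> A \<and> x \<otimes> (a \<otimes> b) \<in> A)}"
  let ?Z = "\<lambda>c. {y \<in> V. (y \<in> S \<or> y \<in> A) \<and> y \<otimes> c \<in> S}"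
  let ?d = "inv (a \<otimes> b)"
  have V: "a \<in> V" "b \<in> V" "a \<otimes> b \<in> V" using a b ab C_carrier by auto
  have d: "?d \<in> C" using ab C_inv by blast
  \<comment> \<open>Apart from the counted steps and those inside \<open>A\<close>, a step leaves
    \<open>S\<close> or enters \<open>S\<close> from a singleton. Three steps cannot alternate and
    close up, and a walk that enters \<open>A\<close> cannot leave it again without a counted
    step.\<close>
  have step: "(y \<in> S \<or> y \<in> A) \<and> y \<otimes> c \<in> S \<or> y \<in> A \<and> y \<otimes> c \<in> A \<or> y \<in> S \<and> y \<otimes> c \<notin> S
      \<or> y \<notin> S \<and> y \<notin> A \<and> y \<otimes> c \<in> S" if "y \<in> V" "c \<in> C" for y c
    using that single_step[OF outside, of y c] P_sep[OF A_P, of y c] by blast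
  have "?T \<subseteq> ?Z a \<union> ({x \<in> V. x \<otimes> a \<in> ?Z b} \<union> {x \<in> V. x \<otimes> (a \<otimes> b) \<in> ?Z ?d})"
  proof
    fix x assume x: "x \<in> ?T"
    then have xV: "x \<in> V" by simp
    have e: "x \<otimes> a \<otimes> b = x \<otimes> (a \<otimes> b)" "x \<otimes> (a \<otimes> b) \<otimes> ?d = x"
      using xV V by (simp_all add: m_assoc del: inv_mult_group)
    have pV: "x \<otimes> a \<in> V" "x \<otimes> (a \<otimes> b) \<in> V" using xV V by auto
    have s: "(x \<in> S \<or> x \<in> A) \<and> x \<otimes> a \<in> S \<or> x \<in> A \<and> x \<otimes> a \<in> A \<or> x \<in> S \<and> x \<otimes> a \<notin> S
        \<or> x \<notin> S \<and> x \<notin> A \<and> x \<otimes> a \<in> S"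
      "(x \<otimes> a \<in> S \<or> x \<otimes> a \<in> A) \<and> x \<otimes> (a \<otimes> b) \<in> S \<or> x \<otimes> a \<in> A \<and> x \<otimes> (a \<otimes> b) \<in> A
        \<or> x \<otimes> a \<in> S \<and> x \<otimes> (a \<otimes> b) \<notin> S \<or> x \<otimes> a \<notin> S \<and> x \<otimes> a \<notin> A \<and> x \<otimes> (a \<otimes> b) \<in> S"
      "(x \<otimes> (a \<otimes> b) \<in> S \<or> x \<otimes> (a \<otimes> b) \<in> A) \<and> x \<in> S \<or> x \<otimes> (a \<otimes> b) \<in> A \<and> x \<in> A
        \<or> x \<otimes> (a \<otimes> b) \<in> S \<and> x \<notin> S \<or> x \<otimes> (a \<otimes> b) \<notin> S \<and> x \<otimes> (a \<otimes> b) \<notin> A \<and> x \<in> S"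
      using step[OF xV a] step[OF pV(1) b] step[OF pV(2) d] unfolding e by blast+
    have "\<not> (x \<in> A \<and> x \<in> S)" "\<not> (x \<otimes> a \<in> A \<and> x \<otimes> a \<in> S)"
      "\<not> (x \<otimes> (a \<otimes> b) \<in> A \<and> x \<otimes> (a \<otimes> b) \<in> S)" using A_S by blast+
    then have "(x \<in> S \<or> x \<in> A) \<and> x \<otimes> a \<in> S \<or> (x \<otimes> a \<in> S \<or> x \<otimes> a \<in> A) \<and> x \<otimes> (a \<otimes> b) \<in> S
        \<or> (x \<otimes> (a \<otimes> b) \<in> S \<or> x \<otimes> (a \<otimes> b) \<in> A) \<and> x \<in> S"
      using s x by blast
    then show "x \<in> ?Z a \<union> ({x \<in> V. x \<otimes> a \<in> ?Z b} \<union> {x \<in> V. x \<otimes> (a \<otimes> b) \<in> ?Z ?d})"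
      using xV pV e by auto
  qed
  then have "card ?T \<le> card (?Z a \<union> ({x \<in> V. x \<otimes> a \<in> ?Z b} \<union> {x \<in> V. x \<otimes> (a \<otimes> b) \<in> ?Z ?d}))"
    using fin by (intro card_mono) auto
  also have "\<dots> \<le> card (?Z a) + (card {x \<in> V. x \<otimes> a \<in> ?Z b} + card {x \<in> V. x \<otimes> (a \<otimes> b) \<in> ?Z ?d})"
    by (meson add_left_mono card_Un_le order_trans)
  also have "card {x \<in> V. x \<otimes> a \<in> ?Z b} = card (?Z b)" using V by (intro card_preimage) auto
  also have "card {x \<in> V. x \<otimes> (a \<otimes> b) \<in> ?Z ?d} = card (?Z ?d)" using V by (intro card_preimage) auto
  finally show ?thesis using arcs_to_S[OF a] arcs_to_S[OF b] arcs_to_S[OF d] by simp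
qed

text \<open>If there is a triangle, all vertices outside \<open>A\<close> are among the at most nine
  counted ones, so 2 |S| - 3 \<le> 9, while |S| \<ge> |C| \<ge> 5.\<close>

lemma card_S_cases:
  assumes "a \<in> C" "b \<in> C" "a \<otimes> b \<in> C"
  shows "card S = 5 \<and> card C = 5 \<or> card S = 6"
proof -
  have "card (V - A) \<le> card {x \<in> V. \<not> (x \<in> A \<and> x \<otimes> a \<in> A \<and> x \<otimes> (a \<otimes> b) \<in> A)}"
    using fin by (intro card_mono) auto
  then have "card (V - A) \<le> 9" using triangle_bound[OF assms] by linarith
  then show ?thesis using card_D S_ge_degree degree by linarith
qed

text \<open>Two isolated vertices of \<open>V - S\<close> would be twins, so that \<open>C\<close> is a coset of a subgroup of
  order \<open>5\<close>.\<close>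

lemma card_S_not_5: "\<not> (card S = 5 \<and> card C = 5)"
proof
  assume S5: "card S = 5 \<and> card C = 5"
  then have "card (V - A - S) = 2" using card_singles by linarith
  then obtain i1 i2 where i: "i1 \<in> V - A - S" "i2 \<in> V - A - S" "i1 \<noteq> i2"
    by (metis card_2_iff' )
  have nb: "(\<otimes>) i ` C = S" if "i \<in> V - A - S" for i
  proof (rule card_subset_eq[OF finS])
    show "(\<otimes>) i ` C \<subseteq> S" using single_step[OF outside[OF that]] by blast
    show "card ((\<otimes>) i ` C) = card S" using card_translate[of i C] that C_sub S5 by simp
  qed
  have iV: "i1 \<in> V" "i2 \<in> V" using i by auto
  let ?K = "stab C"
  have K: "subgroup ?K G" and r: "rinv ?K C" using stab_subgroup[OF C_sub] stab_rinv[OF C_sub] by auto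
  let ?t = "inv i2 \<otimes> i1"
  have left: "?t \<otimes> c \<in> C" if c: "c \<in> C" for c
  proof -
    have "i1 \<otimes> c \<in> (\<otimes>) i2 ` C" using nb[OF i(1)] nb[OF i(2)] c by blast
    then obtain e where "e \<in> C" "i1 \<otimes> c = i2 \<otimes> e" by blast
    then have "?t \<otimes> c = e" using iV c C_carrier by (simp add: m_assoc inv_solve_left')
    then show ?thesis using \<open>e \<in> C\<close> by simp
  qed
  \<comment> \<open>Left multiplication by \<open>?t\<close> preserves \<open>C\<close>; inversion
    turns this into right multiplication by its inverse.\<close>
  have t: "inv ?t \<in> ?K"
    unfolding stab_def
  proof (intro CollectI conjI ballI)
    fix c assume c: "c \<in> C"
    have "inv (?t \<otimes> inv c) \<in> C" using left[OF C_inv[OF c]] C_inv by blast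
    moreover have "inv (?t \<otimes> inv c) = c \<otimes> inv ?t"
      using iV c C_carrier by (simp add: inv_mult_group m_assoc)
    ultimately show "c \<otimes> inv ?t \<in> C" by (simp only:)
  qed (use iV in simp)
  have t1: "inv ?t \<noteq> \<one>"
  proof
    assume "inv ?t = \<one>"
    then have "inv i1 \<otimes> i2 = \<one>" using iV by (simp add: inv_mult_group)
    then have "i1 = i2" using iV by (metis inv_closed inv_inv inv_equality l_inv inv_unique' m_closed r_inv)
    then show False using i by simp
  qed
  have fK: "finite ?K" using fin by (simp add: stab_def)
  have "card {\<one>, inv ?t} \<le> card ?K"
    using t fK subgroup.one_closed[OF K] by (intro card_mono) auto
  then have "2 \<le> card ?K" using t1 by simp
  moreover have "card ?K dvd 5" using rinv_dvd[OF K r] S5 by simp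
  moreover have "card ?K \<le> 5" using dvd_imp_le[OF \<open>card ?K dvd 5\<close>] by simp
  ultimately have K5: "card ?K = 5"
  proof -
    have "card ?K \<in> {2, 3, 4, 5}" using \<open>2 \<le> card ?K\<close> \<open>card ?K \<le> 5\<close> by auto
    then show ?thesis using \<open>card ?K dvd 5\<close> by auto
  qed
  \<comment> \<open>Both ends of the edge \<open>u1 u2\<close> lie in \<open>i1 C\<close>, a left
    coset of the stabiliser, so the generator \<open>inv u1 \<otimes> u2\<close> and its inverse lie
    in the stabiliser; their product would put the identity into \<open>C\<close>.\<close>
  obtain e where e: "e \<in> C" "u1 = i1 \<otimes> e" using nb[OF i(1)] uv_sub by blast
  obtain f where f: "f \<in> C" "u2 = i1 \<otimes> f" using nb[OF i(1)] uv_sub by blast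
  have ef: "inv u1 \<otimes> u2 = inv e \<otimes> f"
    using e f iV C_carrier by (simp add: inv_mult_group m_assoc inv_solve_left')
  have "blk ?K e = C"
    using blk_rinv_sub[OF K r e(1)] card_blk[OF K C_carrier[OF e(1)]] K5 S5 by (intro card_subset_eq finC) auto
  then have "inv e \<otimes> f \<in> ?K" using f by (auto simp: blk_def)
  then have "inv (inv e \<otimes> f) \<in> ?K" by (rule subgroup.m_inv_closed[OF K])
  then have "(inv u1 \<otimes> u2) \<otimes> inv (inv u1 \<otimes> u2) \<in> C" using u_adj unfolding ef stab_def by blast
  then show False using C_one C_carrier[OF u_adj] by simp
qed

text \<open>Now \<open>V - A\<close> has nine vertices and attains \<open>triangle_bound\<close>, so
  every generator in a triangle stabilises it, and the stabiliser has order 3 or 9. Order 9 makes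
  \<open>V - A\<close> a coset, which then contains all neighbours of \<open>i\<close>, against
  connectedness. For order 3, at least three generators lie outside the stabiliser, and they lead
  from \<open>i\<close> to distinct further cosets, too many for nine vertices.\<close>

lemma card_S_not_6:
  assumes a: "a \<in> C" and b: "b \<in> C" and ab: "a \<otimes> b \<in> C" and S6: "card S = 6"
  shows False
proof -
  let ?D = "V - A"
  let ?K = "stab ?D"
  have D9: "card ?D = 9" using card_D S6 by linarith
  have DV: "?D \<subseteq> V" by blast
  have K: "subgroup ?K G" and r: "rinv ?K ?D" using stab_subgroup[OF DV] stab_rinv[OF DV] by auto
  have fK: "finite ?K" using fin by (simp add: stab_def)
  have tri: "e \<in> ?K" if e: "e \<in> C" and f: "f \<in> C" and ef: "e \<otimes> f \<in> C" for e f
  proof -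
    let ?T = "{x \<in> V. \<not> (x \<in> A \<and> x \<otimes> e \<in> A \<and> x \<otimes> (e \<otimes> f) \<in> A)}"
    have eV: "e \<in> V" using e C_carrier by blast
    have "?D \<subseteq> ?T" by blast
    then have T: "?T = ?D"
      using triangle_bound[OF e f ef] D9 fin by (intro card_seteq[symmetric]) auto
    have "inv e \<in> ?K"
      unfolding stab_def
    proof (intro CollectI conjI ballI)
      fix x assume x: "x \<in> ?D"
      have "(x \<otimes> inv e) \<otimes> e \<notin> A" using x eV by (simp add: m_assoc)
      then have "x \<otimes> inv e \<in> ?T" using x eV by simp
      then show "x \<otimes> inv e \<in> ?D" using T by (simp only:)
    qed (use eV in simp)
    then have "inv (inv e) \<in> ?K" by (rule subgroup.m_inv_closed[OF K])
    then show ?thesis using eV by simp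
  qed
  have aK: "a \<in> ?K" using tri[OF a b ab] .
  have aV: "a \<in> V" and a1: "a \<noteq> \<one>" using a C_carrier C_one by auto
  have oneK: "\<one> \<in> ?K" by (rule subgroup.one_closed[OF K])
  have "card {\<one>, a} \<le> card ?K" using aK oneK fK by (intro card_mono) auto
  then have K2: "2 \<le> card ?K" using a1 by simp
  have Kd: "card ?K dvd 9" using rinv_dvd[OF K r] D9 by simp
  have K9: "card ?K \<le> 9" using dvd_imp_le[OF Kd] by simp
  have "card ?K \<in> {2, 3, 4, 5, 6, 7, 8, 9}" using K2 K9 by auto
  then have K39: "card ?K = 3 \<or> card ?K = 9" using Kd by auto
  have "card (V - A - S) \<noteq> 0" using card_singles S6 by linarith
  then obtain i where i: "i \<in> V - A - S" by (metis card.empty ex_in_conv)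
  have iV: "i \<in> V" using i by blast
  have iS: "i \<otimes> c \<in> S" if "c \<in> C" for c using single_step[OF outside[OF i] that] .
  have SD: "S \<subseteq> ?D" using S_sub A_S by blast
  have bi: "blk ?K i \<subseteq> ?D" using i by (intro blk_rinv_sub[OF K r]) auto
  show False
  proof (cases "card ?K = 9")
    case True
    then have "blk ?K i = ?D" using bi card_blk[OF K iV] D9 fin by (intro card_subset_eq) auto
    then have "i \<otimes> c \<in> blk ?K i" if "c \<in> C" for c using iS[OF that] SD by blast
    then have "C \<subseteq> ?K" using blk_mult[OF K iV blk_self[OF K iV]] C_carrier by blast
    moreover have "?K \<noteq> V"
    proof
      assume "?K = V"
      then have "card V = 9" using True by simp
      moreover have "card ?D + card A = card V" by (rule card_compl[OF A_sub])
      ultimately show False using D9 A_card by linarith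
    qed
    ultimately show False using subgroup_generators[OF K] by blast
  next
    case False
    then have K3: "card ?K = 3" using K39 by simp
    have inv_a: "inv a \<in> ?K" "inv a \<in> C" using subgroup.m_inv_closed[OF K aK] C_inv a by auto
    have "inv a \<noteq> a"
    proof
      assume ia: "inv a = a"
      have "card (?K - {\<one>, a}) = 1" using K3 aK oneK a1 fK by (subst card_Diff_subset) auto
      then obtain t where t: "?K - {\<one>, a} = {t}" by (metis card_1_singletonE)
      then have tK: "t \<in> ?K" "t \<noteq> \<one>" "t \<noteq> a" by auto
      then have tV: "t \<in> V" by (simp add: stab_def)
      have "t \<otimes> a \<in> ?K" by (rule subgroup.m_closed[OF K tK(1) aK])
      moreover have "t \<otimes> a \<noteq> t" using tV aV a1 by (metis l_cancel_one)
      moreover have "t \<otimes> a \<noteq> a" using tV aV tK by (metis r_cancel_one)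
      moreover have "t \<otimes> a \<noteq> \<one>" using tV aV tK ia by (metis inv_equality)
      ultimately show False using t by blast
    qed
    moreover have "inv a \<noteq> \<one>" using C_one inv_a(2) by metis
    ultimately have "card {\<one>, a, inv a} = 3" using a1 by auto
    then have Keq: "{\<one>, a, inv a} = ?K" using K3 aK oneK inv_a fK by (intro card_subset_eq) auto
    let ?W = "(\<otimes>) i ` (C - ?K)"
    have "C \<inter> ?K \<subseteq> {a, inv a}" using C_one unfolding Keq[symmetric] by blast
    then have "card (C \<inter> ?K) \<le> card {a, inv a}" by (intro card_mono) auto
    also have "\<dots> \<le> 2" by (simp add: card_insert_if)
    finally have "3 \<le> card (C - ?K)" using card_generators_subgroup(2)[OF K] degree by linarith
    moreover have "card ?W = card (C - ?K)" using iV C_sub by (intro card_translate) auto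
    ultimately have W3: "3 \<le> card ?W" by simp
    have WV: "?W \<subseteq> V" using iV C_sub by auto
    have fW: "finite ?W" using finX[OF WV] .
    \<comment> \<open>Two neighbours of \<open>i\<close> in one coset differ by \<open>a\<close> or
      its inverse, which yields a triangle containing the generator \<open>c\<close>, so
      \<open>c\<close> would be in the stabiliser.\<close>
    have dis: "blk ?K w \<inter> blk ?K w' = {}" if w: "w \<in> ?W" and w': "w' \<in> ?W" and ne: "w \<noteq> w'" for w w'
    proof (rule ccontr)
      assume "blk ?K w \<inter> blk ?K w' \<noteq> {}"
      then obtain y where "y \<in> blk ?K w" "y \<in> blk ?K w'" by blast
      then have "blk ?K w = blk ?K w'" using blk_eq[OF K] w w' WV by (metis subsetD)
      then have "w' \<in> blk ?K w" using blk_self[OF K] w' WV by blast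
      then have wK: "inv w \<otimes> w' \<in> ?K" by (simp add: blk_def)
      obtain c where c: "c \<in> C" "c \<notin> ?K" "w = i \<otimes> c" using w by blast
      obtain c' where c': "c' \<in> C" "w' = i \<otimes> c'" using w' by blast
      have V: "c \<in> V" "c' \<in> V" using c c' C_carrier by auto
      have eq: "inv w \<otimes> w' = inv c \<otimes> c'"
        using c c' iV V by (simp add: inv_mult_group m_assoc inv_solve_left')
      have ceq: "c \<otimes> (inv c \<otimes> c') = c'" using V by (simp add: m_assoc[symmetric])
      have "inv c \<otimes> c' \<noteq> \<one>"
      proof
        assume "inv c \<otimes> c' = \<one>"
        then have "c = c'" using ceq V by simp
        then show False using ne c c' by simp
      qed
      then have "inv c \<otimes> c' \<in> C" using wK eq Keq a inv_a by auto
      then have "c \<in> ?K" using tri[OF c(1), of "inv c \<otimes> c'"] ceq c'(1) by simp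
      then show False using c(2) by simp
    qed
    have "(\<Union>w\<in>?W. blk ?K w) \<subseteq> ?D - blk ?K i"
    proof
      fix y assume "y \<in> (\<Union>w\<in>?W. blk ?K w)"
      then obtain c where c: "c \<in> C" "c \<notin> ?K" "y \<in> blk ?K (i \<otimes> c)" by blast
      have cV: "c \<in> V" using c C_carrier by blast
      have "i \<otimes> c \<in> ?D" using iS[OF c(1)] SD by blast
      then have "y \<in> ?D" using blk_rinv_sub[OF K r] c(3) by blast
      moreover have "y \<notin> blk ?K i"
      proof
        assume "y \<in> blk ?K i"
        then have "blk ?K (i \<otimes> c) = blk ?K i" using blk_eq[OF K] c(3) iV cV by (metis m_closed)
        then have "i \<otimes> c \<in> blk ?K i" using blk_self[OF K, of "i \<otimes> c"] iV cV by simp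
        then show False using blk_mult[OF K iV blk_self[OF K iV] cV] c(2) by simp
      qed
      ultimately show "y \<in> ?D - blk ?K i" by blast
    qed
    then have "card (\<Union>w\<in>?W. blk ?K w) \<le> card (?D - blk ?K i)" using fin by (intro card_mono) auto
    also have "\<dots> = 6" using card_blk[OF K iV] K3 D9 bi finX[OF blk_sub] by (simp add: card_Diff_subset)
    also have "card (\<Union>w\<in>?W. blk ?K w) = (\<Sum>w\<in>?W. card (blk ?K w))"
      using fW finX[OF blk_sub] dis by (intro card_UN_disjoint) auto
    also have "\<dots> = (\<Sum>w\<in>?W. 3)" using card_blk[OF K] WV K3 by (intro sum.cong) auto
    finally show False using W3 by simp
  qed
qed

lemma triangle_free: "a \<in> C \<Longrightarrow> b \<in> C \<Longrightarrow> a \<otimes> b \<notin> C"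
  using card_S_cases card_S_not_5 card_S_not_6 by blast

text \<open>Mantel's bound |C| |Y| - |Y| |Y| / 2 exceeds 3 |C| - 4 for sets of 4, 5 or 6 vertices,
  so with m = 4 the competing sets have the required 2 m - 1 vertices. Multiplying
  \<open>C \<inter> K\<close> by one of its elements gives a disjoint copy inside \<open>K\<close>,
  hence |C \<inter> K| \<le> |K|/2, and two outgoing generators would cost too much.\<close>

lemma triangle_free_atom:
  assumes X: "eligible 4 X" "cut C X + 4 \<le> 3 * card C"
  obtains K where "subgroup K G" "eligible 4 K" "card (C - K) = 1" "cut C K = card K"
    "2 * card (C \<inter> K) \<le> card K" "card K \<le> cut C X" "card (C \<inter> K) + 1 = card C"
    "\<And>Y. eligible 4 Y \<Longrightarrow> cut C K \<le> cut C Y"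
proof -
  have large: "7 \<le> card Y" if Y: "eligible 4 Y" "cut C Y \<le> cut C X" for Y
  proof (rule ccontr)
    assume "\<not> 7 \<le> card Y"
    then have Y3: "card Y = 4 \<or> card Y = 5 \<or> card Y = 6" using Y(1) by (auto simp: eligible_def)
    have YV: "Y \<subseteq> V" using Y(1) by (simp add: eligible_def)
    have "2 * inn C Y \<le> card Y * card Y" using YV triangle_free by (rule mantel)
    moreover have "cut C Y + inn C Y = card C * card Y" by (rule cut_plus_inn[OF finX[OF YV]])
    ultimately have "2 * (card C * card Y) \<le> 2 * cut C X + card Y * card Y" using Y(2) by linarith
    then show False using Y3 X(2) degree by auto
  qed
  obtain K where K: "subgroup K G" "eligible 4 K" "cut C K \<le> cut C X"
    and low: "\<And>Y. eligible 4 Y \<Longrightarrow> cut C K \<le> cut C Y"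
    by (rule atom_subgroup[OF X(1)]) (use large in auto)
  interpret K: subgroup K G by fact
  have K7: "7 \<le> card K" using large K by blast
  let ?r = "card (C \<inter> K)"
  have two: "2 * ?r \<le> card K"
  proof (cases "C \<inter> K = {}")
    case False
    then obtain b where b: "b \<in> C" "b \<in> K" by blast
    have bV: "b \<in> V" using b C_carrier by blast
    let ?B = "(\<otimes>) b ` (C \<inter> K)"
    have "?B \<inter> C = {}" using triangle_free b by blast
    moreover have "card ?B = ?r" using bV C_sub by (intro card_translate) auto
    moreover have "?B \<subseteq> K" using b by auto
    then have "card ((C \<inter> K) \<union> ?B) \<le> card K" using finX[OF K.subset] by (intro card_mono) auto
    ultimately show ?thesis using finC by (subst (asm) card_Un_disjoint) auto
  qed simp
  define u where "u = card (C - K)"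
  have cK: "cut C K = card K * u" using cut_subgroup[OF K(1) C_sub] by (simp add: u_def)
  have gens: "?r + u = card C" using card_generators_subgroup[OF K(1)] by (simp add: u_def)
  have "K \<noteq> V" using K(2) by (auto simp: eligible_def)
  then have u1: "1 \<le> u"
    using subgroup_generators[OF K(1)] finC by (auto simp: u_def Suc_le_eq card_gt_0_iff)
  have "u = 1"
  proof (rule ccontr)
    assume "u \<noteq> 1"
    then obtain t where t: "u = t + 2" using u1 by (metis le_Suc_ex add.commute Suc_1 Suc_leI le_neq_implies_less plus_1_eq_Suc)
    obtain m where m: "card K = m + 7" using K7 by (metis le_Suc_ex add.commute)
    have "card K * u + 4 \<le> 3 * card C" using K(3) X(2) cK by linarith
    then have "card K * u + 4 \<le> 3 * (?r + u)" by (simp only: gens)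
    then have "2 * m + 12 \<le> 3 * ?r" unfolding t m by (simp add: algebra_simps)
    then show False using two m by linarith
  qed
  then show ?thesis using that[of K] K two cK gens u_def low by simp
qed

text \<open>The boundary of \<open>A\<close> is at most 3 |C| - 4, which is 3 r - 1 for r = |C
  \<inter> K| = |C| - 1. This is the budget of \<open>one_exit_triangle_free\<close>, and it also
  bounds |K|.\<close>

lemma card_A_small: "card A = 3"
proof (rule ccontr)
  assume "card A \<noteq> 3"
  then have A5: "5 \<le> card A" using A_card A_odd by presburger
  have "5 \<le> card (V - A)" using card_D S_ge_degree degree by linarith
  then have el: "eligible 5 A" using A5 A_sub by (simp add: eligible_def)
  then have "eligible 4 A" by (simp add: eligible_def)
  moreover have cA: "cut C A + 4 \<le> 3 * card C" using deg_eq3 inn_S_ge by linarith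
  ultimately obtain K where K: "subgroup K G" "eligible 4 K" "card (C - K) = 1" "cut C K = card K"
    "2 * card (C \<inter> K) \<le> card K" "card K \<le> cut C A" "card (C \<inter> K) + 1 = card C"
    and low: "\<And>Y. eligible 4 Y \<Longrightarrow> cut C K \<le> cut C Y"
    by (rule triangle_free_atom) blast
  obtain c where c: "C - K = {c}" "c \<in> C" "inv c = c"
    and exits: "\<And>U. \<lbrakk>rinv K U; U \<noteq> {}; U \<noteq> V\<rbrakk> \<Longrightarrow> card K \<le> cut {c} U"
    using subgroup_one_exit[OF K(1,3,2) low] by blast
  have A: "A \<in> big" using big_A by simp
  show False
  proof (rule one_exit_triangle_free[OF K(1) c(1) K(5) _ _ exits _ el involution_cut[OF c(2,3) A]])
    show "card K + 1 \<le> 3 * card (C \<inter> K)" using K(6,7) cA by linarith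
    show "4 \<le> card (C \<inter> K)" using K(7) degree by linarith
    show "cut C A + 1 \<le> 3 * card (C \<inter> K)" using K(7) cA by linarith
    fix Y assume Y: "Y \<subseteq> V"
    have "2 * inn C Y \<le> card Y * card Y" using Y triangle_free by (rule mantel)
    moreover have "inn (C \<inter> K) Y \<le> inn C Y" using finC by (intro inn_mono) auto
    moreover have "cut (C \<inter> K) Y + inn (C \<inter> K) Y = card (C \<inter> K) * card Y"
      by (rule cut_plus_inn[OF finX[OF Y]])
    ultimately show "2 * card Y * card (C \<inter> K) \<le> 2 * cut (C \<inter> K) Y + card Y * card Y"
      by (simp add: algebra_simps)
  qed
qed

text \<open>Three vertices without a triangle span at most four arcs, so the boundary of
  \<open>A\<close> is at least 3 |C| - 4, and the degree equation leaves only four arcs in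
  \<open>S\<close>. Now \<open>S\<close> is half of \<open>V\<close>, and in a regular graph
  complementary halves span equally many arcs.\<close>

lemma inn_S: "inn C S = 4" and inn_compl_S: "inn C (V - S) = 4" and card_compl_S: "card (V - S) = card S"
proof -
  have "2 * inn C A \<le> 9" using mantel[OF A_sub triangle_free] card_A_small by simp
  moreover have "cut C A + inn C A = card C * 3"
    using cut_plus_inn[OF finX[OF A_sub], of C] card_A_small by simp
  ultimately show i: "inn C S = 4" using deg_eq3 inn_S_ge by linarith
  have "card V = 2 * card S" using card_D card_compl[OF A_sub] card_A_small by linarith
  then show eq: "card (V - S) = card S" using card_compl[OF S_sub] by linarith
  have "cut C S + inn C S = cut C (V - S) + inn C (V - S)"
    using cut_plus_inn[OF finS, of C] cut_plus_inn[of "V - S" C] fin eq by simp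
  then show "inn C (V - S) = 4" using cut_compl[OF S_sub C_sub] i by simp
qed

text \<open>Moving a vertex \<open>q\<close> of \<open>S\<close> to the other side of the almost bipartition \<open>(S, V - S)\<close> creates
  too many edges inside that side, because \<open>q\<close> has at most one neighbour in \<open>S\<close>.\<close>

lemma no_exchange:
  assumes W: "W \<subseteq> V" "inn C W = 4" and q: "q \<in> S \<inter> W" and few: "card ((V - S) - W) \<le> 1"
  shows False
proof -
  have qV: "q \<in> V" using q S_sub by blast
  \<comment> \<open>At least |C| - 1 neighbours of \<open>q\<close> lie outside \<open>S\<close>,
    and at most one of them avoids \<open>W\<close>; the at least three edges from \<open>q\<close>
    into \<open>W\<close> give six arcs.\<close>
  have "{c \<in> C. q \<otimes> c \<notin> S} \<subseteq> {c \<in> C. q \<otimes> c \<in> W} \<union> {c \<in> C. q \<otimes> c \<in> (V - S) - W}"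
    using qV C_carrier by auto
  then have "card {c \<in> C. q \<otimes> c \<notin> S}
      \<le> card ({c \<in> C. q \<otimes> c \<in> W} \<union> {c \<in> C. q \<otimes> c \<in> (V - S) - W})"
    using finC by (intro card_mono) auto
  also have "\<dots> \<le> card {c \<in> C. q \<otimes> c \<in> W} + card {c \<in> C. q \<otimes> c \<in> (V - S) - W}" by (rule card_Un_le)
  also have "card {c \<in> C. q \<otimes> c \<in> (V - S) - W} \<le> card ((V - S) - W)"
    using fin C_sub qV by (intro card_inj_on_le[OF translate_inj[OF qV]]) auto
  finally have "card {c \<in> C. q \<otimes> c \<notin> S} \<le> card {c \<in> C. q \<otimes> c \<in> W} + 1" using few by linarith
  moreover have "card {c \<in> C. q \<otimes> c \<notin> S} + card {c \<in> C. q \<otimes> c \<in> S} = card C" by (rule card_split[OF finC])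
  moreover have "card {c \<in> C. q \<otimes> c \<in> S} \<le> 1" using inn_S_eq[OF inn_S] q by blast
  moreover have "2 * card {c \<in> C. q \<otimes> c \<in> W} \<le> inn C W" using W q by (intro inn_ge_twice_degree) auto
  ultimately show False using W(2) degree by linarith
qed

text \<open>An arc between the symmetric difference and its complement crosses exactly one of the
  partitions given by \<open>S\<close> and \<open>R\<close>, hence lies inside a side of the other.
  The four sides hold 16 arcs, which cover the exits from the difference and from its complement;
  these two cuts are equal.\<close>

lemma cut_sym_diff:
  assumes R: "R \<subseteq> V" "inn C R = 4" "inn C (V - R) = 4"
  shows "cut C ((S - R) \<union> (R - S)) \<le> 8"
proof -
  let ?Q = "(S - R) \<union> (R - S)"
  let ?i = "\<lambda>X c. card {x \<in> X. x \<otimes> c \<in> X}"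
  have QV: "?Q \<subseteq> V" using R S_sub by blast
  have "card {x \<in> ?Q. x \<otimes> c \<notin> ?Q} + card {x \<in> V - ?Q. x \<otimes> c \<notin> V - ?Q}
      \<le> ?i S c + ?i (V - S) c + (?i R c + ?i (V - R) c)" if c: "c \<in> C" for c
  proof -
    have f: "finite ?Q" "finite (V - ?Q)" using finX[OF QV] finX[of "V - ?Q"] by blast+
    have f': "finite {x \<in> ?Q. x \<otimes> c \<notin> ?Q}" "finite {x \<in> V - ?Q. x \<otimes> c \<notin> V - ?Q}"
      by (rule finite_subset[OF _ f(1)], blast) (rule finite_subset[OF _ f(2)], blast)
    have "card {x \<in> ?Q. x \<otimes> c \<notin> ?Q} + card {x \<in> V - ?Q. x \<otimes> c \<notin> V - ?Q}
        = card ({x \<in> ?Q. x \<otimes> c \<notin> ?Q} \<union> {x \<in> V - ?Q. x \<otimes> c \<notin> V - ?Q})"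
      by (intro card_Un_disjoint[symmetric] f') blast
    also have "\<dots> \<le> card (({x \<in> S. x \<otimes> c \<in> S} \<union> {x \<in> V - S. x \<otimes> c \<in> V - S})
        \<union> ({x \<in> R. x \<otimes> c \<in> R} \<union> {x \<in> V - R. x \<otimes> c \<in> V - R}))"
      using fin finS finX[OF R(1)] S_sub R(1) C_carrier[OF c] by (intro card_mono) auto
    also have "\<dots> \<le> ?i S c + ?i (V - S) c + (?i R c + ?i (V - R) c)"
      by (meson add_mono card_Un_le order_trans)
    finally show ?thesis .
  qed
  then have "cut C ?Q + cut C (V - ?Q) \<le> inn C S + inn C (V - S) + (inn C R + inn C (V - R))"
    unfolding cut_def inn_def sum.distrib[symmetric] by (rule sum_mono)
  then show ?thesis using cut_compl[OF QV C_sub] R inn_S inn_compl_S by simp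
qed

text \<open>A subgroup atom of order \<open>8\<close> would be a \<open>K\<^sub>4\<^sub>,\<^sub>4\<close> containing an edge of \<open>S\<close>, but then
  \<open>V - S\<close> would contain too many edges in the same coset.\<close>

lemma no_order_8_atom:
  assumes K: "subgroup K G" "card K = 8" "card (C \<inter> K) = 4" "C - K = {c}"
  shows False
proof -
  let ?E = "C \<inter> K"
  have E: "?E \<subseteq> K" "?E \<subseteq> V" using C_sub by auto
  have "inn C S = inn ?E S + inn {c} S"
    unfolding inn_def using sum.Int_Diff[OF finC, of "\<lambda>c. card {x \<in> S. x \<otimes> c \<in> S}" K] K(4) by simp
  moreover have "c \<in> C" using K(4) by auto
  then have "inn {c} S \<le> 3" using gen_eq3[of c] by linarith
  \<comment> \<open>The outgoing generator accounts for at most three of the four arcs in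
    \<open>S\<close>.\<close>
  ultimately have "inn ?E S \<noteq> 0" using inn_S by linarith
  then obtain b where "b \<in> ?E" "card {x \<in> S. x \<otimes> b \<in> S} \<noteq> 0" unfolding inn_def by (meson sum.neutral)
  then obtain x where x: "x \<in> S" "x \<otimes> b \<in> S" and b: "b \<in> C" "b \<in> K"
    by (metis (mono_tags, lifting) Collect_empty_eq IntE card.empty)
  let ?y = "x \<otimes> b"
  have xV: "x \<in> V" and yV: "?y \<in> V" and bV: "b \<in> V" using x S_sub b C_carrier by auto
  let ?B = "blk K x" and ?M = "(\<otimes>) x ` ?E" and ?N = "(\<otimes>) ?y ` ?E"
  have yB: "?y \<in> ?B" using blk_mult[OF K(1) xV blk_self[OF K(1) xV] bV] b by simp
  have MB: "?M \<subseteq> ?B" using blk_mult[OF K(1) xV blk_self[OF K(1) xV]] C_carrier by auto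
  have NB: "?N \<subseteq> ?B" using blk_mult[OF K(1) xV yB] C_carrier by auto
  \<comment> \<open>Without triangles the neighbourhoods of \<open>x\<close> and \<open>?y\<close>
    in the coset are disjoint, so with 4 + 4 vertices they fill it; each contains at most one vertex
    of \<open>S\<close>.\<close>
  have "?M \<inter> ?N = {}"
  proof (rule ccontr)
    assume "?M \<inter> ?N \<noteq> {}"
    then obtain e f where ef: "e \<in> C" "f \<in> C" "x \<otimes> e = ?y \<otimes> f" by blast
    then have "x \<otimes> e = x \<otimes> (b \<otimes> f)" using xV bV C_carrier by (simp add: m_assoc)
    then have "e = b \<otimes> f" using ef xV bV C_carrier by simp
    then show False using ef triangle_free b by blast
  qed
  moreover have "card ?M = 4" "card ?N = 4" using card_translate[OF xV E(2)] card_translate[OF yV E(2)] K(3) by auto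
  ultimately have "card (?M \<union> ?N) = 8" using finC by (subst card_Un_disjoint) auto
  then have MN: "?M \<union> ?N = ?B"
    using MB NB card_blk[OF K(1) xV] K(2) finX[OF blk_sub] by (intro card_subset_eq) auto
  have one: "card (S \<inter> (\<otimes>) w ` ?E) \<le> 1" if w: "w \<in> S" for w
  proof -
    have wV: "w \<in> V" using w S_sub by blast
    have "S \<inter> (\<otimes>) w ` ?E \<subseteq> (\<otimes>) w ` {c \<in> C. w \<otimes> c \<in> S}" by blast
    then have "card (S \<inter> (\<otimes>) w ` ?E) \<le> card ((\<otimes>) w ` {c \<in> C. w \<otimes> c \<in> S})"
      using finC by (intro card_mono) auto
    also have "\<dots> = card {c \<in> C. w \<otimes> c \<in> S}" using wV C_sub by (intro card_translate) auto
    also have "\<dots> \<le> 1" by (rule inn_S_eq[OF inn_S w])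
    finally show ?thesis .
  qed
  have "S \<inter> ?B = (S \<inter> ?M) \<union> (S \<inter> ?N)" using MN by blast
  then have "card (S \<inter> ?B) \<le> card (S \<inter> ?M) + card (S \<inter> ?N)" by (simp add: card_Un_le)
  then have SB: "card (S \<inter> ?B) \<le> 2" using one[OF x(1)] one[OF x(2)] by linarith
  let ?T = "?B - S"
  have fB: "finite ?B" by (rule finX[OF blk_sub])
  have "card ?T + card (S \<inter> ?B) = 8"
    using card_Diff_subset_Int[of ?B S] fB card_mono[OF fB, of "?B \<inter> S"] card_blk[OF K(1) xV] K(2)
    by (simp add: Int_commute)
  then have T6: "6 \<le> card ?T" using SB by linarith
  \<comment> \<open>The at most two vertices of \<open>S\<close> in the coset send at most 8 arcs
    into \<open>?T\<close>, so the at least six vertices of \<open>?T\<close> keep at least 24 - 8 =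
    16 arcs among themselves, against four in all of \<open>V - S\<close>.\<close>
  have "cut ?E ?T = cut ?E (S \<inter> ?B)"
    by (rule cut_rinv_diff[OF K(1) rinv_blk[OF K(1) xV] E(1) S_sub])
  moreover have "cut ?E (S \<inter> ?B) \<le> card ?E * card (S \<inter> ?B)"
    using cut_plus_inn[of "S \<inter> ?B" ?E] finS by simp
  ultimately have "cut ?E ?T \<le> 8" using SB K(3) by simp
  moreover have "cut ?E ?T + inn ?E ?T = 4 * card ?T" using cut_plus_inn[of ?T ?E] fB K(3) by simp
  moreover have "inn ?E ?T \<le> inn C ?T" using finC by (intro inn_mono) auto
  moreover have "inn C ?T \<le> inn C (V - S)" using fin blk_sub by (intro inn_mono_set) auto
  ultimately show False using T6 inn_compl_S by linarith
qed

text \<open>The symmetric difference \<open>?Q\<close> has size 2 j and its complement size 2 l. The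
  cases j = 1 and l = 1 are exchanges of a single vertex. Otherwise \<open>?Q\<close> is eligible
  for m = 4, and 8 \<le> 2 |C \<inter> K| \<le> |K| \<le> 8 determines the atom.\<close>

lemma translate_S:
  assumes g: "g \<in> V"
  shows "(\<otimes>) g ` S = S \<or> (\<otimes>) g ` S = V - S"
proof (rule ccontr)
  assume no: "\<not> ?thesis"
  let ?R = "(\<otimes>) g ` S"
  let ?Q = "(S - ?R) \<union> (?R - S)"
  have R: "?R \<subseteq> V" using translate_sub[OF g S_sub] .
  have fR: "finite ?R" using finX[OF R] .
  have cR: "card ?R = card S" using card_translate[OF g S_sub] .
  have iR: "inn C ?R = 4" using inn_translate[OF g S_sub C_sub] inn_S by simp
  have cVR: "card (V - ?R) = card (V - S)" using card_compl[OF R] card_compl[OF S_sub] cR by linarith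
  have iVR: "inn C (V - ?R) = 4"
  proof -
    have "cut C ?R + inn C ?R = cut C (V - ?R) + inn C (V - ?R)"
      using cut_plus_inn[OF fR, of C] cut_plus_inn[of "V - ?R" C] fin cVR cR card_compl_S by simp
    then show ?thesis using cut_compl[OF R C_sub] iR by simp
  qed
  define j where "j = card (S - ?R)"
  define l where "l = card (S \<inter> ?R)"
  have jl: "j + l = card S" unfolding j_def l_def
    using finS by (subst card_Un_disjoint[symmetric]) (auto intro: arg_cong[where f = card])
  have jR: "card (?R - S) + l = card S" unfolding cR[symmetric] l_def
    using fR by (subst card_Un_disjoint[symmetric]) (auto intro: arg_cong[where f = card])
  have j2: "card (?R - S) = j" using jl jR by linarith
  have Q: "card ?Q = 2 * j" using finS fR j2 by (subst card_Un_disjoint) (auto simp: j_def)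
  have QV: "?Q \<subseteq> V" using R S_sub by blast
  have VQ: "card (V - ?Q) = 2 * l"
    using card_compl[OF QV] card_compl[OF S_sub] card_compl_S Q jl by linarith
  have VR: "card ((V - S) - ?R) = l"
  proof -
    have "card ((V - S) - ?R) + card (?R - S) = card (V - S)"
      using fin fR R by (subst card_Un_disjoint[symmetric]) (auto intro: arg_cong[where f = card])
    then show ?thesis using jR card_compl_S by linarith
  qed
  have j0: "j \<noteq> 0"
  proof
    assume "j = 0"
    then have "S \<subseteq> ?R" using finS by (simp add: j_def)
    then have "S = ?R" using fR cR by (intro card_subset_eq) auto
    then show False using no by simp
  qed
  have l0: "l \<noteq> 0"
  proof
    assume "l = 0"
    then have "?R \<subseteq> V - S" using finS R by (auto simp: l_def)
    then have "?R = V - S" using fin cR card_compl_S by (intro card_subset_eq) auto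
    then show False using no by simp
  qed
  have j1: "j \<noteq> 1"
  proof
    assume j: "j = 1"
    then have "S - ?R \<noteq> {}" unfolding j_def by force
    then obtain q where "q \<in> S - ?R" by blast
    then have "q \<in> S \<inter> (V - ?R)" using S_sub by blast
    moreover have "(V - S) - (V - ?R) = ?R - S" using R by blast
    ultimately show False using no_exchange[OF _ iVR, of q] j j2 by auto
  qed
  have l1: "l \<noteq> 1"
  proof
    assume l: "l = 1"
    then have "S \<inter> ?R \<noteq> {}" unfolding l_def by force
    then obtain q where "q \<in> S \<inter> ?R" by blast
    then show False using no_exchange[OF R iR, of q] l VR by auto
  qed
  have el: "eligible 4 ?Q" using QV Q VQ j0 j1 l0 l1 by (auto simp: eligible_def)
  have c8: "cut C ?Q \<le> 8" using cut_sym_diff[OF R iR iVR] .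
  then have "cut C ?Q + 4 \<le> 3 * card C" using degree by linarith
  with el obtain K where K: "subgroup K G" "eligible 4 K" "card (C - K) = 1" "cut C K = card K"
    "2 * card (C \<inter> K) \<le> card K" "card K \<le> cut C ?Q" "card (C \<inter> K) + 1 = card C"
    by (rule triangle_free_atom) blast
  have "card K = 8" "card (C \<inter> K) = 4" using K c8 degree by linarith+
  moreover obtain c where "C - K = {c}" using K(3) by (metis card_1_singletonE)
  ultimately show False using no_order_8_atom K(1) by blast
qed

text \<open>The translation taking \<open>u1\<close> to a vertex of \<open>S\<close> maps
  \<open>S\<close> to a set that meets \<open>S\<close>, hence to \<open>S\<close> itself, and takes
  \<open>u2\<close> along. So the generator of the edge \<open>u1 u2\<close> maps \<open>S\<close>
  into itself and has |S| \<ge> 5 arcs there, more than the four available.\<close>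

theorem contradiction: False
proof -
  let ?c = "inv u1 \<otimes> u2"
  have u: "u1 \<in> S" "u2 \<in> S" "u1 \<in> V" "u2 \<in> V" using uv_sub S_sub by auto
  have "x \<otimes> ?c \<in> S" if x: "x \<in> S" for x
  proof -
    have xV: "x \<in> V" using x S_sub by blast
    let ?g = "x \<otimes> inv u1"
    have gV: "?g \<in> V" using xV u by simp
    have "?g \<otimes> u1 = x" "?g \<otimes> u2 = x \<otimes> ?c" using xV u by (simp_all add: m_assoc)
    then have "x \<in> (\<otimes>) ?g ` S" "x \<otimes> ?c \<in> (\<otimes>) ?g ` S" using u by (metis image_eqI)+
    then show ?thesis using translate_S[OF gV] x by auto
  qed
  then have "{x \<in> S. x \<otimes> ?c \<in> S} = S" by blast
  then have "inn {?c} S = card S" by (simp add: inn_def)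
  moreover have "inn {?c} S \<le> inn C S" using u_adj finC by (intro inn_mono) auto
  ultimately show False using inn_S S_ge_degree degree by linarith
qed

end

section \<open>Extending two independent edges\<close>

context cayley
begin

definition adj :: "'a \<Rightarrow> 'a \<Rightarrow> bool" where
  "adj x y \<longleftrightarrow> x \<in> V \<and> y \<in> V \<and> inv x \<otimes> y \<in> C"

lemma adj_sym: "adj x y \<Longrightarrow> adj y x"
proof -
  assume a: "adj x y"
  then have "inv (inv x \<otimes> y) \<in> C" using C_inv by (simp add: adj_def)
  moreover have "inv (inv x \<otimes> y) = inv y \<otimes> x" using a by (simp add: adj_def inv_mult_group)
  ultimately show ?thesis using a by (simp add: adj_def)
qed

lemma adj_mult: "x \<in> V \<Longrightarrow> c \<in> C \<Longrightarrow> adj x (x \<otimes> c)"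
  using C_carrier by (simp add: adj_def m_assoc[symmetric])

lemma adj_neq: "adj x y \<Longrightarrow> x \<noteq> y"
  using C_one by (auto simp: adj_def)

text \<open>\<open>S\<close> is the barrier together with the four ends. Keeping |T| + 1 members of
  the family and merging all other vertices into one part \<open>R\<close> makes the deficiency
  exact; \<open>R\<close> is odd because |V| is even.\<close>

lemma barrier_exists:
  assumes ev: "even (card V)" and Q: "Q \<subseteq> V" "card Q = 4"
    and TF: "odd_family adj (V - Q) T F" "card T < card F"
  obtains S P where "S \<subseteq> V" "Q \<subseteq> S" "pairwise disjnt P" "\<Union>P = V - S"
    "\<And>A. A \<in> P \<Longrightarrow> odd (card A)"
    "\<And>A x c. \<lbrakk>A \<in> P; x \<in> A; c \<in> C\<rbrakk> \<Longrightarrow> x \<otimes> c \<in> A \<union> S" "card P + 2 = card S"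
proof -
  have TQ: "T \<subseteq> V - Q" and disF: "pairwise disjnt F"
    and FA: "\<And>A. A \<in> F \<Longrightarrow> A \<subseteq> V - Q - T \<and> odd (card A) \<and> (\<forall>x\<in>A. \<forall>y\<in>V - Q - T - A. \<not> adj x y)"
    using TF(1) by (auto simp: odd_family_def)
  have fT: "finite T" "finite Q" using TQ Q finX by auto
  obtain F' where F': "F' \<subseteq> F" "card F' = card T + 1" "finite F'"
    using TF(2) obtain_subset_with_card_n[of "card T + 1" F] by auto
  define S where "S = T \<union> Q"
  define R where "R = V - S - \<Union>F'"
  have SV: "S \<subseteq> V" using TQ Q by (auto simp: S_def)
  have cS: "card S = card T + 4" unfolding S_def using TQ Q fT by (subst card_Un_disjoint) auto
  have F'A: "A \<subseteq> V - S" "odd (card A)" "\<And>x y. x \<in> A \<Longrightarrow> y \<in> V - S - A \<Longrightarrow> \<not> adj x y"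
    if "A \<in> F'" for A
  proof -
    have A: "A \<in> F" using that F' by blast
    have e: "V - S = V - Q - T" by (auto simp: S_def)
    show "A \<subseteq> V - S" "odd (card A)" using FA[OF A] e by auto
    show "\<not> adj x y" if "x \<in> A" "y \<in> V - S - A" for x y using FA[OF A] that e by blast
  qed
  have disF': "pairwise disjnt F'" using disF F'(1) by (rule pairwise_subset)
  have UF: "\<Union>F' \<subseteq> V - S" using F'A(1) by blast
  have "odd (card R)"
  proof -
    have "even (card (\<Union>F')) \<longleftrightarrow> even (card F')" using F' disF' F'A(2) by (intro card_Union_odd_parity)
    moreover have "card (V - S) + card S = card V" by (rule card_compl[OF SV])
    moreover have "card R + card (\<Union>F') = card (V - S)"
      unfolding R_def using UF fin by (metis card_Diff_subset card_mono finite_Diff finite_subset le_add_diff_inverse2)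
    ultimately show ?thesis using ev cS F'(2) by presburger
  qed
  then have "R \<noteq> {}" by force
  then have RF: "R \<notin> F'" unfolding R_def by blast
  show ?thesis
  proof (rule that[of S "insert R F'"])
    show "S \<subseteq> V" "Q \<subseteq> S" using SV by (auto simp: S_def)
    show "pairwise disjnt (insert R F')"
      using disF' by (auto simp: pairwise_insert disjnt_def R_def)
    show "\<Union>(insert R F') = V - S" using UF by (auto simp: R_def)
    show "odd (card A)" if "A \<in> insert R F'" for A using that F'A(2) \<open>odd (card R)\<close> by blast
    show "card (insert R F') + 2 = card S" using RF F' cS by simp
    fix A x c assume A: "A \<in> insert R F'" "x \<in> A" "c \<in> C"
    have "A \<subseteq> V - S" using A(1) F'A(1) by (auto simp: R_def)
    then have xV: "x \<in> V" "x \<notin> S" using A(2) by auto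
    have a: "adj x (x \<otimes> c)" using adj_mult xV A(3) by blast
    have cV: "x \<otimes> c \<in> V" using a by (simp add: adj_def)
    show "x \<otimes> c \<in> A \<union> S"
    proof (rule ccontr)
      assume n: "x \<otimes> c \<notin> A \<union> S"
      show False
      proof (cases "A \<in> F'")
        case True
        then show False using F'A(3)[OF True A(2)] a n cV by blast
      next
        case False
        then have AR: "A = R" using A(1) by blast
        then obtain B where B: "B \<in> F'" "x \<otimes> c \<in> B" using n cV by (auto simp: R_def)
        then have "x \<notin> B" using A(2) AR by (auto simp: R_def)
        then show False using F'A(3)[OF B, of x] adj_sym[OF a] xV by blast
      qed
    qed
  qed
qed

lemma two_edges_extend:
  assumes ev: "even (card V)" and degree: "5 \<le> card C" and odd: "\<exists>n. odd n \<and> \<one> \<in> walk n"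
    and uv: "card {u1, u2, v1, v2} = 4" "adj u1 u2" "adj v1 v2"
  shows "\<exists>N. perfectly_matched adj (V - {u1, u2, v1, v2}) N"
proof (rule ccontr)
  assume no: "\<not> ?thesis"
  let ?Q = "{u1, u2, v1, v2}"
  have Q: "?Q \<subseteq> V" using uv by (auto simp: adj_def)
  have "\<exists>T F. odd_family adj (V - ?Q) T F \<and> card T < card F"
  proof (rule ccontr)
    assume "\<not> ?thesis"
    then have "\<And>T F. odd_family adj (V - ?Q) T F \<Longrightarrow> card F \<le> card T" by (meson not_less)
    moreover have "symp adj" using adj_sym by (intro sympI)
    ultimately show False using tutte[of "V - ?Q" adj] fin no by blast
  qed
  then obtain T F where TF: "odd_family adj (V - ?Q) T F" "card T < card F" by blast
  obtain S P where SP: "S \<subseteq> V" "?Q \<subseteq> S" "pairwise disjnt P" "\<Union>P = V - S"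
    "\<And>A. A \<in> P \<Longrightarrow> odd (card A)"
    "\<And>A x c. \<lbrakk>A \<in> P; x \<in> A; c \<in> C\<rbrakk> \<Longrightarrow> x \<otimes> c \<in> A \<union> S" "card P + 2 = card S"
    by (rule barrier_exists[OF ev Q uv(1) TF]) blast
  interpret B: cayley_barrier G C S P u1 u2 v1 v2
    by unfold_locales (use SP degree uv odd in \<open>auto simp: adj_def\<close>)
  obtain A where "B.big = {A}" by (rule B.big_singleton)
  then interpret O: cayley_one_big G C S P u1 u2 v1 v2 A by unfold_locales
  show False by (rule O.contradiction)
qed

end

lemma connected_cayley_generates:
  fixes \<Gamma> :: "('a, 'b) monoid_scheme"
  assumes "group \<Gamma>" and C: "connection_set \<Gamma> C"
    and con: "Digraph_Component.connected (with_proj (cayley_graph \<Gamma> C))"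
    and U: "U \<subseteq> carrier \<Gamma>" "\<one>\<^bsub>\<Gamma>\<^esub> \<in> U" "\<And>x c. \<lbrakk>x \<in> U; c \<in> C\<rbrakk> \<Longrightarrow> x \<otimes>\<^bsub>\<Gamma>\<^esub> c \<in> U"
  shows "U = carrier \<Gamma>"
proof
  interpret group \<Gamma> by fact
  let ?X = "cayley_graph \<Gamma> C"
  \<comment> \<open>Connectedness of a digraph is reachability in its symmetric closure, whose arcs
    are again steps by generators because \<open>C\<close> is inverse-closed.\<close>
  let ?M = "mk_symmetric (with_proj ?X)"
  have step: "y \<in> U" if "x \<in> U" "(x, y) \<in> parcs ?M" for x y
  proof -
    from that(2) have arc: "(x, y) \<in> parcs ?X \<or> (y, x) \<in> parcs ?X" by (auto simp: mk_symmetric_def)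
    then have xy: "x \<in> carrier \<Gamma>" "y \<in> carrier \<Gamma>" by (auto simp: cayley_graph_def)
    have "inv\<^bsub>\<Gamma>\<^esub> x \<otimes>\<^bsub>\<Gamma>\<^esub> y \<in> C"
      using arc
    proof
      assume "(y, x) \<in> parcs ?X"
      then have "inv\<^bsub>\<Gamma>\<^esub> (inv\<^bsub>\<Gamma>\<^esub> y \<otimes>\<^bsub>\<Gamma>\<^esub> x) \<in> C"
        using C by (auto simp: cayley_graph_def connection_set_def)
      moreover have "inv\<^bsub>\<Gamma>\<^esub> (inv\<^bsub>\<Gamma>\<^esub> y \<otimes>\<^bsub>\<Gamma>\<^esub> x) = inv\<^bsub>\<Gamma>\<^esub> x \<otimes>\<^bsub>\<Gamma>\<^esub> y"
        using xy by (simp add: inv_mult_group)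
      ultimately show ?thesis by simp
    qed (simp add: cayley_graph_def)
    then have "x \<otimes>\<^bsub>\<Gamma>\<^esub> (inv\<^bsub>\<Gamma>\<^esub> x \<otimes>\<^bsub>\<Gamma>\<^esub> y) \<in> U" using U(3) that(1) by blast
    moreover have "x \<otimes>\<^bsub>\<Gamma>\<^esub> (inv\<^bsub>\<Gamma>\<^esub> x \<otimes>\<^bsub>\<Gamma>\<^esub> y) = y" using xy by (simp add: m_assoc[symmetric])
    ultimately show ?thesis by (simp only:)
  qed
  show "carrier \<Gamma> \<subseteq> U"
  proof
    fix v assume v: "v \<in> carrier \<Gamma>"
    have "(\<one>\<^bsub>\<Gamma>\<^esub>, v) \<in> rtrancl_on (pverts ?M) (parcs ?M)"
      using con v unfolding connected_def strongly_connected_def reachable_def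
      by (auto simp: cayley_graph_def)
    moreover have "b \<in> U" if "(a, b) \<in> rtrancl_on (pverts ?M) (parcs ?M)" "a \<in> U" for a b
      using that by induction (use step in auto)
    ultimately show "v \<in> U" using U(2) by blast
  qed
qed (rule U(1))

text \<open>Without odd closed walks, the parity of a walk from the identity depends only on its
  end, and the two parity classes form a bipartition.\<close>

lemma (in cayley) odd_walk_if_not_bipartite:
  assumes "\<not> bipartite_graph (cayley_graph G C)"
  shows "\<exists>n. odd n \<and> \<one> \<in> walk n"
proof (rule ccontr)
  assume no: "\<not> ?thesis"
  let ?A = "\<Union>n\<in>{n. even n}. walk n" and ?B = "\<Union>n\<in>{n. odd n}. walk n"
  have "(\<Union>n. walk n) = V"
  proof (rule gen)
    show "(\<Union>n. walk n) \<subseteq> V" using walk_sub by blast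
    show "\<one> \<in> (\<Union>n. walk n)" by (metis UN_I UNIV_I singletonI walk.simps(1))
    show "x \<otimes> c \<in> (\<Union>n. walk n)" if "x \<in> (\<Union>n. walk n)" "c \<in> C" for x c
      using that walk_add[OF _ walk_1] by blast
  qed
  then have AB: "?A \<union> ?B = V" by blast
  have disj: "?A \<inter> ?B = {}"
  proof (rule ccontr)
    assume "?A \<inter> ?B \<noteq> {}"
    then obtain x m n where x: "x \<in> walk m" "x \<in> walk n" "even m" "odd n" by blast
    then have "x \<otimes> inv x \<in> walk (m + n)" using walk_add walk_inv by blast
    moreover have "x \<in> V" using x walk_sub by blast
    ultimately show False using no x by (metis odd_add r_inv)
  qed
  have "parcs (cayley_graph G C) \<subseteq> ?A \<times> ?B \<union> ?B \<times> ?A"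
  proof
    fix e assume "e \<in> parcs (cayley_graph G C)"
    then obtain x y where xy: "e = (x, y)" "x \<in> V" "y \<in> V" "inv x \<otimes> y \<in> C" by (auto simp: cayley_graph_def)
    have y: "y = x \<otimes> (inv x \<otimes> y)" using xy by (simp add: m_assoc[symmetric])
    obtain n where n: "x \<in> walk n" using AB xy(2) by blast
    have "x \<otimes> (inv x \<otimes> y) \<in> walk (n + 1)" by (rule walk_add[OF n walk_1[OF xy(4)]])
    then have m: "x \<in> walk n" "y \<in> walk (n + 1)" using n by (simp_all only: y[symmetric])
    have A: "w \<in> ?A" if "w \<in> walk i" "even i" for w i using that by blast
    have B: "w \<in> ?B" if "w \<in> walk i" "odd i" for w i using that by blast
    show "e \<in> ?A \<times> ?B \<union> ?B \<times> ?A"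
    proof (cases "even n")
      case True
      then have "x \<in> ?A" "y \<in> ?B" using A[OF m(1)] B[OF m(2)] by simp_all
      then show ?thesis unfolding xy(1) by blast
    next
      case False
      then have "x \<in> ?B" "y \<in> ?A" using B[OF m(1)] A[OF m(2)] by simp_all
      then show ?thesis unfolding xy(1) by blast
    qed
  qed
  then have "bipartite_graph (cayley_graph G C)"
    unfolding bipartite_graph_def using AB disj
    by (intro exI[of _ ?A] exI[of _ ?B]) (simp add: cayley_graph_def)
  then show False using assms by simp
qed

theorem mainTheorem2:
  fixes \<Gamma> :: "('a, 'b) monoid_scheme" and C :: "'a set"
  assumes "group \<Gamma>" and "finite (carrier \<Gamma>)"
    and "connection_set \<Gamma> C"
    and "Digraph_Component.connected (with_proj (cayley_graph \<Gamma> C))"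
    and "\<not> bipartite_graph (cayley_graph \<Gamma> C)"
    and "even (card (pverts (cayley_graph \<Gamma> C)))"
    and "card C \<ge> 5"
  shows "extendable 2 (cayley_graph \<Gamma> C)"
proof -
  let ?X = "cayley_graph \<Gamma> C"
  interpret group \<Gamma> by fact
  interpret cayley \<Gamma> C
  proof
    show "finite (carrier \<Gamma>)" by fact
    show "C \<subseteq> carrier \<Gamma>" "\<one>\<^bsub>\<Gamma>\<^esub> \<notin> C" "\<And>c. c \<in> C \<Longrightarrow> inv\<^bsub>\<Gamma>\<^esub> c \<in> C"
      using assms(3) by (auto simp: connection_set_def)
    show "U = carrier \<Gamma>" if "U \<subseteq> carrier \<Gamma>" "\<one>\<^bsub>\<Gamma>\<^esub> \<in> U" "\<And>x c. x \<in> U \<Longrightarrow> c \<in> C \<Longrightarrow> x \<otimes>\<^bsub>\<Gamma>\<^esub> c \<in> U" for U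
      using connected_cayley_generates[OF assms(1,3,4)] that by blast
  qed
  have verts: "pverts ?X = carrier \<Gamma>" by (simp add: cayley_graph_def)
  have edges: "e \<in> graph_edges ?X \<longleftrightarrow> (\<exists>x y. e = {x, y} \<and> adj x y)" for e
    by (auto simp: graph_edges_def cayley_graph_def adj_def image_iff)
  have ev: "even (card (carrier \<Gamma>))" using assms(6) verts by simp
  have oddw: "\<exists>n. odd n \<and> \<one>\<^bsub>\<Gamma>\<^esub> \<in> walk n" by (rule odd_walk_if_not_bipartite[OF assms(5)])
  have card6: "5 < card (carrier \<Gamma>)"
  proof -
    have "card (insert \<one>\<^bsub>\<Gamma>\<^esub> C) \<le> card (carrier \<Gamma>)" using C_sub fin by (intro card_mono) auto
    then show ?thesis using C_one finC assms(7) by simp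
  qed
  have pm: "\<exists>P. perfect_matching ?X P \<and> {{u1, u2}, {v1, v2}} \<subseteq> P"
    if uv: "card {u1, u2, v1, v2} = 4" "adj u1 u2" "adj v1 v2" for u1 u2 v1 v2
  proof -
    obtain N where N: "perfectly_matched adj (carrier \<Gamma> - {u1, u2, v1, v2}) N"
      using two_edges_extend[OF ev assms(7) oddw uv] by blast
    let ?P = "insert {u1, u2} (insert {v1, v2} N)"
    have d: "disjnt {u1, u2} {v1, v2}"
      using uv(1) by (auto simp: disjnt_def card_insert_if split: if_splits)
    have UN: "\<Union>N = carrier \<Gamma> - {u1, u2, v1, v2}" using N by (simp add: perfectly_matched_def)
    have "e \<in> graph_edges ?X" if e: "e \<in> ?P" for e
    proof -
      have "\<exists>x y. e = {x, y} \<and> adj x y" if "e \<in> N"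
        using N that unfolding perfectly_matched_def by blast
      then show ?thesis unfolding edges using e uv(2,3) by blast
    qed
    moreover have "pairwise disjnt ?P"
    proof -
      have "disjnt {u1, u2} e" "disjnt {v1, v2} e" "disjnt e {u1, u2}" "disjnt e {v1, v2}" if "e \<in> N" for e
        using that UN by (auto simp: disjnt_def)
      then show ?thesis
        using N d unfolding perfectly_matched_def pairwise_insert by (auto simp: disjnt_sym)
    qed
    moreover have "\<Union>?P = carrier \<Gamma>" using UN uv by (auto simp: adj_def)
    ultimately have "perfect_matching ?X ?P"
      unfolding perfect_matching_def graph_matching_def verts by blast
    then show ?thesis by blast
  qed
  have ext: "\<exists>P. perfect_matching ?X P \<and> M \<subseteq> P" if M: "graph_matching ?X M" "card M = 2" for M
  proof -
    obtain e f where ef: "M = {e, f}" "e \<noteq> f" using M(2) by (auto simp: card_2_iff)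
    have "e \<in> graph_edges ?X" "f \<in> graph_edges ?X" "disjnt e f"
      using M(1) ef by (auto simp: graph_matching_def pairwise_def)
    then obtain u1 u2 v1 v2 where uv: "e = {u1, u2}" "f = {v1, v2}" "adj u1 u2" "adj v1 v2"
      unfolding edges by (elim exE conjE)
    have "u1 \<noteq> u2" "v1 \<noteq> v2" using uv(3,4) adj_neq by blast+
    moreover have "u1 \<notin> {v1, v2}" "u2 \<notin> {v1, v2}"
      using \<open>disjnt e f\<close> unfolding uv(1,2) disjnt_def by blast+
    ultimately have "card {u1, u2, v1, v2} = 4" by simp
    then show ?thesis using pm[OF _ uv(3,4)] uv ef by simp
  qed
  \<comment> \<open>It suffices to extend two independent edges: one at the identity and one at a
    vertex \<open>v\<close> off that edge, since degree at least 5 leaves a neighbour of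
    \<open>v\<close> off it as well.\<close>
  have "\<exists>P. perfect_matching ?X P"
  proof -
    obtain c where c: "c \<in> C" using assms(7) by fastforce
    let ?e = "{\<one>\<^bsub>\<Gamma>\<^esub>, c}"
    have a1: "adj \<one>\<^bsub>\<Gamma>\<^esub> c" using adj_mult[of "\<one>\<^bsub>\<Gamma>\<^esub>" c] c C_carrier by simp
    have ce: "card ?e \<le> 2" by (simp add: card_insert_if)
    have "\<not> carrier \<Gamma> \<subseteq> ?e"
      using card_mono[of ?e "carrier \<Gamma>"] ce card6 by auto
    then obtain v where v: "v \<in> carrier \<Gamma>" "v \<notin> ?e" by blast
    have "card ((\<otimes>\<^bsub>\<Gamma>\<^esub>) v ` C) = card C" using v C_sub by (intro card_translate)
    then have "\<not> (\<otimes>\<^bsub>\<Gamma>\<^esub>) v ` C \<subseteq> ?e"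
      using card_mono[of ?e "(\<otimes>\<^bsub>\<Gamma>\<^esub>) v ` C"] ce assms(7) by auto
    then obtain d where d: "d \<in> C" "v \<otimes>\<^bsub>\<Gamma>\<^esub> d \<notin> ?e" by blast
    have a2: "adj v (v \<otimes>\<^bsub>\<Gamma>\<^esub> d)" using adj_mult v(1) d(1) by blast
    have "card {\<one>\<^bsub>\<Gamma>\<^esub>, c, v, v \<otimes>\<^bsub>\<Gamma>\<^esub> d} = 4"
      using adj_neq[OF a1] adj_neq[OF a2] v(2) d(2) by auto
    then show ?thesis using pm[OF _ a1 a2] by blast
  qed
  moreover have "pair_graph ?X" by (rule pair_graph_cayley_graph[OF assms(1-3)])
  ultimately show ?thesis
    unfolding extendable_def using assms(4,6) ext card6 verts by auto
qed

end
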